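(* Let $\theta$ be a complex number such that $\theta\notin\mathbb{Q}(i)$ and let $\varepsilon>0$ be an arbitrary constant. Then there exists an infinite increasing sequence of natural numbers $(N_k)_{k\in\mathbb{N}}$ such that, for every sequence of real numbers $(\delta_k)_{k\in\mathbb{N}}$ with $$N_k^{-1/24+\varepsilon}\le \delta_k\le 1/2 \quad\text{for all } k\in\mathbb{N},$$ one has $$\sum_{\substack{N_k/2<\mathcal{N}(p)\le N_k\\ \|p\theta\|\le \delta_k}} 1 \;\sim\; 4\delta_k^2\cdot \sum_{N_k/2<\mathcal{N}(p)\le N_k} 1 \quad\text{as } k\to\infty,$$ where both sums run over Gaussian primes $p$.
   Context: $\mathbb{Z}[i]$ is the ring of Gaussian integers, and $\mathcal{N}(n)=|n|^2$ denotes the norm of $n\in\mathbb{Z}[i]$. A Gaussian prime is a prime element of $\mathbb{Z}[i]$; sums over Gaussian primes run over all prime elements, with associates counted separately. For a real number $x$, $\|x\|$ denotes the distance from $x$ to the nearest integer. For a complex number $z$, $\|z\|:=\max\{\|\Re(z)\|,\|\Im(z)\|\}$, where $\Re(z)$ and $\Im(z)$ are the real and imaginary parts of $z$ (so $\|z\|$ is the supremum-norm distance from $z$ to the nearest Gaussian integer). The notation $f_k\sim g_k$ as $k\to\infty$ means $f_k/g_k\to 1$. *)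

theory Defs
  imports Complex_Main "HOL-Library.Landau_Symbols" "HOL-Computational_Algebra.Factorial_Ring"
begin

datatype gauss_int = Gauss_Int (gre: int) (gim: int)

instantiation gauss_int :: comm_ring_1
begin

definition "0 = Gauss_Int 0 0"
definition "1 = Gauss_Int 1 0"
definition "x + y = Gauss_Int (gre x + gre y) (gim x + gim y)"
definition "- x = Gauss_Int (- gre x) (- gim x)"
definition "x - y = Gauss_Int (gre x - gre y) (gim x - gim y)"
definition "x * y = Gauss_Int (gre x * gre y - gim x * gim y) (gre x * gim y + gim x * gre y)"

instance
  by standard
    (auto simp: zero_gauss_int_def one_gauss_int_def plus_gauss_int_def uminus_gauss_int_def
      minus_gauss_int_def times_gauss_int_def algebra_simps)

end

definition complex_of_gauss :: "gauss_int \<Rightarrow> complex" where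
  "complex_of_gauss z = Complex (of_int (gre z)) (of_int (gim z))"

lemma complex_of_gauss_hom:
  "complex_of_gauss 0 = 0"
  "complex_of_gauss 1 = 1"
  "complex_of_gauss (x + y) = complex_of_gauss x + complex_of_gauss y"
  "complex_of_gauss (- x) = - complex_of_gauss x"
  "complex_of_gauss (x - y) = complex_of_gauss x - complex_of_gauss y"
  "complex_of_gauss (x * y) = complex_of_gauss x * complex_of_gauss y"
  by (simp_all add: complex_of_gauss_def complex_eq_iff zero_gauss_int_def one_gauss_int_def
      plus_gauss_int_def uminus_gauss_int_def minus_gauss_int_def times_gauss_int_def)

lemma inj_complex_of_gauss: "inj complex_of_gauss"
  by (rule injI) (simp add: complex_of_gauss_def gauss_int.expand)

definition gauss_norm :: "gauss_int \<Rightarrow> real" where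
  "gauss_norm z = (cmod (complex_of_gauss z))\<^sup>2"

definition gauss_rats :: "complex set" where
  "gauss_rats = {of_rat a + of_rat b * \<i> | a b. True}"

definition dist_int :: "real \<Rightarrow> real" where
  "dist_int x = \<bar>x - of_int (round x)\<bar>"

definition dist_gauss :: "complex \<Rightarrow> real" where
  "dist_gauss z = max (dist_int (Re z)) (dist_int (Im z))"

text \<open>Associates are counted separately. The finiteness lemma is needed for sums over this set
  to be meaningful, since sums over infinite sets are 0 by convention.\<close>

definition gauss_primes_dyadic :: "nat \<Rightarrow> gauss_int set" where
  "gauss_primes_dyadic N = {p. prime_elem p \<and> real N / 2 < gauss_norm p \<and> gauss_norm p \<le> real N}"

lemma finite_gauss_primes_dyadic: "finite (gauss_primes_dyadic N)"
proof (rule finite_subset)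
  have "\<bar>a\<bar> \<le> int N" if "real_of_int a ^ 2 + real_of_int b ^ 2 \<le> real N" for a b :: int
  proof -
    have "real_of_int (a ^ 2 + b ^ 2) \<le> real_of_int (int N)" using that by simp
    then have "a ^ 2 + b ^ 2 \<le> int N" by (simp only: of_int_le_iff)
    moreover have "\<bar>a\<bar> \<le> a ^ 2"
      using self_le_power[of "\<bar>a\<bar>" 2] by (cases "a = 0") auto
    ultimately show ?thesis by (smt (verit) zero_le_power2)
  qed
  from this this[OF _[unfolded add.commute]]
  have "\<bar>gre p\<bar> \<le> int N \<and> \<bar>gim p\<bar> \<le> int N" if "gauss_norm p \<le> real N" for p
    using that by (simp add: gauss_norm_def complex_of_gauss_def cmod_power2 add.commute)
  then have "gre p \<in> {- int N..int N} \<and> gim p \<in> {- int N..int N}" if "gauss_norm p \<le> real N" for p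
    using that by force
  then show "gauss_primes_dyadic N \<subseteq> case_prod Gauss_Int ` ({- int N..int N} \<times> {- int N..int N})"
    unfolding gauss_primes_dyadic_def
    by (auto intro!: image_eqI[where x = "(gre p, gim p)" for p])
qed simp

end

theory Submission
  imports Defs "HOL-Analysis.Analysis" "HOL-Computational_Algebra.Euclidean_Algorithm"
    "HOL-Real_Asymp.Real_Asymp"
begin

text \<open>Detecting \<open>\<parallel>p \<theta>\<parallel> \<le> \<delta>\<close> by trigonometric polynomials of degree \<open>H\<close> slightly larger than
  \<open>1/\<delta>\<close> reduces the claim to a bound of size \<open>N\<^bsup>11/12 + o(1)\<^esup>\<close> for each of the sums of
  \<open>e(Re (h p \<theta>))\<close> over Gaussian primes \<open>p\<close>, where \<open>h \<noteq> 0\<close> is a Gaussian integer with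
  \<open>\<bar>h\<bar> \<le> H\<close>. If \<open>a/q\<close> is a good approximation to \<open>\<theta>\<close>, then the points \<open>k \<theta>\<close> with
  \<open>\<bar>k\<bar>\<close> small compared to \<open>\<bar>q\<bar>\<close> are well spaced modulo the Gaussian integers, and so are the
  points \<open>k h \<theta>\<close> for \<open>\<bar>k\<bar>\<close> small compared to \<open>\<bar>q\<bar> / H\<close>. Vaughan's identity with cut-off
  \<open>N\<^bsup>1/6\<^esup>\<close> turns the prime sum into Type I sums and into bilinear sums whose longer variable has norm
  between \<open>N\<^bsup>1/2\<^esup>\<close> and \<open>N\<^bsup>5/6\<^esup>\<close>; the spacing bounds both as soon as \<open>\<bar>q\<bar>\<close> lies between
  about \<open>N\<^bsup>1/6\<^esup>\<close> and \<open>N\<^bsup>1/5\<^esup>\<close>. This freedom in the choice of \<open>N\<close> is used to avoid the prime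
  number theorem: the count of lattice points in a disc and the identity \<open>\<Lambda> * 1 = ln\<close> give a power of
  two \<open>N\<close> in that range with many Gaussian primes of norm in \<open>(N/2, N]\<close>.\<close>


subsection \<open>The Euclidean ring of Gaussian integers\<close>

text \<open>Where the exponents come from. Detection with H about 1/\<delta> involves about H^2
  frequencies, each with error N^(11/12), while main term and error share the density \<delta>^2.
  Hence H^2 must stay below N^(1/12), and this is the exponent 1/24. The bilinear sums have squared
  size about N * (N/U), and U = N^(1/6) makes its root N^(11/12). Dilating \<theta> by h divides the
  range of the spacing by the norm of h, up to N^(1/12), but leaves the spacing itself alone. A
  denominator of norm n therefore needs n at least about N^(1/3), to keep N^(1/4) after the
  dilation, and at most N^(2/5), since terms with the inverse square of the spacing 1/sqrt n
  tolerate little beyond N^(1/5) for sqrt n. Solved for N, this is the window from n^(5/2) to 2 n^3.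
  Since n^3 = (n^(5/2))^(6/5), primes are wanted between X and about X^(6/5). Elementary estimates
  find them because errors of one percent stay well below the gain of a factor 6/5 in the
  logarithm.\<close>

lemma complex_of_gauss_inject [simp]: "complex_of_gauss x = complex_of_gauss y \<longleftrightarrow> x = y"
  using inj_complex_of_gauss by (auto dest: injD)

lemma complex_of_gauss_eq_0_iff [simp]: "complex_of_gauss x = 0 \<longleftrightarrow> x = 0"
  using complex_of_gauss_inject[of x 0] by (simp only: complex_of_gauss_hom)

lemma gauss_norm_altdef: "gauss_norm z = (of_int (gre z))\<^sup>2 + (of_int (gim z))\<^sup>2"
  by (simp add: gauss_norm_def complex_of_gauss_def cmod_power2)

lemma Re_complex_of_gauss [simp]: "Re (complex_of_gauss z) = of_int (gre z)"
  and Im_complex_of_gauss [simp]: "Im (complex_of_gauss z) = of_int (gim z)"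
  by (simp_all add: complex_of_gauss_def)

lemma gauss_norm_mult: "gauss_norm (x * y) = gauss_norm x * gauss_norm y"
  by (simp add: gauss_norm_def complex_of_gauss_hom norm_mult power_mult_distrib)

lemma gauss_norm_0 [simp]: "gauss_norm 0 = 0" and gauss_norm_1 [simp]: "gauss_norm 1 = 1"
  by (simp_all add: gauss_norm_def complex_of_gauss_hom)

lemma gauss_norm_nonneg [simp]: "gauss_norm z \<ge> 0"
  by (simp add: gauss_norm_def)

lemma gauss_norm_eq_0_iff [simp]: "gauss_norm z = 0 \<longleftrightarrow> z = 0"
  by (simp add: gauss_norm_def)

lemma gauss_norm_int: "gauss_norm z = of_int ((gre z)\<^sup>2 + (gim z)\<^sup>2)"
  by (simp add: gauss_norm_altdef)

lemma gauss_norm_ge_1: "z \<noteq> 0 \<Longrightarrow> gauss_norm z \<ge> 1"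
proof -
  assume "z \<noteq> 0"
  then have "gauss_norm z > 0" by (metis gauss_norm_eq_0_iff gauss_norm_nonneg order_le_less)
  then have "(gre z)\<^sup>2 + (gim z)\<^sup>2 > 0" unfolding gauss_norm_int by linarith
  then show ?thesis unfolding gauss_norm_int by linarith
qed

lemma gauss_norm_pos: "z \<noteq> 0 \<Longrightarrow> gauss_norm z > 0"
  using gauss_norm_ge_1[of z] by simp

lemma gauss_norm_ge_1_iff [simp]: "gauss_norm z \<ge> 1 \<longleftrightarrow> z \<noteq> 0"
  using gauss_norm_ge_1[of z] by auto

instance gauss_int :: idom
proof
  fix a b :: gauss_int
  assume "a \<noteq> 0" "b \<noteq> 0"
  then show "a * b \<noteq> 0"
    by (metis complex_of_gauss_eq_0_iff complex_of_gauss_hom(6) mult_eq_0_iff)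
qed

instantiation gauss_int :: normalization_euclidean_semiring
begin

definition divide_gauss_int :: "gauss_int \<Rightarrow> gauss_int \<Rightarrow> gauss_int" where
  "divide_gauss_int x y = (let q = complex_of_gauss x / complex_of_gauss y in Gauss_Int (round (Re q)) (round (Im q)))"

definition modulo_gauss_int :: "gauss_int \<Rightarrow> gauss_int \<Rightarrow> gauss_int" where
  "modulo_gauss_int x y = x - x div y * y"

definition euclidean_size_gauss_int :: "gauss_int \<Rightarrow> nat" where
  "euclidean_size_gauss_int z = nat ((gre z)\<^sup>2 + (gim z)\<^sup>2)"

text \<open>The cases are four half-open quadrants which multiplication by i permutes cyclically, so
  every nonzero element has exactly one associate with \<open>gre\<close> positive and
  \<open>gim\<close> nonnegative.\<close>

definition unit_factor_gauss_int :: "gauss_int \<Rightarrow> gauss_int" where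
  "unit_factor_gauss_int z =
    (if z = 0 then 0
     else if gre z > 0 \<and> gim z \<ge> 0 then 1
     else if gre z \<le> 0 \<and> gim z > 0 then Gauss_Int 0 1
     else if gre z < 0 \<and> gim z \<le> 0 then - 1
     else Gauss_Int 0 (- 1))"

definition normalize_gauss_int :: "gauss_int \<Rightarrow> gauss_int" where
  "normalize_gauss_int z = z div unit_factor z"

lemma real_euclidean_size_gauss_int: "real (euclidean_size z) = gauss_norm z"
  by (simp add: euclidean_size_gauss_int_def gauss_norm_int)

text \<open>Rounding the exact quotient errs by at most 1/2 in each coordinate, hence by at most 1/2
  in squared modulus. This makes division by the nearest point Euclidean.\<close>

lemma gauss_norm_mod_less:
  fixes x y :: gauss_int
  assumes "y \<noteq> 0"
  shows "gauss_norm (x mod y) < gauss_norm y"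
proof -
  define q where "q = complex_of_gauss x / complex_of_gauss y"
  have x: "complex_of_gauss x = q * complex_of_gauss y" using assms by (simp add: q_def)
  have "complex_of_gauss (x mod y) = (q - complex_of_gauss (x div y)) * complex_of_gauss y"
    by (simp add: modulo_gauss_int_def complex_of_gauss_hom x algebra_simps)
  moreover have "(cmod (q - complex_of_gauss (x div y)))\<^sup>2 \<le> 1/2"
  proof -
    have *: "(t - of_int (round t))\<^sup>2 \<le> 1 / 4" for t :: real
      using power_mono[OF of_int_round_abs_le[of t], of 2] by (simp add: abs_minus_commute power2_eq_square)
    show ?thesis using *[of "Re q"] *[of "Im q"]
      by (simp add: divide_gauss_int_def Let_def cmod_power2 flip: q_def)
  qed
  ultimately have "gauss_norm (x mod y) \<le> 1/2 * gauss_norm y"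
    unfolding gauss_norm_def using mult_right_mono[of _ "1/2" "(cmod (complex_of_gauss y))\<^sup>2"]
    by (simp add: norm_mult power_mult_distrib)
  then show ?thesis using gauss_norm_pos[OF assms] by linarith
qed

lemma gauss_int_unit_cases:
  fixes u :: gauss_int
  assumes "u dvd 1"
  shows "u \<in> {1, -1, Gauss_Int 0 1, Gauss_Int 0 (-1)}"
proof -
  obtain v where v: "1 = u * v" using assms by (meson dvdE)
  then have "u \<noteq> 0" "v \<noteq> 0" by auto
  have "gauss_norm u * gauss_norm v = 1" using v by (metis gauss_norm_1 gauss_norm_mult)
  moreover have "gauss_norm u * gauss_norm v \<ge> gauss_norm u * 1"
    using gauss_norm_ge_1[OF \<open>v \<noteq> 0\<close>] by (intro mult_left_mono) auto
  ultimately have "gauss_norm u \<le> 1" by simp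
  then have le: "(gre u)\<^sup>2 + (gim u)\<^sup>2 \<le> 1" unfolding gauss_norm_int by linarith
  have *: "a = 0 \<or> a = 1 \<or> a = - 1" if "a\<^sup>2 \<le> 1" for a :: int
    using that abs_square_le_1[of a] by auto
  have "gre u = 0 \<or> gre u = 1 \<or> gre u = -1"
    using le zero_le_power2[of "gim u"] by (intro *) linarith
  moreover have "gim u = 0 \<or> gim u = 1 \<or> gim u = -1"
    using le zero_le_power2[of "gre u"] by (intro *) linarith
  ultimately show ?thesis using le \<open>u \<noteq> 0\<close>
    by (cases u) (auto simp: one_gauss_int_def uminus_gauss_int_def zero_gauss_int_def)
qed

lemma gauss_int_units_dvd: "Gauss_Int 0 1 dvd 1" "Gauss_Int 0 (-1) dvd 1"
  by (rule dvdI[of _ _ "Gauss_Int 0 (-1)"]; simp add: times_gauss_int_def one_gauss_int_def)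
     (rule dvdI[of _ _ "Gauss_Int 0 1"]; simp add: times_gauss_int_def one_gauss_int_def)

lemma mult_div_cancel_gauss_int: "b \<noteq> 0 \<Longrightarrow> a * b div b = (a :: gauss_int)"
  by (simp add: divide_gauss_int_def complex_of_gauss_hom)

instance
proof
  fix a b :: gauss_int
  show "a * b div b = a" if "b \<noteq> 0"
    using that by (rule mult_div_cancel_gauss_int)
  show "a div 0 = 0"
    by (simp add: divide_gauss_int_def complex_of_gauss_hom) (simp add: zero_gauss_int_def)
  show "a div b * b + a mod b = a" by (simp add: modulo_gauss_int_def)
  show "euclidean_size (0 :: gauss_int) = 0"
    by (simp add: euclidean_size_gauss_int_def zero_gauss_int_def)
  show "euclidean_size (a mod b) < euclidean_size b" if "b \<noteq> 0"
    using gauss_norm_mod_less[OF that, of a] by (simp flip: real_euclidean_size_gauss_int)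
  show "euclidean_size a \<le> euclidean_size (a * b)" if "b \<noteq> 0"
  proof -
    have "gauss_norm a * 1 \<le> gauss_norm a * gauss_norm b"
      using gauss_norm_ge_1[OF that] by (intro mult_left_mono) auto
    then have "gauss_norm a \<le> gauss_norm (a * b)" by (simp add: gauss_norm_mult)
    then show ?thesis by (metis of_nat_le_iff real_euclidean_size_gauss_int)
  qed
  show "unit_factor (0 :: gauss_int) = 0" by (simp add: unit_factor_gauss_int_def)
  show "unit_factor a = a" if "a dvd 1"
    using gauss_int_unit_cases[OF that]
    by (auto simp: unit_factor_gauss_int_def one_gauss_int_def zero_gauss_int_def uminus_gauss_int_def)
  show unit: "unit_factor a dvd 1" if "a \<noteq> 0" for a :: gauss_int
    using that gauss_int_units_dvd by (auto simp: unit_factor_gauss_int_def)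
  show "unit_factor (a * b) = a * unit_factor b" if a: "a dvd 1"
  proof -
    obtain x y where b: "b = Gauss_Int x y" by (cases b)
    consider "a = Gauss_Int 1 0" | "a = Gauss_Int (-1) 0" | "a = Gauss_Int 0 1" | "a = Gauss_Int 0 (-1)"
      using gauss_int_unit_cases[OF a] by (auto simp: one_gauss_int_def uminus_gauss_int_def)
    then show ?thesis unfolding b
      by cases (simp_all add: unit_factor_gauss_int_def one_gauss_int_def zero_gauss_int_def
       uminus_gauss_int_def times_gauss_int_def, linarith+)
  qed
  show "normalize (0 :: gauss_int) = 0"
    by (simp add: normalize_gauss_int_def unit_factor_gauss_int_def divide_gauss_int_def
      complex_of_gauss_hom) (simp add: zero_gauss_int_def)
  show "unit_factor a * normalize a = a"
  proof (cases "a = 0")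
    case False
    then obtain v where v: "1 = unit_factor a * v" using unit by (meson dvdE)
    then have nz: "unit_factor a \<noteq> 0" by auto
    have a: "a = (v * a) * unit_factor a" using v by (metis mult.commute mult.left_commute mult_1)
    have "a div unit_factor a = v * a"
      by (subst a) (rule mult_div_cancel_gauss_int[OF nz])
    then show ?thesis using a by (metis mult.commute normalize_gauss_int_def)
  qed (simp add: unit_factor_gauss_int_def)
qed

end

instantiation gauss_int :: euclidean_ring_gcd
begin

definition "gcd_gauss_int = (Euclidean_Algorithm.gcd :: gauss_int \<Rightarrow> _)"
definition "lcm_gauss_int = (Euclidean_Algorithm.lcm :: gauss_int \<Rightarrow> _)"
definition "Gcd_gauss_int = (Euclidean_Algorithm.Gcd :: gauss_int set \<Rightarrow> _)"
definition "Lcm_gauss_int = (Euclidean_Algorithm.Lcm :: gauss_int set \<Rightarrow> _)"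

instance
  by standard (simp_all add: gcd_gauss_int_def lcm_gauss_int_def Gcd_gauss_int_def Lcm_gauss_int_def)

end

subsection \<open>Divisor sums and Vaughan's identity\<close>

lemma gauss_norm_normalize [simp]: "gauss_norm (normalize z) = gauss_norm z"
proof (cases "z = 0")
  case False
  have *: "gauss_norm (unit_factor z) = 1"
    using gauss_int_unit_cases[OF unit_factor_is_unit[OF False]]
    by (auto simp: gauss_norm_altdef one_gauss_int_def uminus_gauss_int_def)
  show ?thesis using gauss_norm_mult[of "unit_factor z" "normalize z"] * by simp
qed simp

lemma gauss_norm_dvd_le: "d dvd n \<Longrightarrow> n \<noteq> 0 \<Longrightarrow> gauss_norm d \<le> gauss_norm n"
proof (elim dvdE)
  fix k assume "n \<noteq> 0" "n = d * k"
  then have "1 \<le> gauss_norm k" by auto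
  then have "gauss_norm d * 1 \<le> gauss_norm d * gauss_norm k" by (intro mult_left_mono) auto
  then show ?thesis using \<open>n = d * k\<close> by (simp add: gauss_norm_mult)
qed

lemma gauss_norm_prod: "gauss_norm (prod f A) = (\<Prod>x\<in>A. gauss_norm (f x))"
  by (induction A rule: infinite_finite_induct) (auto simp: gauss_norm_mult)

lemma gauss_norm_power: "gauss_norm (z ^ k) = gauss_norm z ^ k"
  by (induction k) (auto simp: gauss_norm_mult)

section \<open>Norm discs, norm annuli and canonical divisors\<close>

definition gball :: "real \<Rightarrow> gauss_int set" where
  "gball B = {n. gauss_norm n \<le> B}"

definition gann :: "real \<Rightarrow> real \<Rightarrow> gauss_int set" where
  "gann A B = {n. A < gauss_norm n \<and> gauss_norm n \<le> B}"

lemma gball_subset_box: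
  "gball B \<subseteq> case_prod Gauss_Int ` ({- \<lfloor>sqrt B\<rfloor>..\<lfloor>sqrt B\<rfloor>} \<times> {- \<lfloor>sqrt B\<rfloor>..\<lfloor>sqrt B\<rfloor>})"
proof
  fix z assume z: "z \<in> gball B"
  have *: "a \<in> {- \<lfloor>sqrt B\<rfloor>..\<lfloor>sqrt B\<rfloor>}" if "(of_int a :: real)\<^sup>2 \<le> B" for a :: int
  proof -
    have "\<bar>of_int a\<bar> \<le> sqrt B" using that real_le_rsqrt by (simp add: real_le_rsqrt)
    then have "\<bar>a\<bar> \<le> \<lfloor>sqrt B\<rfloor>" by (simp add: le_floor_iff)
    then show ?thesis by auto
  qed
  have "(of_int (gre z) :: real)\<^sup>2 \<le> B" "(of_int (gim z) :: real)\<^sup>2 \<le> B"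
    using z by (auto simp: gball_def gauss_norm_altdef intro: order_trans[rotated])
  then show "z \<in> case_prod Gauss_Int ` ({- \<lfloor>sqrt B\<rfloor>..\<lfloor>sqrt B\<rfloor>} \<times> {- \<lfloor>sqrt B\<rfloor>..\<lfloor>sqrt B\<rfloor>})"
    by (intro image_eqI[of _ _ "(gre z, gim z)"]) (auto dest: *)
qed

lemma finite_gball [simp, intro]: "finite (gball B)"
  by (rule finite_subset[OF gball_subset_box]) auto

lemma gann_subset_gball: "gann A B \<subseteq> gball B"
  by (auto simp: gann_def gball_def)

lemma finite_gann [simp, intro]: "finite (gann A B)"
  by (rule finite_subset[OF gann_subset_gball]) auto

lemma card_gball_le: "B \<ge> 1 \<Longrightarrow> real (card (gball B)) \<le> 9 * B"
proof -
  assume B: "B \<ge> 1"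
  let ?r = "\<lfloor>sqrt B\<rfloor>"
  have r: "?r \<ge> 1" using B by (simp add: le_floor_iff)
  have "card (gball B) \<le> card ({- ?r..?r} \<times> {- ?r..?r})"
    using card_mono[OF _ gball_subset_box] card_image_le[of "{- ?r..?r} \<times> {- ?r..?r}" "case_prod Gauss_Int"]
    by (meson finite_SigmaI finite_atLeastAtMost_int finite_imageI order_trans)
  also have "\<dots> = nat (2 * ?r + 1) ^ 2" by (simp add: power2_eq_square)
  finally have "real (card (gball B)) \<le> real (nat (2 * ?r + 1) ^ 2)" by linarith
  also have "\<dots> = (2 * of_int ?r + 1) ^ 2" using r by simp
  also have "\<dots> \<le> (2 * sqrt B + sqrt B) ^ 2"
    using r B by (intro power_mono add_mono) auto
  also have "\<dots> = 9 * B" using B by (simp add: power_mult_distrib flip: distrib_right)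
  finally show ?thesis .
qed

text \<open>Convolutions are written \<open>n = d * m\<close> with \<open>d\<close> a canonical associate and \<open>m\<close> arbitrary. Every
  class of divisors is then counted once, while the free variable \<open>m\<close> runs over a full annulus.\<close>

definition gcanon :: "gauss_int set" where
  "gcanon = {d. d \<noteq> 0 \<and> normalize d = d}"

definition gdiv :: "gauss_int \<Rightarrow> gauss_int set" where
  "gdiv n = {d. d dvd n \<and> normalize d = d}"

lemma gdiv_subset_gball: "n \<noteq> 0 \<Longrightarrow> gdiv n \<subseteq> gball (gauss_norm n)"
  by (auto simp: gdiv_def gball_def gauss_norm_dvd_le)

lemma finite_gdiv [simp, intro]: "n \<noteq> 0 \<Longrightarrow> finite (gdiv n)"
  by (rule finite_subset[OF gdiv_subset_gball]) auto

text \<open>Unique factorization. It turns sums over divisors into sums over sub-multisets of one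
  multiset, where the identities for the von Mangoldt and Moebius functions become
  combinatorial.\<close>

lemma bij_betw_gdiv:
  assumes "n \<noteq> 0"
  shows "bij_betw prime_factorization (gdiv n) {A. A \<subseteq># prime_factorization n}"
proof (rule bij_betwI')
  fix x y assume "x \<in> gdiv n" "y \<in> gdiv n"
  then have "x \<noteq> 0" "y \<noteq> 0" "normalize x = x" "normalize y = y"
    using assms by (auto simp: gdiv_def)
  then show "(prime_factorization x = prime_factorization y) = (x = y)"
    by (metis prod_mset_prime_factorization_weak)
next
  fix x assume "x \<in> gdiv n"
  then show "prime_factorization x \<in> {A. A \<subseteq># prime_factorization n}"
    using assms by (auto simp: gdiv_def prime_factorization_subset_iff_dvd)
next
  fix A assume "A \<in> {A. A \<subseteq># prime_factorization n}"
  then have A: "A \<subseteq># prime_factorization n" by simp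
  have pr: "prime p" if "p \<in># A" for p
    using that A by (meson in_prime_factors_imp_prime mset_subset_eqD)
  then have pf: "prime_factorization (prod_mset A) = A"
    by (intro prime_factorization_prod_mset_primes)
  moreover have "prod_mset A \<noteq> 0" using pr[of 0] by (auto simp: prod_mset_zero_iff)
  ultimately have "prod_mset A dvd n"
    using A assms prime_factorization_subset_iff_dvd by metis
  \<comment> \<open>A product of canonical primes need not be canonical: (2 + i)(1 + 2i) = 5i. Hence
    the \<open>normalize\<close> in the witness.\<close>
  then show "\<exists>x\<in>gdiv n. A = prime_factorization x"
    using pf by (intro bexI[of _ "normalize (prod_mset A)"])
       (auto simp: gdiv_def prime_factorization_normalize)
qed

text \<open>A set of prime factors is a singleton exactly for a unit times a positive power of a
  prime. Prime factors do not see units, so all associates receive the same value; at 0 and at units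
  the value is 0.\<close>

definition gmangoldt :: "gauss_int \<Rightarrow> real" where
  "gmangoldt d = (if is_singleton (prime_factors d) then ln (gauss_norm (the_elem (prime_factors d))) else 0)"

definition gmoebius :: "gauss_int \<Rightarrow> real" where
  "gmoebius d = (if \<forall>p. count (prime_factorization d) p \<le> 1
     then (- 1) ^ size (prime_factorization d) else 0)"

lemma abs_gmoebius_le: "\<bar>gmoebius d\<bar> \<le> 1"
  by (simp add: gmoebius_def)

lemma gauss_norm_prime_gt_1: "prime p \<Longrightarrow> gauss_norm p > 1"
proof -
  assume p: "prime p"
  have "gauss_norm p \<noteq> 1"
  proof
    assume "gauss_norm p = 1"
    then have eq: "(gre p)\<^sup>2 + (gim p)\<^sup>2 = 1" unfolding gauss_norm_int by linarith
    have "p * Gauss_Int (gre p) (- gim p) = 1"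
      using eq by (simp add: times_gauss_int_def one_gauss_int_def power2_eq_square algebra_simps)
    then have "is_unit p" by (metis dvdI)
    then show False using p by (simp add: not_prime_unit)
  qed
  moreover have "gauss_norm p \<ge> 1" using p by auto
  ultimately show ?thesis by linarith
qed

lemma gmangoldt_nonneg: "gmangoldt d \<ge> 0"
proof (cases "is_singleton (prime_factors d)")
  case True
  then obtain p where p: "prime_factors d = {p}" by (auto simp: is_singleton_def)
  then have "prime p" by (metis in_prime_factors_imp_prime insertI1)
  then show ?thesis using p gauss_norm_prime_gt_1[of p] by (simp add: gmangoldt_def)
qed (simp add: gmangoldt_def)

lemma ln_gauss_norm_conv_prime_factors:
  assumes "n \<noteq> 0"
  shows "ln (gauss_norm n) = (\<Sum>p\<in>prime_factors n. real (count (prime_factorization n) p) * ln (gauss_norm p))"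
proof -
  have "gauss_norm n = gauss_norm (prod_mset (prime_factorization n))"
    by (metis assms gauss_norm_normalize prod_mset_prime_factorization_weak)
  also have "\<dots> = (\<Prod>p\<in>prime_factors n. gauss_norm p ^ count (prime_factorization n) p)"
    by (simp add: prod_mset_multiplicity gauss_norm_prod gauss_norm_power)
  also have "ln \<dots> = (\<Sum>p\<in>prime_factors n. ln (gauss_norm p ^ count (prime_factorization n) p))"
    by (intro ln_prod) (auto intro!: gauss_norm_pos zero_less_power)
  also have "\<dots> = (\<Sum>p\<in>prime_factors n. real (count (prime_factorization n) p) * ln (gauss_norm p))"
    by (intro sum.cong refl ln_realpow)
  finally show ?thesis .
qed

text \<open>Only the sub-multisets \<open>replicate_mset k p\<close> contribute, each with the
  logarithm of the norm of p. A prime p occurs for as many k as its multiplicity in n, which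
  rebuilds the logarithm of the norm of n.\<close>

lemma sum_gmangoldt_gdiv:
  assumes "n \<noteq> 0"
  shows "(\<Sum>d\<in>gdiv n. gmangoldt d) = ln (gauss_norm n)"
proof -
  define M where "M = prime_factorization n"
  define L where "L A = (if is_singleton A then ln (gauss_norm (the_elem A)) else 0)" for A
  \<comment> \<open>Exponents start at 1: for k = 0 all p would give the same empty multiset, and
    injectivity would fail.\<close>
  define T where "T = (SIGMA p:set_mset M. {1..count M p})"
  have fin: "finite {A. A \<subseteq># M}"
    using bij_betw_finite[OF bij_betw_gdiv[OF assms]] assms by (simp add: M_def)
  have inj: "inj_on (\<lambda>(p, k). replicate_mset k p) T"
    by (auto simp: inj_on_def T_def replicate_mset_eq_iff)
  have sub: "(\<lambda>(p, k). replicate_mset k p) ` T \<subseteq> {A. A \<subseteq># M}"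
    by (auto simp: T_def simp flip: count_le_replicate_mset_subset_eq)
  have "(\<Sum>d\<in>gdiv n. gmangoldt d) = (\<Sum>d\<in>gdiv n. L (set_mset (prime_factorization d)))"
    by (simp add: gmangoldt_def L_def)
  also have "\<dots> = (\<Sum>A | A \<subseteq># M. L (set_mset A))"
    using bij_betw_gdiv[OF assms] unfolding M_def by (rule sum.reindex_bij_betw)
  also have "\<dots> = (\<Sum>A\<in>(\<lambda>(p, k). replicate_mset k p) ` T. L (set_mset A))"
  proof (intro sum.mono_neutral_right fin sub ballI)
    fix A assume A: "A \<in> {A. A \<subseteq># M} - (\<lambda>(p, k). replicate_mset k p) ` T"
    have "\<not> is_singleton (set_mset A)"
    proof
      assume "is_singleton (set_mset A)"
      then obtain p where p: "set_mset A = {p}" by (auto simp: is_singleton_def)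
      then have eq: "A = replicate_mset (count A p) p"
        by (intro multiset_eqI) (metis count_eq_zero_iff count_replicate_mset singletonD)
      have "count A p > 0" using p by (simp add: count_greater_zero_iff)
      moreover have "count A p \<le> count M p" using A by (simp add: mset_subset_eq_count)
      ultimately have "(p, count A p) \<in> T" unfolding T_def
        by (auto simp: Suc_le_eq simp flip: count_greater_zero_iff)
      then show False using A eq by force
    qed
    then show "L (set_mset A) = 0" by (simp add: L_def)
  qed
  also have "\<dots> = (\<Sum>(p, k)\<in>T. L (set_mset (replicate_mset k p)))"
    by (subst sum.reindex[OF inj]) (simp add: case_prod_unfold)
  also have "\<dots> = (\<Sum>(p, k)\<in>T. ln (gauss_norm p))"
    by (intro sum.cong refl) (auto simp: T_def L_def)
  also have "\<dots> = (\<Sum>p\<in>set_mset M. \<Sum>k\<in>{1..count M p}. ln (gauss_norm p))"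
    unfolding T_def by (subst sum.Sigma) auto
  also have "\<dots> = ln (gauss_norm n)"
    by (simp add: M_def ln_gauss_norm_conv_prime_factors[OF assms])
  finally show ?thesis .
qed

text \<open>Sub-multisets without repetition are the subsets of the set of prime factors, and their
  alternating sum is the expansion of a product of factors -1 + 1. That product is empty exactly
  when n is a unit.\<close>

lemma sum_gmoebius_gdiv:
  assumes "n \<noteq> 0"
  shows "(\<Sum>d\<in>gdiv n. gmoebius d) = (if is_unit n then 1 else 0)"
proof -
  define M where "M = prime_factorization n"
  define L where "L A = (if \<forall>p. count A p \<le> 1 then (- 1) ^ size A else 0 :: real)" for A :: "gauss_int multiset"
  have fin: "finite {A. A \<subseteq># M}"
    using bij_betw_finite[OF bij_betw_gdiv[OF assms]] assms by (simp add: M_def)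
  have sub: "mset_set ` Pow (set_mset M) \<subseteq> {A. A \<subseteq># M}"
    by (auto simp: subseteq_mset_def count_mset_set' intro: finite_subset)
  have inj: "inj_on mset_set (Pow (set_mset M))"
    by (intro inj_onI) (metis PowD finite_set_mset finite_subset finite_set_mset_mset_set)
  have "(\<Sum>d\<in>gdiv n. gmoebius d) = (\<Sum>d\<in>gdiv n. L (prime_factorization d))"
    by (simp add: gmoebius_def L_def)
  also have "\<dots> = (\<Sum>A | A \<subseteq># M. L A)"
    using bij_betw_gdiv[OF assms] unfolding M_def by (rule sum.reindex_bij_betw)
  also have "\<dots> = (\<Sum>A\<in>mset_set ` Pow (set_mset M). L A)"
  proof (intro sum.mono_neutral_right fin sub ballI)
    fix A assume A: "A \<in> {A. A \<subseteq># M} - mset_set ` Pow (set_mset M)"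
    have "\<not> (\<forall>p. count A p \<le> 1)"
    proof
      assume *: "\<forall>p. count A p \<le> 1"
      have "A = mset_set (set_mset A)"
      proof (intro multiset_eqI)
        fix x
        have "count A x \<le> 1" using * by blast
        then show "count A x = count (mset_set (set_mset A)) x"
        proof (cases "x \<in># A")
          case True
          then have "count A x > 0" by (simp only: count_greater_zero_iff)
          with \<open>count A x \<le> 1\<close> have "count A x = 1" by linarith
          then show ?thesis using True by (simp add: count_mset_set')
        qed (simp add: count_mset_set' not_in_iff)
      qed
      moreover have "set_mset A \<subseteq> set_mset M" using A by (auto dest: mset_subset_eqD)
      ultimately show False using A by blast
    qed
    then show "L A = 0" by (auto simp: L_def)
  qed
  also have "\<dots> = (\<Sum>S\<in>Pow (set_mset M). L (mset_set S))"
    by (subst sum.reindex[OF inj]) simp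
  also have "\<dots> = (\<Sum>S\<in>Pow (set_mset M). (\<Prod>x\<in>S. - 1) * (\<Prod>x\<in>set_mset M - S. 1))"
    by (intro sum.cong refl) (auto simp: L_def count_mset_set' finite_subset[OF _ finite_set_mset])
  also have "\<dots> = (\<Prod>x\<in>set_mset M. - 1 + 1)"
    by (rule prod_add[symmetric]) simp
  also have "\<dots> = (if is_unit n then 1 else 0)"
  proof -
    have "prime_factors n = {} \<longleftrightarrow> is_unit n" using assms by (simp add: prime_factorization_empty_iff)
    then show ?thesis by (cases "is_unit n") (simp_all add: M_def card_gt_0_iff)
  qed
  finally show ?thesis .
qed

section \<open>Double divisor sums and Vaughan's identity\<close>

lemma dvd_div_iff_gauss:
  fixes n d e :: gauss_int
  assumes "n \<noteq> 0" "d dvd n"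
  shows "e dvd n div d \<longleftrightarrow> d * e dvd n"
proof -
  obtain k where k: "n = d * k" using assms by (meson dvdE)
  then show ?thesis using assms by (auto simp: dvd_mult_cancel_left)
qed

text \<open>The description is symmetric in the two divisors, so that a sum over it can be evaluated
  with either of them in the inner sum.\<close>

definition gpairs :: "gauss_int \<Rightarrow> (gauss_int \<times> gauss_int) set" where
  "gpairs n = {(d, e). d \<in> gcanon \<and> e \<in> gcanon \<and> d * e dvd n}"

lemma gpairs_conv_Sigma:
  assumes "n \<noteq> 0"
  shows "gpairs n = (SIGMA d:gdiv n. gdiv (n div d))"
  using assms by (auto simp: gpairs_def gdiv_def gcanon_def dvd_div_iff_gauss dest: dvd_mult_left)

lemma gdiv_div_nonzero: "n \<noteq> 0 \<Longrightarrow> d \<in> gdiv n \<Longrightarrow> n div d \<noteq> 0"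
  by (auto simp: gdiv_def dvd_div_eq_0_iff)

lemma sum_gpairs_left:
  assumes "n \<noteq> 0"
  shows "(\<Sum>(d, e)\<in>gpairs n. F d e) = (\<Sum>d\<in>gdiv n. \<Sum>e\<in>gdiv (n div d). F d e)"
  unfolding gpairs_conv_Sigma[OF assms]
  by (rule sum.Sigma[symmetric]) (use assms in \<open>auto simp: gdiv_div_nonzero\<close>)

lemma sum_gpairs_right:
  assumes "n \<noteq> 0"
  shows "(\<Sum>(d, e)\<in>gpairs n. F d e) = (\<Sum>e\<in>gdiv n. \<Sum>d\<in>gdiv (n div e). F d e)"
proof -
  have "(\<Sum>(d, e)\<in>gpairs n. F d e) = (\<Sum>(e, d)\<in>gpairs n. F d e)"
    by (rule sum.reindex_bij_witness[of _ prod.swap prod.swap])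
       (auto simp: gpairs_def mult.commute)
  then show ?thesis using sum_gpairs_left[OF assms, of "\<lambda>e d. F d e"] by simp
qed

lemma gmangoldt_normalize: "gmangoldt (normalize n) = gmangoldt n"
  by (simp add: gmangoldt_def prime_factorization_normalize)

text \<open>After the Moebius sum over the cofactor has been carried out, only divisors with a unit
  cofactor survive. The single canonical one among them is \<open>normalize n\<close>.\<close>

lemma sum_gmangoldt_unit_quotient:
  assumes "n \<noteq> 0"
  shows "(\<Sum>d\<in>gdiv n. if is_unit (n div d) \<and> P (gauss_norm d) then gmangoldt d else 0) =
    (if P (gauss_norm n) then gmangoldt n else 0)"
proof -
  have *: "is_unit (n div d) \<longleftrightarrow> d = normalize n" if "d \<in> gdiv n" for d
  proof -
    have d: "d dvd n" "normalize d = d" "d \<noteq> 0" using that assms by (auto simp: gdiv_def)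
    have "is_unit (n div d) \<longleftrightarrow> n dvd d"
    proof -
      obtain k where k: "n = d * k" using d by (meson dvdE)
      then have "n dvd d \<longleftrightarrow> d * k dvd d * 1" by simp
      also have "\<dots> \<longleftrightarrow> is_unit k" by (rule dvd_times_left_cancel_iff[OF d(3)])
      finally show ?thesis using k d by simp
    qed
    also have "\<dots> \<longleftrightarrow> d = normalize n"
      using d by (metis associatedI associated_iff_dvd normalize_idem)
    finally show ?thesis .
  qed
  have "(\<Sum>d\<in>gdiv n. if is_unit (n div d) \<and> P (gauss_norm d) then gmangoldt d else 0) =
     (\<Sum>d\<in>gdiv n. if d = normalize n then (if P (gauss_norm n) then gmangoldt n else 0) else 0)"
    by (intro sum.cong refl) (auto simp: * gmangoldt_normalize)
  also have "\<dots> = (if P (gauss_norm n) then gmangoldt n else 0)"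
  proof -
    have "normalize n \<in> gdiv n" by (simp add: gdiv_def)
    then show ?thesis using assms by (simp add: sum.delta)
  qed
  finally show ?thesis .
qed

text \<open>The full sum of \<Lambda>(d) \<mu>(e) over \<open>gpairs n\<close> equals \<Lambda>(n)
  and is split at U in both variables. The part restricted only by d at most U evaluates to 0,
  because n itself lies above U; in the part restricted only by e at most U, the sum over d is a
  logarithm.\<close>

lemma vaughan_identity:
  assumes n: "n \<noteq> 0" and U: "gauss_norm n > U"
  shows "gmangoldt n =
    (\<Sum>e\<in>gdiv n. if gauss_norm e \<le> U then gmoebius e * ln (gauss_norm (n div e)) else 0)
    - (\<Sum>d\<in>gdiv n. \<Sum>e\<in>gdiv (n div d). if gauss_norm d \<le> U \<and> gauss_norm e \<le> U then gmangoldt d * gmoebius e else 0)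
    + (\<Sum>d\<in>gdiv n. \<Sum>e\<in>gdiv (n div d). if gauss_norm d > U \<and> gauss_norm e > U then gmangoldt d * gmoebius e else 0)"
proof -
  define S where "S P = (\<Sum>(d, e)\<in>gpairs n. if P d e then gmangoldt d * gmoebius e else 0)" for P
  have left: "S (\<lambda>d e. P (gauss_norm d)) = (if P (gauss_norm n) then gmangoldt n else 0)" for P
  proof -
    have "S (\<lambda>d e. P (gauss_norm d)) =
       (\<Sum>d\<in>gdiv n. (if P (gauss_norm d) then gmangoldt d else 0) * (\<Sum>e\<in>gdiv (n div d). gmoebius e))"
      unfolding S_def sum_gpairs_left[OF n] sum_distrib_left by (intro sum.cong refl) auto
    also have "\<dots> = (\<Sum>d\<in>gdiv n. if is_unit (n div d) \<and> P (gauss_norm d) then gmangoldt d else 0)"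
      by (intro sum.cong refl) (auto simp: sum_gmoebius_gdiv gdiv_div_nonzero n)
    finally show ?thesis by (simp add: sum_gmangoldt_unit_quotient[OF n])
  qed
  have right: "S (\<lambda>d e. gauss_norm e \<le> U) =
     (\<Sum>e\<in>gdiv n. if gauss_norm e \<le> U then gmoebius e * ln (gauss_norm (n div e)) else 0)"
    unfolding S_def sum_gpairs_right[OF n]
  proof (intro sum.cong refl)
    fix e assume "e \<in> gdiv n"
    then have "n div e \<noteq> 0" using gdiv_div_nonzero n by blast
    then show "(\<Sum>d\<in>gdiv (n div e). if gauss_norm e \<le> U then gmangoldt d * gmoebius e else 0) =
      (if gauss_norm e \<le> U then gmoebius e * ln (gauss_norm (n div e)) else 0)"
      by (simp flip: sum_distrib_right add: sum_gmangoldt_gdiv mult.commute)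
  qed
  \<comment> \<open>Inclusion and exclusion for the indicators of d at most U and e at most U; the
    last term is the complement of their union.\<close>
  have "S (\<lambda>d e. True) = S (\<lambda>d e. gauss_norm e \<le> U) + S (\<lambda>d e. gauss_norm d \<le> U)
     - S (\<lambda>d e. gauss_norm d \<le> U \<and> gauss_norm e \<le> U) + S (\<lambda>d e. gauss_norm d > U \<and> gauss_norm e > U)"
    unfolding S_def sum.distrib[symmetric] sum_subtractf[symmetric] case_prod_unfold
    by (intro sum.cong refl) auto
  then show ?thesis using left[of "\<lambda>_. True"] left[of "\<lambda>x. x \<le> U"] right U
    unfolding S_def sum_gpairs_left[OF n] by simp
qed

lemma sum_gann_gdiv:
  fixes G :: "gauss_int \<Rightarrow> gauss_int \<Rightarrow> 'a :: comm_monoid_add"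
  assumes "A \<ge> 0"
  shows "(\<Sum>n\<in>gann A B. \<Sum>d\<in>gdiv n. G d (n div d)) =
    (\<Sum>d\<in>gcanon \<inter> gball B. \<Sum>m\<in>gann (A / gauss_norm d) (B / gauss_norm d). G d m)"
proof -
  have nz: "n \<noteq> 0" if "n \<in> gann A B" for n using that assms by (auto simp: gann_def)
  have "(\<Sum>n\<in>gann A B. \<Sum>d\<in>gdiv n. G d (n div d)) = (\<Sum>(n, d)\<in>(SIGMA n:gann A B. gdiv n). G d (n div d))"
    by (rule sum.Sigma) (auto simp: nz)
  also have "\<dots> = (\<Sum>(d, m)\<in>(SIGMA d:gcanon \<inter> gball B. gann (A / gauss_norm d) (B / gauss_norm d)). G d m)"
  proof (rule sum.reindex_bij_witness[of _ "\<lambda>(d, m). (d * m, d)" "\<lambda>(n, d). (d, n div d)"])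
    fix x assume "x \<in> (SIGMA n:gann A B. gdiv n)"
    then obtain n d where x: "x = (n, d)" "n \<in> gann A B" "d dvd n" "normalize d = d"
      by (auto simp: gdiv_def)
    have n0: "n \<noteq> 0" using nz x by blast
    then have d0: "d \<noteq> 0" using x by auto
    have dm: "d * (n div d) = n" using x by simp
    have "gauss_norm d \<le> gauss_norm n" using x n0 by (intro gauss_norm_dvd_le)
    then have "d \<in> gcanon \<inter> gball B" using x d0 by (auto simp: gcanon_def gball_def gann_def)
    moreover have "gauss_norm n = gauss_norm d * gauss_norm (n div d)"
      using dm by (metis gauss_norm_mult)
    then have "n div d \<in> gann (A / gauss_norm d) (B / gauss_norm d)"
      using x gauss_norm_pos[OF d0] by (simp add: gann_def field_simps)
    ultimately show "(case x of (n, d) \<Rightarrow> (d, n div d)) \<in> (SIGMA d:gcanon \<inter> gball B. gann (A / gauss_norm d) (B / gauss_norm d))"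
      by (simp add: x)
    show "(case case x of (n, d) \<Rightarrow> (d, n div d) of (d, m) \<Rightarrow> (d * m, d)) = x"
      using dm by (simp add: x)
    show "(case case x of (n, d) \<Rightarrow> (d, n div d) of (d, m) \<Rightarrow> G d m) = (case x of (n, d) \<Rightarrow> G d (n div d))"
      by (simp add: x)
  next
    fix y assume "y \<in> (SIGMA d:gcanon \<inter> gball B. gann (A / gauss_norm d) (B / gauss_norm d))"
    then obtain d m where y: "y = (d, m)" "d \<noteq> 0" "normalize d = d" "m \<in> gann (A / gauss_norm d) (B / gauss_norm d)"
      by (auto simp: gcanon_def)
    show "(case case y of (d, m) \<Rightarrow> (d * m, d) of (n, d) \<Rightarrow> (d, n div d)) = y"
      using y by simp
    show "(case y of (d, m) \<Rightarrow> (d * m, d)) \<in> (SIGMA n:gann A B. gdiv n)"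
      using y gauss_norm_pos[of d] by (auto simp: gann_def gdiv_def gauss_norm_mult field_simps)
  qed
  also have "\<dots> = (\<Sum>d\<in>gcanon \<inter> gball B. \<Sum>m\<in>gann (A / gauss_norm d) (B / gauss_norm d). G d m)"
    by (rule sum.Sigma[symmetric]) auto
  finally show ?thesis .
qed

subsection \<open>Exponential sums over discs\<close>

lemma dist_int_nonneg [simp]: "dist_int x \<ge> 0"
  by (simp add: dist_int_def)

lemma dist_int_le_half: "dist_int x \<le> 1 / 2"
  using of_int_round_abs_le[of x] by (simp add: dist_int_def abs_minus_commute)

lemma dist_int_le: "dist_int x \<le> \<bar>x - of_int k\<bar>"
  unfolding dist_int_def by (rule round_diff_minimal)

lemma dist_int_minus [simp]: "dist_int (- x) = dist_int x"
proof -
  have "dist_int (- x) \<le> dist_int x" for x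
    using dist_int_le[of "- x" "- round x"] by (simp add: dist_int_def)
  from this[of x] this[of "- x"] show ?thesis by simp
qed

lemma dist_int_add_le: "dist_int (x + y) \<le> dist_int x + dist_int y"
  using dist_int_le[of "x + y" "round x + round y"] unfolding dist_int_def by simp

lemma dist_int_diff_le: "dist_int (x - y) \<le> dist_int x + dist_int y"
  using dist_int_add_le[of x "- y"] by simp

lemma dist_int_le_abs: "dist_int x \<le> \<bar>x\<bar>"
  using dist_int_le[of x 0] by simp

lemma dist_gauss_nonneg [simp]: "dist_gauss z \<ge> 0"
  by (simp add: dist_gauss_def le_max_iff_disj)

lemma dist_gauss_le_half: "dist_gauss z \<le> 1 / 2"
  using dist_int_le_half[of "Re z"] dist_int_le_half[of "Im z"] by (simp add: dist_gauss_def)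

lemma dist_gauss_diff_le: "dist_gauss (x - y) \<le> dist_gauss x + dist_gauss y"
  using dist_int_diff_le[of "Re x" "Re y"] dist_int_diff_le[of "Im x" "Im y"]
  by (auto simp: dist_gauss_def max_def)

definition ee :: "real \<Rightarrow> complex" where
  "ee x = cis (2 * pi * x)"

lemma norm_ee [simp]: "norm (ee x) = 1"
  by (simp add: ee_def)

lemma ee_0 [simp]: "ee 0 = 1"
  by (simp add: ee_def)

lemma ee_add: "ee (x + y) = ee x * ee y"
  by (simp add: ee_def cis_mult distrib_left)

lemma ee_of_int [simp]: "ee (of_int k) = 1"
  using cis_multiple_2pi[of "of_int k"] by (simp add: ee_def)

lemma cnj_ee: "cnj (ee x) = ee (- x)"
  by (simp add: ee_def cis_cnj)

text \<open>A weak Jordan inequality: x - x^3/6 is at least x/2 as long as x^2 is at most 3, and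
  pi/2 is below 1.6 with 1.6^2 = 2.56.\<close>

lemma sin_ge_half:
  fixes x :: real
  assumes "0 \<le> x" "x \<le> pi / 2"
  shows "sin x \<ge> x / 2"
proof -
  have "\<bar>sin x - (\<Sum>m<3. sin_coeff m * x ^ m)\<bar> \<le> inverse (fact 3) * \<bar>x\<bar> ^ 3"
    by (rule Maclaurin_sin_bound)
  also have "(\<Sum>m<3. sin_coeff m * x ^ m) = x"
    by (simp add: numeral_3_eq_3 sin_coeff_def)
  finally have "sin x \<ge> x - x * x\<^sup>2 / 6"
    using assms unfolding abs_le_iff by (simp add: fact_numeral power3_eq_cube power2_eq_square mult.assoc)
  moreover have "x\<^sup>2 \<le> (1.6)\<^sup>2"
    using assms pi_approx by (intro power_mono) auto
  then have "x * x\<^sup>2 \<le> x * 3" using assms by (intro mult_left_mono) (auto simp: power2_eq_square)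
  ultimately show ?thesis by linarith
qed

text \<open>By periodicity x may be replaced by its signed distance t to the nearest integer. The
  chord then has length 2 sin(pi |t|), which is at least pi |t| and so at least 3 |t|.\<close>

lemma norm_ee_minus_1_ge: "norm (ee x - 1) \<ge> 3 * dist_int x"
proof -
  define t where "t = x - of_int (round x)"
  have t: "\<bar>t\<bar> = dist_int x" "\<bar>t\<bar> \<le> 1 / 2"
    using dist_int_le_half[of x] by (simp_all add: t_def dist_int_def)
  have "ee x = ee (t + of_int (round x))" by (simp add: t_def)
  then have ex: "ee x = ee t" unfolding ee_add by simp
  have "(norm (ee t - 1))\<^sup>2 = (2 * sin (pi * \<bar>t\<bar>))\<^sup>2"
  proof -
    have c: "cos (2 * pi * t) = 1 - 2 * (sin (pi * t))\<^sup>2"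
      using cos_double_sin[of "pi * t"] by (simp add: mult.assoc)
    have "(norm (ee t - 1))\<^sup>2 = (cos (2 * pi * t) - 1)\<^sup>2 + (sin (2 * pi * t))\<^sup>2"
      by (simp add: ee_def cmod_power2)
    also have "\<dots> = 2 - 2 * cos (2 * pi * t)"
      using sin_cos_squared_add[of "2 * pi * t"] by (simp add: power2_eq_square algebra_simps)
    also have "\<dots> = (2 * sin (pi * \<bar>t\<bar>))\<^sup>2"
      by (simp add: c power_mult_distrib abs_if)
    finally show ?thesis .
  qed
  moreover have sin: "sin (pi * \<bar>t\<bar>) \<ge> pi * \<bar>t\<bar> / 2"
    using t by (intro sin_ge_half) auto
  then have "2 * sin (pi * \<bar>t\<bar>) \<ge> 0" using pi_gt3
    by (smt (verit) abs_ge_zero mult_nonneg_nonneg divide_nonneg_nonneg)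
  ultimately have "norm (ee t - 1) = 2 * sin (pi * \<bar>t\<bar>)"
    by (intro power2_eq_imp_eq[of "norm (ee t - 1)" "2 * sin (pi * \<bar>t\<bar>)"]) auto
  moreover note sin
  moreover have "pi * \<bar>t\<bar> \<ge> 3 * \<bar>t\<bar>"
    using pi_gt3 by (intro mult_right_mono) auto
  ultimately show ?thesis using t ex by simp
qed

text \<open>Multiplying by \<open>ee t - 1\<close> telescopes the sum to a difference of two unit
  vectors. The product form needs no exception for integral t, where the distance is 0.\<close>

lemma geometric_ee_bound:
  fixes a b :: int
  shows "norm (\<Sum>x\<in>{a..b}. ee (of_int x * t)) * dist_int t \<le> 1"
proof (cases "a \<le> b")
  case True
  have "(ee t - 1) * (\<Sum>x\<in>{a..b}. ee (of_int x * t)) = ee (of_int (b + 1) * t) - ee (of_int a * t)"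
    using True
  proof (induction b rule: int_ge_induct)
    case base
    show ?case by (simp add: ee_add algebra_simps)
  next
    case (step b)
    have "{a..b + 1} = insert (b + 1) {a..b}" using step.hyps by auto
    then have "(\<Sum>x\<in>{a..b + 1}. ee (of_int x * t)) = ee (of_int (b + 1) * t) + (\<Sum>x\<in>{a..b}. ee (of_int x * t))"
      by simp
    then have "(ee t - 1) * (\<Sum>x\<in>{a..b + 1}. ee (of_int x * t)) =
      (ee t - 1) * ee (of_int (b + 1) * t) + (ee (of_int (b + 1) * t) - ee (of_int a * t))"
      using step.IH by (simp only: distrib_left)
    also have "\<dots> = ee t * ee (of_int (b + 1) * t) - ee (of_int a * t)"
      by (simp add: algebra_simps)
    also have "ee t * ee (of_int (b + 1) * t) = ee (of_int (b + 1 + 1) * t)"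
      by (simp add: algebra_simps flip: ee_add)
    finally show ?case .
  qed
  then have "norm (ee t - 1) * norm (\<Sum>x\<in>{a..b}. ee (of_int x * t)) \<le> 2"
    using norm_triangle_ineq4[of "ee (of_int (b + 1) * t)" "ee (of_int a * t)"]
    by (simp flip: norm_mult)
  moreover have "3 * dist_int t * norm (\<Sum>x\<in>{a..b}. ee (of_int x * t)) \<le>
     norm (ee t - 1) * norm (\<Sum>x\<in>{a..b}. ee (of_int x * t))"
    by (intro mult_right_mono norm_ee_minus_1_ge) auto
  ultimately have "3 * (norm (\<Sum>x\<in>{a..b}. ee (of_int x * t)) * dist_int t) \<le> 2"
    by (simp add: mult_ac)
  then show ?thesis by linarith
qed auto

text \<open>These are all the unitary characters of the additive group: for \<beta> = a - i b the
  value at x + i y is e(a x + b y). Writing them through multiplication by \<beta> makes a factor t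
  of the argument a dilation of the frequency.\<close>

definition gchar :: "complex \<Rightarrow> gauss_int \<Rightarrow> complex" where
  "gchar \<beta> m = ee (Re (complex_of_gauss m * \<beta>))"

lemma norm_gchar [simp]: "norm (gchar \<beta> m) = 1"
  by (simp add: gchar_def)

text \<open>The rows of a disc are intervals centred at 0, so a character sum over the disc is a sum
  of geometric progressions.\<close>

lemma gball_conv_Sigma:
  assumes "B \<ge> 0"
  shows "gball B = (\<lambda>(y, x). Gauss_Int x y) `
    (SIGMA y:{- \<lfloor>sqrt B\<rfloor>..\<lfloor>sqrt B\<rfloor>}. {- \<lfloor>sqrt (B - (of_int y)\<^sup>2)\<rfloor>..\<lfloor>sqrt (B - (of_int y)\<^sup>2)\<rfloor>})"
proof -
  have *: "(of_int a :: real)\<^sup>2 \<le> C \<longleftrightarrow> a \<in> {- \<lfloor>sqrt C\<rfloor>..\<lfloor>sqrt C\<rfloor>}" if "C \<ge> 0" for a :: int and C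
  proof -
    have "(of_int a :: real)\<^sup>2 \<le> C \<longleftrightarrow> \<bar>of_int a\<bar> \<le> sqrt C"
      using that by (metis real_sqrt_abs real_sqrt_le_iff)
    also have "\<dots> \<longleftrightarrow> \<bar>a\<bar> \<le> \<lfloor>sqrt C\<rfloor>" by (simp add: le_floor_iff)
    also have "\<dots> \<longleftrightarrow> a \<in> {- \<lfloor>sqrt C\<rfloor>..\<lfloor>sqrt C\<rfloor>}" by auto
    finally show ?thesis .
  qed
  define S where "S = (SIGMA y:{- \<lfloor>sqrt B\<rfloor>..\<lfloor>sqrt B\<rfloor>}.
    {- \<lfloor>sqrt (B - (of_int y)\<^sup>2)\<rfloor>..\<lfloor>sqrt (B - (of_int y)\<^sup>2)\<rfloor>})"
  have iff: "Gauss_Int x y \<in> gball B \<longleftrightarrow> (y, x) \<in> S" for x y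
  proof (cases "(of_int y :: real)\<^sup>2 \<le> B")
    case True
    have "Gauss_Int x y \<in> gball B \<longleftrightarrow> (of_int x :: real)\<^sup>2 \<le> B - (of_int y)\<^sup>2"
      by (auto simp: gball_def gauss_norm_altdef)
    then show ?thesis using True *[OF assms, of y] *[of "B - (of_int y)\<^sup>2" x]
      unfolding S_def by simp
  next
    case False
    have "Gauss_Int x y \<notin> gball B"
    proof
      assume "Gauss_Int x y \<in> gball B"
      then have "(of_int x)\<^sup>2 + (of_int y :: real)\<^sup>2 \<le> B" by (simp add: gball_def gauss_norm_altdef)
      then show False using False zero_le_power2[of "real_of_int x"] by linarith
    qed
    moreover have "(y, x) \<notin> S"
      using False *[OF assms, of y] unfolding S_def by blast
    ultimately show ?thesis by simp
  qed
  have "gball B = (\<lambda>(y, x). Gauss_Int x y) ` S"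
  proof (intro equalityI subsetI)
    fix z assume "z \<in> gball B"
    then show "z \<in> (\<lambda>(y, x). Gauss_Int x y) ` S"
      using iff[of "gre z" "gim z"] by (intro image_eqI[of _ _ "(gim z, gre z)"]) auto
  qed (auto simp: iff)
  then show ?thesis by (simp only: S_def)
qed

text \<open>All rows have the same ratio e(Re \<beta>). Each contributes at most 1 after
  multiplication by the distance, and there are at most 3 sqrt B rows.\<close>

lemma sum_gchar_gball_bound_Re:
  assumes "B \<ge> 1"
  shows "norm (\<Sum>m\<in>gball B. gchar \<beta> m) * dist_int (Re \<beta>) \<le> 3 * sqrt B"
proof -
  let ?r = "\<lfloor>sqrt B\<rfloor>"
  let ?s = "\<lambda>y :: int. \<lfloor>sqrt (B - (of_int y)\<^sup>2)\<rfloor>"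
  have r: "?r \<ge> 1" using assms by (simp add: le_floor_iff)
  have "(\<Sum>m\<in>gball B. gchar \<beta> m) =
    (\<Sum>(y, x)\<in>(SIGMA y:{- ?r..?r}. {- ?s y..?s y}). gchar \<beta> (Gauss_Int x y))"
    using assms by (subst gball_conv_Sigma) (auto simp: sum.reindex inj_on_def case_prod_unfold)
  also have "\<dots> = (\<Sum>y\<in>{- ?r..?r}. \<Sum>x\<in>{- ?s y..?s y}. gchar \<beta> (Gauss_Int x y))"
    by (rule sum.Sigma[symmetric]) auto
  also have "\<dots> = (\<Sum>y\<in>{- ?r..?r}. ee (- of_int y * Im \<beta>) * (\<Sum>x\<in>{- ?s y..?s y}. ee (of_int x * Re \<beta>)))"
    unfolding sum_distrib_left by (intro sum.cong refl) (simp add: gchar_def flip: ee_add)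
  finally have "norm (\<Sum>m\<in>gball B. gchar \<beta> m) \<le>
      (\<Sum>y\<in>{- ?r..?r}. norm (\<Sum>x\<in>{- ?s y..?s y}. ee (of_int x * Re \<beta>)))"
    by (auto intro!: order_trans[OF norm_sum] simp: norm_mult)
  then have "norm (\<Sum>m\<in>gball B. gchar \<beta> m) * dist_int (Re \<beta>) \<le>
      (\<Sum>y\<in>{- ?r..?r}. norm (\<Sum>x\<in>{- ?s y..?s y}. ee (of_int x * Re \<beta>)) * dist_int (Re \<beta>))"
    unfolding sum_distrib_right[symmetric] by (intro mult_right_mono) auto
  also have "\<dots> \<le> (\<Sum>y\<in>{- ?r..?r}. 1)"
    by (intro sum_mono geometric_ee_bound)
  also have "\<dots> = 2 * of_int ?r + 1" using r by simp
  also have "\<dots> \<le> 2 * sqrt B + sqrt B"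
    using assms by (intro add_mono) auto
  finally show ?thesis by simp
qed

lemma sum_gchar_gball_bound:
  assumes "B \<ge> 1"
  shows "norm (\<Sum>m\<in>gball B. gchar \<beta> m) * dist_gauss \<beta> \<le> 3 * sqrt B"
proof -
  \<comment> \<open>Chosen so that reflecting the disc in the diagonal carries the sum for \<beta>
    to the sum for \<open>\<beta>'\<close>. The signs are harmless, as \<open>dist_int\<close> is
    even.\<close>
  define \<beta>' where "\<beta>' = Complex (- Im \<beta>) (- Re \<beta>)"
  have "(\<Sum>m\<in>gball B. gchar \<beta> m) = (\<Sum>m\<in>gball B. gchar \<beta>' m)"
    by (rule sum.reindex_bij_witness[of _ "\<lambda>z. Gauss_Int (gim z) (gre z)" "\<lambda>z. Gauss_Int (gim z) (gre z)"])
       (auto simp: gball_def gauss_norm_altdef gchar_def \<beta>'_def add.commute)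
  then have "norm (\<Sum>m\<in>gball B. gchar \<beta> m) * dist_int (Im \<beta>) \<le> 3 * sqrt B"
    using sum_gchar_gball_bound_Re[OF assms, of \<beta>'] by (simp add: \<beta>'_def)
  then show ?thesis
    using sum_gchar_gball_bound_Re[OF assms, of \<beta>] by (auto simp: dist_gauss_def max_def)
qed

lemma norm_sum_gchar_le_card: "norm (\<Sum>m\<in>A. gchar \<beta> m) \<le> real (card A)"
  by (rule order_trans[OF norm_sum]) simp

lemma gann_eq_empty: "0 \<le> A \<Longrightarrow> B < 1 \<Longrightarrow> gann A B = {}"
proof -
  assume "0 \<le> A" "B < 1"
  have False if "z \<in> gann A B" for z
  proof -
    have z: "gauss_norm z > 0" "gauss_norm z < 1" using that \<open>0 \<le> A\<close> \<open>B < 1\<close> by (auto simp: gann_def)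
    then have "z \<noteq> 0" by auto
    then show False using gauss_norm_ge_1[of z] z by linarith
  qed
  then show ?thesis by auto
qed

lemma gball_less_1: "0 \<le> B \<Longrightarrow> B < 1 \<Longrightarrow> gball B = {0}"
proof -
  assume *: "0 \<le> B" "B < 1"
  have "z = 0" if "z \<in> gball B" for z
  proof (rule ccontr)
    assume "z \<noteq> 0"
    from gauss_norm_ge_1[OF this] show False using that * unfolding gball_def mem_Collect_eq by linarith
  qed
  then show ?thesis using * by (auto simp: gball_def)
qed

text \<open>A difference of two discs. The bound is in terms of a separate P because later annuli
  are cut down by further conditions, and one bound has to serve all of them, even the tiny and the
  empty ones.\<close>

lemma sum_gchar_gann_bound:
  assumes "A \<ge> 0" "B \<le> P" "P \<ge> 1"
  shows "norm (\<Sum>m\<in>gann A B. gchar \<beta> m) * dist_gauss \<beta> \<le> 6 * sqrt P"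
proof -
  have ball: "norm (\<Sum>m\<in>gball C. gchar \<beta> m) * dist_gauss \<beta> \<le> 3 * sqrt P" if "0 \<le> C" "C \<le> P" for C
  proof (cases "C \<ge> 1")
    case True
    have "3 * sqrt C \<le> 3 * sqrt P" using that by simp
    with sum_gchar_gball_bound[OF True, of \<beta>] show ?thesis by linarith
  next
    case False
    then have "norm (\<Sum>m\<in>gball C. gchar \<beta> m) * dist_gauss \<beta> \<le> 1 * (1 / 2)"
      using that dist_gauss_le_half by (subst gball_less_1) (auto simp: gchar_def complex_of_gauss_hom)
    moreover have "sqrt P \<ge> 1" using assms by simp
    ultimately show ?thesis by linarith
  qed
  show ?thesis
  proof (cases "A \<le> B")
    case True
    have "gann A B = gball B - gball A" by (auto simp: gann_def gball_def)
    moreover have "gball A \<subseteq> gball B" using True by (auto simp: gball_def)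
    ultimately have "(\<Sum>m\<in>gann A B. gchar \<beta> m) = (\<Sum>m\<in>gball B. gchar \<beta> m) - (\<Sum>m\<in>gball A. gchar \<beta> m)"
      by (simp add: sum_diff)
    then have "norm (\<Sum>m\<in>gann A B. gchar \<beta> m) \<le> norm (\<Sum>m\<in>gball B. gchar \<beta> m) + norm (\<Sum>m\<in>gball A. gchar \<beta> m)"
      by (simp add: norm_triangle_ineq4)
    then have "norm (\<Sum>m\<in>gann A B. gchar \<beta> m) * dist_gauss \<beta> \<le>
       (norm (\<Sum>m\<in>gball B. gchar \<beta> m) + norm (\<Sum>m\<in>gball A. gchar \<beta> m)) * dist_gauss \<beta>"
      by (intro mult_right_mono) auto
    also have "\<dots> \<le> 3 * sqrt P + 3 * sqrt P"
      unfolding distrib_right using True assms by (intro add_mono ball) auto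
    finally show ?thesis by simp
  next
    case False
    then have "gann A B = {}" by (auto simp: gann_def)
    then show ?thesis using assms by simp
  qed
qed

lemma card_gann_le: "P \<ge> 1 \<Longrightarrow> B \<le> P \<Longrightarrow> real (card (gann A B)) \<le> 9 * P"
proof -
  assume P: "P \<ge> 1" "B \<le> P"
  have "card (gann A B) \<le> card (gball P)"
    using P by (intro card_mono finite_gball) (auto simp: gann_def gball_def)
  then show ?thesis using card_gball_le[OF P(1)] by linarith
qed

text \<open>Partial summation: norms are integers, so ln of a norm is a sum of increments ln(k + 1)
  - ln k over k below it. Only the inner radius varies. The factor c is later 1 or the distance of
  the frequency from the Gaussian integers, which gives the trivial and the nontrivial bound from
  one proof.\<close>

lemma sum_ln_gchar_gann_bound:
  assumes "A \<ge> 0" "B \<le> P" "P \<ge> 1" "c \<ge> 0" "X \<ge> 0"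
    and *: "\<And>A'. A' \<ge> 0 \<Longrightarrow> norm (\<Sum>m\<in>gann A' B. gchar \<beta> m) * c \<le> X"
  shows "norm (\<Sum>m\<in>gann A B. of_real (ln (gauss_norm m)) * gchar \<beta> m) * c \<le> ln P * X"
proof (cases "B \<ge> 1")
  case True
  define K where "K = nat \<lfloor>B\<rfloor>"
  have K: "K \<ge> 1" "real K \<le> B" using True by (auto simp: K_def le_nat_iff)
  define w where "w k = ln (real (Suc k)) - ln (real k)" for k :: nat
  have w: "w k \<ge> 0" if "k \<ge> 1" for k using that by (simp add: w_def)
  have tel: "(\<Sum>k\<in>{1..<n}. w k) = ln (real n)" if "n \<ge> 1" for n
    using sum_Suc_diff'[of 1 n "\<lambda>k. ln (real k)"] that by (simp add: w_def)
  have ln: "ln (gauss_norm m) = (\<Sum>k\<in>{1..<K}. if gauss_norm m > real k then w k else 0)"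
    if m: "m \<in> gann A B" for m
  proof -
    define n where "n = euclidean_size m"
    have n: "gauss_norm m = real n" by (simp add: n_def real_euclidean_size_gauss_int)
    have "gauss_norm m > 0" using m assms by (auto simp: gann_def)
    then have n1: "n \<ge> 1" using n by simp
    have "real n \<le> B" using m n by (simp add: gann_def)
    then have "n \<le> K" unfolding K_def by linarith
    have "(\<Sum>k\<in>{1..<K}. if gauss_norm m > real k then w k else 0) = (\<Sum>k\<in>{1..<n}. w k)"
      using \<open>n \<le> K\<close> n by (intro sum.mono_neutral_cong_right) auto
    then show ?thesis using tel[OF n1] n by simp
  qed
  have "(\<Sum>m\<in>gann A B. of_real (ln (gauss_norm m)) * gchar \<beta> m) =
     (\<Sum>m\<in>gann A B. \<Sum>k\<in>{1..<K}. if gauss_norm m > real k then of_real (w k) * gchar \<beta> m else 0)"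
    by (intro sum.cong refl) (auto simp: ln sum_distrib_right of_real_sum intro!: sum.cong)
  also have "\<dots> = (\<Sum>k\<in>{1..<K}. \<Sum>m\<in>gann A B. if gauss_norm m > real k then of_real (w k) * gchar \<beta> m else 0)"
    by (rule sum.swap)
  also have "\<dots> = (\<Sum>k\<in>{1..<K}. of_real (w k) * (\<Sum>m\<in>gann (max A (real k)) B. gchar \<beta> m))"
    unfolding sum_distrib_left
    by (rule sum.cong[OF refl], rule sum.mono_neutral_cong_right[OF finite_gann]) (auto simp: gann_def)
  finally have "norm (\<Sum>m\<in>gann A B. of_real (ln (gauss_norm m)) * gchar \<beta> m) \<le>
     (\<Sum>k\<in>{1..<K}. w k * norm (\<Sum>m\<in>gann (max A (real k)) B. gchar \<beta> m))"
    by (auto intro!: order_trans[OF norm_sum] sum_mono simp: norm_mult w)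
  then have "norm (\<Sum>m\<in>gann A B. of_real (ln (gauss_norm m)) * gchar \<beta> m) * c \<le>
     (\<Sum>k\<in>{1..<K}. w k * norm (\<Sum>m\<in>gann (max A (real k)) B. gchar \<beta> m)) * c"
    using assms by (intro mult_right_mono) auto
  also have "\<dots> = (\<Sum>k\<in>{1..<K}. w k * (norm (\<Sum>m\<in>gann (max A (real k)) B. gchar \<beta> m) * c))"
    unfolding sum_distrib_right by (intro sum.cong refl) (simp add: mult_ac)
  also have "\<dots> \<le> (\<Sum>k\<in>{1..<K}. w k * X)"
    by (intro sum_mono mult_left_mono * w) auto
  also have "\<dots> = ln (real K) * X" by (simp only: tel[OF K(1)] sum_distrib_right[symmetric])
  also have "\<dots> \<le> ln P * X"
    using K assms by (intro mult_right_mono) auto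
  finally show ?thesis .
next
  case False
  then have "gann A B = {}" using assms by (intro gann_eq_empty) auto
  then show ?thesis using assms by simp
qed

subsection \<open>Well-spaced frequencies\<close>

lemma sum_le_card_mult:
  fixes f :: "'a \<Rightarrow> real"
  assumes "card S \<le> n" "\<And>x. x \<in> S \<Longrightarrow> f x \<le> c" "c \<ge> 0"
  shows "sum f S \<le> real n * c"
proof -
  have "sum f S \<le> real (card S) * c" using assms(2) by (rule sum_bounded_above)
  also have "\<dots> \<le> real n * c" using assms by (intro mult_right_mono) auto
  finally show ?thesis .
qed

text \<open>Separated points occupy distinct cells of a grid of mesh \<open>\<Delta>\<close> on the torus, and a square
  annulus at distance about \<open>s \<Delta>\<close> from the origin meets only \<open>O(s)\<close> cells.\<close>

lemma spaced_sum:
  fixes \<beta> :: "'i \<Rightarrow> complex" and \<phi> :: "'i \<Rightarrow> real"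
  assumes J: "finite J" and \<Delta>: "0 < \<Delta>" "\<Delta> \<le> 1 / 2"
    and spaced: "\<And>i j. i \<in> J \<Longrightarrow> j \<in> J \<Longrightarrow> i \<noteq> j \<Longrightarrow> dist_gauss (\<beta> i - \<beta> j) \<ge> \<Delta>"
    and \<phi>: "\<And>j. j \<in> J \<Longrightarrow> \<phi> j \<le> P" "\<And>j. j \<in> J \<Longrightarrow> \<phi> j * dist_gauss (\<beta> j) \<le> W"
    and PW: "P \<ge> 0" "W \<ge> 0"
  shows "(\<Sum>j\<in>J. \<phi> j) \<le> 12 * P + 12 * W / \<Delta>\<^sup>2"
proof -
  define r where "r x = x - of_int (round x)" for x :: real
  have abs_r: "\<bar>r x\<bar> = dist_int x" for x by (simp add: r_def dist_int_def)
  define cell where "cell j = (\<lfloor>r (Re (\<beta> j)) / \<Delta>\<rfloor>, \<lfloor>r (Im (\<beta> j)) / \<Delta>\<rfloor>)" for j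
  define level where "level j = nat \<lfloor>dist_gauss (\<beta> j) / \<Delta>\<rfloor>" for j
  define S where "S = nat \<lfloor>1 / (2 * \<Delta>)\<rfloor>"
  have close: "dist_int (x - y) < \<Delta>" if "\<lfloor>r x / \<Delta>\<rfloor> = \<lfloor>r y / \<Delta>\<rfloor>" for x y
  proof -
    have "\<bar>r x / \<Delta> - r y / \<Delta>\<bar> < 1" using that by linarith
    then have "\<bar>r x - r y\<bar> < \<Delta>" using \<Delta> by (simp add: field_simps flip: diff_divide_distrib)
    moreover have "dist_int (x - y) \<le> \<bar>r x - r y\<bar>"
      using dist_int_le[of "x - y" "round x - round y"] by (simp add: r_def algebra_simps)
    ultimately show ?thesis by linarith
  qed
  have inj: "inj_on cell J"
  proof (rule inj_onI, rule ccontr)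
    fix i j assume ij: "i \<in> J" "j \<in> J" "cell i = cell j" "i \<noteq> j"
    then have "dist_gauss (\<beta> i - \<beta> j) < \<Delta>"
      using close[of "Re (\<beta> i)" "Re (\<beta> j)"] close[of "Im (\<beta> i)" "Im (\<beta> j)"]
      by (auto simp: cell_def dist_gauss_def max_def)
    then show False using spaced[OF ij(1,2,4)] by linarith
  qed
  have level: "real (level j) * \<Delta> \<le> dist_gauss (\<beta> j)" "dist_gauss (\<beta> j) < (real (level j) + 1) * \<Delta>" for j
  proof -
    have "dist_gauss (\<beta> j) / \<Delta> \<ge> 0" using \<Delta> by simp
    then have "real (level j) = of_int \<lfloor>dist_gauss (\<beta> j) / \<Delta>\<rfloor>" by (simp add: level_def)
    then have "real (level j) \<le> dist_gauss (\<beta> j) / \<Delta>" "dist_gauss (\<beta> j) / \<Delta> < real (level j) + 1"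
      by linarith+
    then show "real (level j) * \<Delta> \<le> dist_gauss (\<beta> j)" "dist_gauss (\<beta> j) < (real (level j) + 1) * \<Delta>"
      using \<Delta> by (simp_all add: field_simps)
  qed
  have level_le: "level j \<le> S" for j
  proof -
    have "dist_gauss (\<beta> j) / \<Delta> \<le> 1 / (2 * \<Delta>)"
      using dist_gauss_le_half[of "\<beta> j"] \<Delta> by (simp add: field_simps)
    then show ?thesis unfolding level_def S_def by (intro nat_mono floor_mono)
  qed
  \<comment> \<open>If s \<Delta> \<le> |r| < (s + 1) \<Delta>, the cell index is s, or -s - 1, or
    -s at the endpoint r = -s \<Delta>. At level s one coordinate is of this kind, while the other
    only has an index between -s - 1 and s.\<close>
  define box where "box s = ({int s, - int s - 1, - int s} \<times> {- int s - 1..int s}) \<union>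
      ({- int s - 1..int s} \<times> {int s, - int s - 1, - int s})" for s
  have card_box: "card (box s) \<le> 12 * (s + 1)" for s
  proof -
    have c3: "card {int s, - int s - 1, - int s} \<le> 3"
      by (simp add: card_insert_if)
    have cI: "card {- int s - 1..int s} = 2 * (s + 1)" by simp
    have "card (box s) \<le> card ({int s, - int s - 1, - int s} \<times> {- int s - 1..int s}) +
       card ({- int s - 1..int s} \<times> {int s, - int s - 1, - int s})"
      unfolding box_def by (rule card_Un_le)
    also have "\<dots> = 2 * (card {int s, - int s - 1, - int s} * (2 * (s + 1)))"
      unfolding card_cartesian_product cI by simp
    also have "\<dots> \<le> 2 * (3 * (2 * (s + 1)))"
      using c3 by (intro mult_le_mono mult_left_mono) auto
    finally show ?thesis by simp
  qed
  have cell_box: "cell j \<in> box (level j)" for j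
  proof -
    define s where "s = level j"
    have rng: "\<lfloor>r x / \<Delta>\<rfloor> \<in> {- int s - 1..int s}" if "\<bar>r x\<bar> < (real s + 1) * \<Delta>" for x
    proof -
      have "\<bar>r x / \<Delta>\<bar> < real s + 1" using that \<Delta> by (simp add: field_simps)
      then have "r x / \<Delta> < real s + 1" "- real s - 1 \<le> r x / \<Delta>" by linarith+
      then show ?thesis by (simp add: le_floor_iff floor_le_iff)
    qed
    have edge: "\<lfloor>r x / \<Delta>\<rfloor> \<in> {int s, - int s - 1, - int s}"
      if "\<bar>r x\<bar> < (real s + 1) * \<Delta>" "\<bar>r x\<bar> \<ge> real s * \<Delta>" for x
    proof -
      have *: "\<bar>r x / \<Delta>\<bar> < real s + 1" "\<bar>r x / \<Delta>\<bar> \<ge> real s" using that \<Delta> by (simp_all add: field_simps)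
      show ?thesis
      proof (cases "r x / \<Delta> \<ge> 0")
        case True
        then have "\<lfloor>r x / \<Delta>\<rfloor> = int s" using * by (intro floor_unique) auto
        then show ?thesis by simp
      next
        case False
        then have "r x / \<Delta> \<le> - real s" "r x / \<Delta> > - real s - 1" using * by linarith+
        then have "\<lfloor>r x / \<Delta>\<rfloor> \<le> - int s" "\<lfloor>r x / \<Delta>\<rfloor> \<ge> - int s - 1" by linarith+
        then show ?thesis by force
      qed
    qed
    have d: "dist_gauss (\<beta> j) < (real s + 1) * \<Delta>" "real s * \<Delta> \<le> dist_gauss (\<beta> j)"
      using level[of j] by (simp_all add: s_def)
    have both: "\<bar>r (Re (\<beta> j))\<bar> < (real s + 1) * \<Delta>" "\<bar>r (Im (\<beta> j))\<bar> < (real s + 1) * \<Delta>"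
      using d unfolding abs_r dist_gauss_def by linarith+
    have "\<bar>r (Re (\<beta> j))\<bar> \<ge> real s * \<Delta> \<or> \<bar>r (Im (\<beta> j))\<bar> \<ge> real s * \<Delta>"
      using d unfolding abs_r dist_gauss_def by linarith
    then show ?thesis
      using rng[OF both(1)] rng[OF both(2)] edge[OF both(1)] edge[OF both(2)]
      unfolding cell_def box_def s_def by blast
  qed
  have card_level: "card {j \<in> J. level j = s} \<le> 12 * (s + 1)" for s
  proof -
    have "card {j \<in> J. level j = s} = card (cell ` {j \<in> J. level j = s})"
      by (intro card_image[symmetric] inj_on_subset[OF inj]) auto
    also have "\<dots> \<le> card (box s)"
    proof (rule card_mono)
      show "finite (box s)" by (simp add: box_def)
      show "cell ` {j \<in> J. level j = s} \<subseteq> box s"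
      proof
        fix p assume "p \<in> cell ` {j \<in> J. level j = s}"
        then obtain j where "p = cell j" "level j = s" by blast
        then show "p \<in> box s" using cell_box[of j] by simp
      qed
    qed
    finally show ?thesis using card_box[of s] by linarith
  qed
  have "(\<Sum>j\<in>J. \<phi> j) = (\<Sum>s\<le>S. \<Sum>j | j \<in> J \<and> level j = s. \<phi> j)"
    using J level_le by (intro sum.group[symmetric]) auto
  also have "\<dots> = (\<Sum>j | j \<in> J \<and> level j = 0. \<phi> j) + (\<Sum>s\<in>{1..S}. \<Sum>j | j \<in> J \<and> level j = s. \<phi> j)"
    by (simp add: sum.atLeast_Suc_atMost[of 0 S] flip: atLeast0AtMost)
  \<comment> \<open>Level 0 takes the trivial bound P. At level s there are at most 24 s points,
    each contributing at most W / (s \<Delta>), so every level costs the same, and there are at most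
    1/(2 \<Delta>) levels.\<close>
  also have "\<dots> \<le> 12 * P + (\<Sum>s\<in>{1..S}. 24 * W / \<Delta>)"
  proof (intro add_mono sum_mono)
    show "(\<Sum>j | j \<in> J \<and> level j = 0. \<phi> j) \<le> 12 * P"
      using sum_le_card_mult[OF card_level[of 0], of \<phi> P] \<phi> PW by simp
  next
    fix s assume s: "s \<in> {1..S}"
    have "\<phi> j \<le> W / (real s * \<Delta>)" if j: "j \<in> J" "level j = s" for j
    proof (cases "\<phi> j \<ge> 0")
      case True
      have "\<phi> j * (real s * \<Delta>) \<le> \<phi> j * dist_gauss (\<beta> j)"
        using level(1)[of j] j True by (intro mult_left_mono) auto
      also have "\<dots> \<le> W" using \<phi>(2)[OF j(1)] .
      finally show ?thesis using s \<Delta> by (simp add: field_simps)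
    next
      case False
      then show ?thesis using PW \<Delta> by (meson divide_nonneg_nonneg dual_order.trans le_cases less_imp_le mult_nonneg_nonneg of_nat_0_le_iff)
    qed
    then have "(\<Sum>j | j \<in> J \<and> level j = s. \<phi> j) \<le> real (12 * (s + 1)) * (W / (real s * \<Delta>))"
      using PW \<Delta> by (intro sum_le_card_mult[OF card_level[of s]]) auto
    also have "\<dots> \<le> real (24 * s) * (W / (real s * \<Delta>))"
      using s PW \<Delta> by (intro mult_right_mono) auto
    also have "\<dots> = 24 * W / \<Delta>" using s by simp
    finally show "(\<Sum>j | j \<in> J \<and> level j = s. \<phi> j) \<le> 24 * W / \<Delta>" .
  qed
  also have "(\<Sum>s\<in>{1..S}. 24 * W / \<Delta>) = real S * (24 * W / \<Delta>)" by simp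
  also have "\<dots> \<le> 1 / (2 * \<Delta>) * (24 * W / \<Delta>)"
    using \<Delta> PW by (intro mult_right_mono) (auto simp: S_def)
  also have "\<dots> = 12 * W / \<Delta>\<^sup>2" by (simp add: power2_eq_square)
  finally show ?thesis by simp
qed

text \<open>Squares of side sqrt(q/2), half-open, contain only points whose differences have norm
  below q. This reduces a large disc to pieces in which a spacing hypothesis about short differences
  applies; about 16 L/q + 8 squares suffice.\<close>

lemma grid_cover_sum:
  fixes \<phi> :: "gauss_int \<Rightarrow> real"
  assumes T: "T \<subseteq> gball L" and "L \<ge> 0" "q > 0" "K \<ge> 0"
    and cell: "\<And>T'. T' \<subseteq> T \<Longrightarrow> (\<And>x y. x \<in> T' \<Longrightarrow> y \<in> T' \<Longrightarrow> gauss_norm (x - y) < q) \<Longrightarrow> sum \<phi> T' \<le> K"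
  shows "sum \<phi> T \<le> (16 * L / q + 8) * K"
proof -
  define s where "s = sqrt (q / 2)"
  have s: "s > 0" "2 * s\<^sup>2 = q" using assms by (auto simp: s_def)
  define c where "c z = (\<lfloor>of_int (gre z) / s\<rfloor>, \<lfloor>of_int (gim z) / s\<rfloor>)" for z
  define R where "R = sqrt L / s"
  have R: "R \<ge> 0" using s assms by (simp add: R_def)
  define box where "box = {\<lfloor>- R\<rfloor>..\<lfloor>R\<rfloor>} \<times> {\<lfloor>- R\<rfloor>..\<lfloor>R\<rfloor>}"
  have fT: "finite T" using T finite_subset by blast
  have "c ` T \<subseteq> box"
  proof
    fix p assume "p \<in> c ` T"
    then obtain z where z: "z \<in> T" "p = c z" by auto
    have n: "gauss_norm z \<le> L" using z T by (auto simp: gball_def)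
    have "\<bar>of_int (gre z)\<bar> \<le> sqrt L" "\<bar>of_int (gim z)\<bar> \<le> sqrt L"
      using n zero_le_power2[of "real_of_int (gre z)"] zero_le_power2[of "real_of_int (gim z)"]
      unfolding gauss_norm_altdef by (intro real_le_rsqrt; simp only: power2_abs; linarith)+
    then have *: "\<bar>of_int (gre z) / s\<bar> \<le> R" "\<bar>of_int (gim z) / s\<bar> \<le> R"
      using s by (simp_all add: R_def divide_right_mono)
    then have "- R \<le> of_int (gre z) / s" "of_int (gre z) / s \<le> R"
       "- R \<le> of_int (gim z) / s" "of_int (gim z) / s \<le> R" by linarith+
    then show "p \<in> box" unfolding z c_def box_def by (auto intro!: floor_mono)
  qed
  have "sum \<phi> T = (\<Sum>p\<in>c ` T. \<Sum>z | z \<in> T \<and> c z = p. \<phi> z)"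
    by (rule sum.image_gen[OF fT])
  also have "\<dots> \<le> real (card box) * K"
  proof (rule sum_le_card_mult)
    show "card (c ` T) \<le> card box"
      using \<open>c ` T \<subseteq> box\<close> by (intro card_mono) (auto simp: box_def)
  next
    fix p
    show "(\<Sum>z | z \<in> T \<and> c z = p. \<phi> z) \<le> K"
    proof (rule cell)
      fix x y assume xy: "x \<in> {z \<in> T. c z = p}" "y \<in> {z \<in> T. c z = p}"
      have lt: "(of_int (a - b) :: real)\<^sup>2 < s\<^sup>2" if "\<lfloor>of_int a / s\<rfloor> = \<lfloor>of_int b / s\<rfloor>" for a b :: int
      proof -
        have "\<bar>of_int a / s - of_int b / s\<bar> < 1" using that by linarith
        then have "\<bar>of_int (a - b)\<bar> < s" using s by (simp add: field_simps flip: diff_divide_distrib)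
        then have "\<bar>of_int (a - b) :: real\<bar>\<^sup>2 < s\<^sup>2" by (intro power_strict_mono) auto
        then show ?thesis by simp
      qed
      have "gauss_norm (x - y) < s\<^sup>2 + s\<^sup>2"
        unfolding gauss_norm_altdef using xy
        by (intro add_strict_mono) (auto simp: minus_gauss_int_def c_def simp del: of_int_diff intro!: lt)
      then show "gauss_norm (x - y) < q" using s by simp
    qed auto
  qed fact
  also have "\<dots> \<le> (16 * L / q + 8) * K"
  proof (intro mult_right_mono)
    have "real (card box) = (of_int (\<lfloor>R\<rfloor> - \<lfloor>- R\<rfloor> + 1))\<^sup>2"
    proof -
      have "\<lfloor>- R\<rfloor> \<le> \<lfloor>R\<rfloor>" using R by (intro floor_mono) auto
      then show ?thesis by (simp add: box_def card_cartesian_product power2_eq_square)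
    qed
    also have "\<dots> \<le> (2 * R + 2)\<^sup>2"
      using R by (intro power_mono) linarith+
    also have "\<dots> \<le> 8 * R\<^sup>2 + 8"
      using zero_le_power2[of "R - 1"] by (simp add: power2_eq_square algebra_simps)
    also have "\<dots> = 16 * L / q + 8"
      using s assms by (simp add: R_def power_divide field_simps)
    finally show "real (card box) \<le> 16 * L / q + 8" .
  qed fact
  finally show ?thesis .
qed

text \<open>Applied to k = n - n', this says that the points n \<alpha> are \<Delta>-separated
  modulo the Gaussian integers while n runs over a set whose differences have norm below q. It is
  the only Diophantine information that the exponential sum estimates receive.\<close>

definition spaced_freq :: "complex \<Rightarrow> real \<Rightarrow> real \<Rightarrow> bool" where
  "spaced_freq \<alpha> q \<Delta> \<longleftrightarrow> (\<forall>k. k \<noteq> 0 \<and> gauss_norm k < q \<longrightarrow> dist_gauss (complex_of_gauss k * \<alpha>) \<ge> \<Delta>)"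

lemma spaced_sum_gball:
  assumes "T \<subseteq> gball L" "L \<ge> 0" "q > 0" "0 < \<Delta>" "\<Delta> \<le> 1 / 2" "P \<ge> 0" "W \<ge> 0"
    and "\<And>n n'. n \<in> T \<Longrightarrow> n' \<in> T \<Longrightarrow> n \<noteq> n' \<Longrightarrow> gauss_norm (n - n') < q \<Longrightarrow> dist_gauss (\<beta> n - \<beta> n') \<ge> \<Delta>"
    and "\<And>n. n \<in> T \<Longrightarrow> \<phi> n \<le> P" "\<And>n. n \<in> T \<Longrightarrow> \<phi> n * dist_gauss (\<beta> n) \<le> W"
  shows "(\<Sum>n\<in>T. \<phi> n) \<le> (16 * L / q + 8) * (12 * P + 12 * W / \<Delta>\<^sup>2)"
proof (rule grid_cover_sum[OF assms(1-3)])
  fix T' assume T': "T' \<subseteq> T" "\<And>x y. x \<in> T' \<Longrightarrow> y \<in> T' \<Longrightarrow> gauss_norm (x - y) < q"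
  show "sum \<phi> T' \<le> 12 * P + 12 * W / \<Delta>\<^sup>2"
  proof (rule spaced_sum[where \<beta> = \<beta>])
    show "finite T'" using assms(1) T'(1) by (meson finite_gball finite_subset)
    show "dist_gauss (\<beta> i - \<beta> j) \<ge> \<Delta>" if "i \<in> T'" "j \<in> T'" "i \<noteq> j" for i j
      using that T' assms(8)[of i j] by auto
    show "\<phi> j \<le> P" "\<phi> j * dist_gauss (\<beta> j) \<le> W" if "j \<in> T'" for j
      using that T'(1) assms(9,10) by auto
  qed fact+
qed (use assms in auto)

text \<open>A shell of norms from 2^k to 2^(k+1) has at most 18 * 2^k points, so it contributes at
  most 18, and about log_2 M shells occur.\<close>

lemma inverse_norm_sum_le:
  assumes "M \<ge> 1"
  shows "(\<Sum>t\<in>gann 0 M. 1 / gauss_norm t) \<le> 36 * (1 + ln M)"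
proof -
  define D where "D k = {t. 0 < gauss_norm t \<and> gauss_norm t < 2 ^ k}" for k :: nat
  have fin: "finite (D k)" for k
    by (rule finite_subset[OF _ finite_gball[of "2 ^ k"]]) (auto simp: D_def gball_def)
  have D: "(\<Sum>t\<in>D k. 1 / gauss_norm t) \<le> 18 * real k" for k
  proof (induction k)
    case 0
    have False if "t \<in> D 0" for t
    proof -
      have "t \<noteq> 0" "gauss_norm t < 1" using that by (auto simp: D_def)
      then show False using gauss_norm_ge_1[of t] by linarith
    qed
    then have "D 0 = {}" by blast
    then show ?case by simp
  next
    case (Suc k)
    define E where "E = {t. 2 ^ k \<le> gauss_norm t \<and> gauss_norm t < 2 ^ Suc k}"
    have E: "E \<subseteq> gball (2 ^ Suc k)" by (auto simp: E_def gball_def)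
    have un: "D (Suc k) = D k \<union> E" by (auto simp: D_def E_def intro: less_le_trans)
    have "(\<Sum>t\<in>D (Suc k). 1 / gauss_norm t) = (\<Sum>t\<in>D k. 1 / gauss_norm t) + (\<Sum>t\<in>E. 1 / gauss_norm t)"
      unfolding un using fin E by (intro sum.union_disjoint) (auto simp: D_def E_def intro: finite_subset)
    moreover have "(\<Sum>t\<in>E. 1 / gauss_norm t) \<le> 18"
    proof -
      have "(\<Sum>t\<in>E. 1 / gauss_norm t) \<le> real (card E) * (1 / 2 ^ k)"
        by (rule sum_bounded_above) (auto simp: E_def intro!: frac_le)
      also have "\<dots> \<le> (9 * 2 ^ Suc k) * (1 / 2 ^ k)"
        using card_mono[OF finite_gball E] card_gball_le[of "2 ^ Suc k", OF one_le_power]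
        by (intro mult_right_mono) auto
      finally show ?thesis by simp
    qed
    ultimately show ?case using Suc.IH by simp
  qed
  define k where "k = nat \<lfloor>log 2 M\<rfloor> + 1"
  have k: "M < 2 ^ k" "real k \<le> log 2 M + 1"
  proof -
    have nn: "log 2 M \<ge> 0" using assms by simp
    have "log 2 M < real k" using nn by (simp add: k_def) linarith
    then show "M < 2 ^ k" using assms by (simp add: log_less_iff powr_realpow)
    show "real k \<le> log 2 M + 1" using nn by (simp add: k_def)
  qed
  have "(\<Sum>t\<in>gann 0 M. 1 / gauss_norm t) \<le> (\<Sum>t\<in>D k. 1 / gauss_norm t)"
    using k fin by (intro sum_mono2) (auto simp: gann_def D_def)
  also have "\<dots> \<le> 18 * (log 2 M + 1)" by (rule order_trans[OF D]) (use k(2) in simp)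
  also have "log 2 M \<le> 2 * ln M"
  proof -
    have "ln M / ln 2 \<le> ln M / (1 / 2)"
      using assms ln2_ge_two_thirds by (intro divide_left_mono) auto
    then show ?thesis by (simp add: log_def)
  qed
  finally show ?thesis using assms by simp
qed

text \<open>By the inequality of arithmetic and geometric means u is at most c u^2 / 2 + 1 / (2 c).
  The choice c = sqrt M balances the sum of inverse norms against the number of points.\<close>

lemma inverse_sqrt_norm_sum_le:
  assumes "M \<ge> 1"
  shows "(\<Sum>t\<in>gann 0 M. 1 / sqrt (gauss_norm t)) \<le> sqrt M * (23 * (1 + ln M))"
proof -
  define c where "c = sqrt M"
  have c: "c > 0" "c * c = M" using assms by (auto simp: c_def)
  have "(\<Sum>t\<in>gann 0 M. 1 / sqrt (gauss_norm t)) \<le> (\<Sum>t\<in>gann 0 M. c / 2 * (1 / gauss_norm t) + 1 / (2 * c))"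
  proof (rule sum_mono)
    fix t assume "t \<in> gann 0 M"
    then have t: "sqrt (gauss_norm t) > 0" by (auto simp: gann_def)
    define u where "u = 1 / sqrt (gauss_norm t)"
    have "u * u = 1 / gauss_norm t" by (simp add: u_def)
    moreover have "2 * c * u \<le> c * c * (u * u) + 1"
      using zero_le_power2[of "c * u - 1"] by (simp add: power2_eq_square algebra_simps)
    then have "u \<le> c / 2 * (u * u) + 1 / (2 * c)" using c(1) by (simp add: field_simps)
    ultimately show "1 / sqrt (gauss_norm t) \<le> c / 2 * (1 / gauss_norm t) + 1 / (2 * c)"
      by (simp add: u_def)
  qed
  also have "\<dots> = c / 2 * (\<Sum>t\<in>gann 0 M. 1 / gauss_norm t) + real (card (gann 0 M)) / (2 * c)"
    by (simp add: sum.distrib sum_distrib_left)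
  also have "\<dots> \<le> c / 2 * (36 * (1 + ln M)) + 9 * M / (2 * c)"
    using c inverse_norm_sum_le[OF assms] card_gann_le[OF assms, of M 0]
    by (intro add_mono mult_left_mono divide_right_mono) auto
  also have "9 * M / (2 * c) = c * (9 / 2)" using c by (simp add: field_simps flip: c(2))
  also have "c / 2 * (36 * (1 + ln M)) + c * (9 / 2) \<le> c * (23 * (1 + ln M))"
  proof -
    have "ln M \<ge> 0" using assms by simp
    then have "c * (18 * (1 + ln M) + 9 / 2) \<le> c * (23 * (1 + ln M))"
      using c by (intro mult_left_mono) auto
    then show ?thesis by (simp add: algebra_simps)
  qed
  finally show ?thesis by (simp add: c_def)
qed

subsection \<open>Type I and Type II sums\<close>

lemma gchar_mult: "gchar \<alpha> (t * m) = gchar (complex_of_gauss t * \<alpha>) m"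
  by (simp add: gchar_def complex_of_gauss_hom(6) mult_ac)

lemma gauss_diff_mult: "complex_of_gauss (x - y) * \<alpha> = complex_of_gauss x * \<alpha> - complex_of_gauss y * \<alpha>"
  by (simp add: complex_of_gauss_hom(5) left_diff_distrib)

text \<open>The terms V t stand for weighted inner sums. If t \<alpha> is at least \<Delta>/2 away
  from the Gaussian integers, the geometric bound is used. Two exceptional t whose difference has
  norm below q would violate the spacing, so each grid square holds at most one; since 0 is
  excluded, an exceptional t has norm at least q, where the trivial bound is affordable.\<close>

lemma type_I_sum:
  assumes sp: "spaced_freq \<alpha> q \<Delta>" and q: "q > 0" and \<Delta>: "0 < \<Delta>" and M: "1 \<le> M" "M \<le> P" and Y: "Y \<ge> 0"
    and V: "\<And>t. t \<in> gann 0 M \<Longrightarrow> V t \<le> Y * (9 * P / gauss_norm t)"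
      "\<And>t. t \<in> gann 0 M \<Longrightarrow> V t * dist_gauss (complex_of_gauss t * \<alpha>) \<le> Y * (6 * sqrt (P / gauss_norm t))"
  shows "(\<Sum>t\<in>gann 0 M. V t) \<le> Y * (276 * (1 + ln P) * sqrt (P * M) / \<Delta> + 9 * P / q * (16 * M / q + 8))"
proof -
  define Bd where "Bd = {t \<in> gann 0 M. dist_gauss (complex_of_gauss t * \<alpha>) < \<Delta> / 2}"
  have Bd_gball: "Bd \<subseteq> gball M" by (auto simp: Bd_def gann_def gball_def)
  have card_Bd: "real (card Bd) \<le> 16 * M / q + 8"
  proof -
    have "(\<Sum>t\<in>Bd. 1) \<le> (16 * M / q + 8) * (1 :: real)"
    proof (rule grid_cover_sum[OF Bd_gball])
      fix T' assume T': "T' \<subseteq> Bd" "\<And>x y. x \<in> T' \<Longrightarrow> y \<in> T' \<Longrightarrow> gauss_norm (x - y) < q"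
      have "x = y" if xy: "x \<in> T'" "y \<in> T'" for x y
      proof (rule ccontr)
        assume "x \<noteq> y"
        then have "dist_gauss (complex_of_gauss (x - y) * \<alpha>) \<ge> \<Delta>"
          using sp T'(2)[OF xy] by (auto simp: spaced_freq_def)
        moreover have "dist_gauss (complex_of_gauss (x - y) * \<alpha>) < \<Delta> / 2 + \<Delta> / 2"
          unfolding gauss_diff_mult using xy T'(1)
          by (intro le_less_trans[OF dist_gauss_diff_le] add_strict_mono) (auto simp: Bd_def)
        ultimately show False by simp
      qed
      then have "card T' \<le> Suc 0"
      proof (subst card_le_Suc0_iff_eq)
        show "finite T'" using T'(1) Bd_gball by (meson finite_gball finite_subset)
      qed blast
      then show "(\<Sum>t\<in>T'. 1 :: real) \<le> 1" by simp
    qed (use q M in auto)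
    then show ?thesis by simp
  qed
  have far: "gauss_norm t \<ge> q" if "t \<in> Bd" for t
  proof (rule ccontr)
    assume "\<not> gauss_norm t \<ge> q"
    moreover have "t \<noteq> 0" using that by (auto simp: Bd_def gann_def)
    ultimately have "dist_gauss (complex_of_gauss t * \<alpha>) \<ge> \<Delta>"
      using sp by (auto simp: spaced_freq_def)
    then show False using that \<Delta> by (auto simp: Bd_def)
  qed
  have "(\<Sum>t\<in>gann 0 M. V t) \<le> (\<Sum>t\<in>gann 0 M. Y * 12 * sqrt P / \<Delta> * (1 / sqrt (gauss_norm t))
      + (if t \<in> Bd then Y * (9 * P / q) else 0))"
  proof (rule sum_mono)
    fix t assume t: "t \<in> gann 0 M"
    then have pos: "gauss_norm t > 0" by (auto simp: gann_def)
    show "V t \<le> Y * 12 * sqrt P / \<Delta> * (1 / sqrt (gauss_norm t)) + (if t \<in> Bd then Y * (9 * P / q) else 0)"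
    proof (cases "t \<in> Bd")
      case True
      have "V t \<le> Y * (9 * P / gauss_norm t)" by (rule V(1)[OF t])
      also have "\<dots> \<le> Y * (9 * P / q)"
        using far[OF True] q Y M by (intro mult_left_mono divide_left_mono) auto
      finally have "V t \<le> Y * (9 * P / q)" .
      moreover have "Y * 12 * sqrt P / \<Delta> * (1 / sqrt (gauss_norm t)) \<ge> 0"
        using Y M \<Delta> by simp
      ultimately show ?thesis using True by simp
    next
      case False
      then have d: "dist_gauss (complex_of_gauss t * \<alpha>) \<ge> \<Delta> / 2" using t by (simp add: Bd_def)
      have rhs: "Y * 12 * sqrt P / \<Delta> * (1 / sqrt (gauss_norm t)) \<ge> 0"
        using Y M \<Delta> by simp
      show ?thesis
      proof (cases "V t \<ge> 0")
        case True
        have "V t * (\<Delta> / 2) \<le> V t * dist_gauss (complex_of_gauss t * \<alpha>)"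
          using d True by (intro mult_left_mono) auto
        also have "\<dots> \<le> Y * (6 * sqrt (P / gauss_norm t))" by (rule V(2)[OF t])
        finally have "V t \<le> Y * (6 * sqrt (P / gauss_norm t)) / (\<Delta> / 2)"
          using \<Delta> by (subst pos_le_divide_eq) auto
        also have "\<dots> = Y * 12 * sqrt P / \<Delta> * (1 / sqrt (gauss_norm t))"
          by (simp add: real_sqrt_divide mult_ac)
        finally have "V t \<le> Y * 12 * sqrt P / \<Delta> * (1 / sqrt (gauss_norm t))" .
        then show ?thesis using False by simp
      next
        case False
        then show ?thesis using rhs \<open>t \<notin> Bd\<close> by simp
      qed
    qed
  qed
  also have "\<dots> = Y * 12 * sqrt P / \<Delta> * (\<Sum>t\<in>gann 0 M. 1 / sqrt (gauss_norm t)) + real (card Bd) * (Y * (9 * P / q))"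
  proof -
    have "(\<Sum>t\<in>gann 0 M. if t \<in> Bd then Y * (9 * P / q) else 0) = (\<Sum>t\<in>Bd. Y * (9 * P / q))"
      by (rule sum.mono_neutral_cong_right) (auto simp: Bd_def)
    then show ?thesis by (simp add: sum.distrib sum_distrib_left)
  qed
  also have "\<dots> \<le> Y * 12 * sqrt P / \<Delta> * (sqrt M * (23 * (1 + ln P))) + (16 * M / q + 8) * (Y * (9 * P / q))"
  proof (intro add_mono mult_left_mono mult_right_mono card_Bd)
    have "sqrt M * (23 * (1 + ln M)) \<le> sqrt M * (23 * (1 + ln P))"
      using M by (intro mult_left_mono) auto
    then show "(\<Sum>t\<in>gann 0 M. 1 / sqrt (gauss_norm t)) \<le> sqrt M * (23 * (1 + ln P))"
      using inverse_sqrt_norm_sum_le[OF M(1)] by linarith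
  qed (use Y M \<Delta> q in auto)
  also have "\<dots> = Y * (276 * (1 + ln P) * sqrt (P * M) / \<Delta> + 9 * P / q * (16 * M / q + 8))"
    by (simp add: real_sqrt_mult algebra_simps add_divide_distrib)
  finally show ?thesis .
qed

text \<open>After Cauchy's inequality the smooth variable \<open>m\<close> runs over an annulus with frequency
  \<open>(n\<^sub>1 - n\<^sub>2) \<alpha>\<close>, and these frequencies are well spaced.\<close>

lemma type_II_sum:
  fixes a b :: "gauss_int \<Rightarrow> real"
  assumes sp: "spaced_freq \<alpha> q \<Delta>" and q: "q > 0" and \<Delta>: "0 < \<Delta>" "\<Delta> \<le> 1 / 2"
    and M: "1 \<le> M" and L: "L \<ge> 0" and A: "A \<ge> 0" and Sn: "Sn \<subseteq> gann 0 L"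
  shows "(norm (\<Sum>m\<in>gann M (2 * M). \<Sum>n | n \<in> Sn \<and> A < gauss_norm (n * m) \<and> gauss_norm (n * m) \<le> B.
       of_real (a m * b n) * gchar \<alpha> (n * m)))\<^sup>2
    \<le> (\<Sum>m\<in>gann M (2 * M). (a m)\<^sup>2) * ((\<Sum>n\<in>Sn. (b n)\<^sup>2) *
        ((16 * L / q + 8) * (216 * M + 72 * sqrt (2 * M) / \<Delta>\<^sup>2)))"
proof -
  define S where "S = gann M (2 * M)"
  define G where "G = (16 * L / q + 8) * (216 * M + 72 * sqrt (2 * M) / \<Delta>\<^sup>2)"
  have fin: "finite Sn" using Sn by (rule finite_subset) auto
  define c where "c n m = (if A < gauss_norm (n * m) \<and> gauss_norm (n * m) \<le> B then 1 else 0 :: real)" for n m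
  define Z where "Z m = (\<Sum>n\<in>Sn. of_real (b n * c n m) * gchar \<alpha> (n * m))" for m
  define D where "D n1 n2 = norm (\<Sum>m\<in>S. of_real (c n1 m * c n2 m) * gchar (complex_of_gauss (n1 - n2) * \<alpha>) m)" for n1 n2
  \<comment> \<open>For fixed n1 and n2 the conditions on the products cut the range of m down to an
    annulus. The annulus depends on n1 and n2, but the character sum bound is uniform in it.\<close>
  have inner: "\<exists>A' B'. A' \<ge> 0 \<and> B' \<le> 2 * M \<and>
     (\<Sum>m\<in>S. of_real (c n1 m * c n2 m) * gchar \<beta> m) = (\<Sum>m\<in>gann A' B'. gchar \<beta> m)"
    if n: "n1 \<in> Sn" "n2 \<in> Sn" for n1 n2 \<beta>
  proof -
    have pos: "gauss_norm n1 > 0" "gauss_norm n2 > 0" using n Sn by (auto simp: gann_def)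
    define A' where "A' = max M (max (A / gauss_norm n1) (A / gauss_norm n2))"
    define B' where "B' = min (2 * M) (min (B / gauss_norm n1) (B / gauss_norm n2))"
    have "(\<Sum>m\<in>S. of_real (c n1 m * c n2 m) * gchar \<beta> m) = (\<Sum>m\<in>gann A' B'. gchar \<beta> m)"
    proof (rule sum.mono_neutral_cong_right)
      show "gann A' B' \<subseteq> S" by (auto simp: gann_def S_def A'_def B'_def)
      show "\<forall>m\<in>S - gann A' B'. of_real (c n1 m * c n2 m) * gchar \<beta> m = 0"
        using pos by (auto simp: gann_def S_def A'_def B'_def c_def gauss_norm_mult field_simps)
      show "of_real (c n1 m * c n2 m) * gchar \<beta> m = gchar \<beta> m" if "m \<in> gann A' B'" for m
        using that pos by (auto simp: gann_def A'_def B'_def c_def gauss_norm_mult field_simps)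
    qed (auto simp: S_def)
    moreover have "A' \<ge> 0" "B' \<le> 2 * M" using M by (auto simp: A'_def B'_def)
    ultimately show ?thesis by blast
  qed
  have D_le: "D n1 n2 \<le> 18 * M" if n: "n1 \<in> Sn" "n2 \<in> Sn" for n1 n2
  proof -
    obtain A' B' where *: "B' \<le> 2 * M" "(\<Sum>m\<in>S. of_real (c n1 m * c n2 m) * gchar (complex_of_gauss (n1 - n2) * \<alpha>) m) =
        (\<Sum>m\<in>gann A' B'. gchar (complex_of_gauss (n1 - n2) * \<alpha>) m)"
      using inner[OF n] by blast
    have "D n1 n2 \<le> real (card (gann A' B'))" unfolding D_def * by (rule norm_sum_gchar_le_card)
    also have "\<dots> \<le> 9 * (2 * M)" using * M by (intro card_gann_le) auto
    finally show ?thesis by simp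
  qed
  have D_dist: "D n1 n2 * dist_gauss (complex_of_gauss (n1 - n2) * \<alpha>) \<le> 6 * sqrt (2 * M)"
    if n: "n1 \<in> Sn" "n2 \<in> Sn" for n1 n2
  proof -
    obtain A' B' where *: "A' \<ge> 0" "B' \<le> 2 * M" "(\<Sum>m\<in>S. of_real (c n1 m * c n2 m) * gchar (complex_of_gauss (n1 - n2) * \<alpha>) m) =
        (\<Sum>m\<in>gann A' B'. gchar (complex_of_gauss (n1 - n2) * \<alpha>) m)"
      using inner[OF n] by blast
    show ?thesis unfolding D_def * using * M by (intro sum_gchar_gann_bound) auto
  qed
  have G_eq: "(16 * L / q + 8) * (12 * (18 * M) + 12 * (6 * sqrt (2 * M)) / \<Delta>\<^sup>2) = G"
    by (simp add: G_def)
  have Sn_ball: "Sn \<subseteq> gball L" using Sn by (auto simp: gann_def gball_def)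
  \<comment> \<open>Schur's test: uniform bounds for the row and column sums of D bound the
    quadratic form in b by G times the sum of squares.\<close>
  have G1: "(\<Sum>n2\<in>Sn. D n1 n2) \<le> G" if n1: "n1 \<in> Sn" for n1
    unfolding G_eq[symmetric]
  proof (rule spaced_sum_gball[OF Sn_ball L q \<Delta>, where \<beta> = "\<lambda>n2. complex_of_gauss (n1 - n2) * \<alpha>"])
    fix n n' assume nn: "n \<in> Sn" "n' \<in> Sn" "n \<noteq> n'" "gauss_norm (n - n') < q"
    have "gauss_norm (n' - n) = gauss_norm (n - n')"
      by (simp add: gauss_norm_def complex_of_gauss_hom norm_minus_commute)
    then have "dist_gauss (complex_of_gauss (n' - n) * \<alpha>) \<ge> \<Delta>"
      using sp nn by (auto simp: spaced_freq_def)
    then show "dist_gauss (complex_of_gauss (n1 - n) * \<alpha> - complex_of_gauss (n1 - n') * \<alpha>) \<ge> \<Delta>"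
      by (simp add: complex_of_gauss_hom algebra_simps)
  qed (use n1 M D_le D_dist in auto)
  have G2: "(\<Sum>n1\<in>Sn. D n1 n2) \<le> G" if n2: "n2 \<in> Sn" for n2
    unfolding G_eq[symmetric]
  proof (rule spaced_sum_gball[OF Sn_ball L q \<Delta>, where \<beta> = "\<lambda>n1. complex_of_gauss (n1 - n2) * \<alpha>"])
    fix n n' assume nn: "n \<in> Sn" "n' \<in> Sn" "n \<noteq> n'" "gauss_norm (n - n') < q"
    then have "dist_gauss (complex_of_gauss (n - n') * \<alpha>) \<ge> \<Delta>"
      using sp by (auto simp: spaced_freq_def)
    then show "dist_gauss (complex_of_gauss (n - n2) * \<alpha> - complex_of_gauss (n' - n2) * \<alpha>) \<ge> \<Delta>"
      by (simp add: complex_of_gauss_hom algebra_simps)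
  qed (use n2 M D_le D_dist in auto)
  have Zsum: "(\<Sum>m\<in>S. (norm (Z m))\<^sup>2) \<le> (\<Sum>n\<in>Sn. (b n)\<^sup>2) * G"
  proof -
    have "complex_of_real (\<Sum>m\<in>S. (norm (Z m))\<^sup>2) = (\<Sum>m\<in>S. Z m * cnj (Z m))"
      by (simp only: of_real_sum complex_norm_square)
    also have "\<dots> = (\<Sum>m\<in>S. \<Sum>n1\<in>Sn. \<Sum>n2\<in>Sn. of_real (b n1 * b n2) *
       (of_real (c n1 m * c n2 m) * gchar (complex_of_gauss (n1 - n2) * \<alpha>) m))"
    proof (intro sum.cong refl)
      fix m
      have g: "gchar \<alpha> (n1 * m) * cnj (gchar \<alpha> (n2 * m)) = gchar (complex_of_gauss (n1 - n2) * \<alpha>) m" for n1 n2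
        by (simp add: gchar_def cnj_ee complex_of_gauss_hom algebra_simps flip: ee_add)
      show "Z m * cnj (Z m) = (\<Sum>n1\<in>Sn. \<Sum>n2\<in>Sn. of_real (b n1 * b n2) *
       (of_real (c n1 m * c n2 m) * gchar (complex_of_gauss (n1 - n2) * \<alpha>) m))"
        unfolding Z_def cnj_sum sum_product g[symmetric]
        by (intro sum.cong refl) (simp add: mult_ac)
    qed
    also have "\<dots> = (\<Sum>n1\<in>Sn. \<Sum>n2\<in>Sn. \<Sum>m\<in>S. of_real (b n1 * b n2) *
       (of_real (c n1 m * c n2 m) * gchar (complex_of_gauss (n1 - n2) * \<alpha>) m))"
    proof -
      have "(\<Sum>m\<in>S. \<Sum>n1\<in>Sn. \<Sum>n2\<in>Sn. of_real (b n1 * b n2) *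
         (of_real (c n1 m * c n2 m) * gchar (complex_of_gauss (n1 - n2) * \<alpha>) m)) =
        (\<Sum>n1\<in>Sn. \<Sum>m\<in>S. \<Sum>n2\<in>Sn. of_real (b n1 * b n2) *
         (of_real (c n1 m * c n2 m) * gchar (complex_of_gauss (n1 - n2) * \<alpha>) m))"
        by (rule sum.swap)
      also have "\<dots> = (\<Sum>n1\<in>Sn. \<Sum>n2\<in>Sn. \<Sum>m\<in>S. of_real (b n1 * b n2) *
         (of_real (c n1 m * c n2 m) * gchar (complex_of_gauss (n1 - n2) * \<alpha>) m))"
        by (rule sum.cong[OF refl], rule sum.swap)
      finally show ?thesis .
    qed
    finally have "norm (complex_of_real (\<Sum>m\<in>S. (norm (Z m))\<^sup>2)) \<le> (\<Sum>n1\<in>Sn. \<Sum>n2\<in>Sn. \<bar>b n1 * b n2\<bar> * D n1 n2)"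
      unfolding sum_distrib_left[symmetric] D_def
      by (auto intro!: order_trans[OF norm_sum] sum_mono simp: norm_mult abs_mult)
    then have "(\<Sum>m\<in>S. (norm (Z m))\<^sup>2) \<le> (\<Sum>n1\<in>Sn. \<Sum>n2\<in>Sn. \<bar>b n1 * b n2\<bar> * D n1 n2)"
      by (simp only: norm_of_real)
    also have "\<dots> \<le> (\<Sum>n1\<in>Sn. \<Sum>n2\<in>Sn. (b n1)\<^sup>2 * (D n1 n2 / 2) + (b n2)\<^sup>2 * (D n1 n2 / 2))"
    proof (intro sum_mono)
      fix n1 n2
      have "\<bar>b n1 * b n2\<bar> \<le> ((b n1)\<^sup>2 + (b n2)\<^sup>2) / 2"
        using sum_squares_bound[of "b n1" "b n2"] sum_squares_bound[of "b n1" "- b n2"] by (simp add: abs_le_iff)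
      then have "\<bar>b n1 * b n2\<bar> * D n1 n2 \<le> ((b n1)\<^sup>2 + (b n2)\<^sup>2) / 2 * D n1 n2"
        by (intro mult_right_mono) (auto simp: D_def)
      then show "\<bar>b n1 * b n2\<bar> * D n1 n2 \<le> (b n1)\<^sup>2 * (D n1 n2 / 2) + (b n2)\<^sup>2 * (D n1 n2 / 2)"
        by (simp add: algebra_simps)
    qed
    also have "\<dots> = (\<Sum>n1\<in>Sn. (b n1)\<^sup>2 * ((\<Sum>n2\<in>Sn. D n1 n2) / 2)) + (\<Sum>n2\<in>Sn. (b n2)\<^sup>2 * ((\<Sum>n1\<in>Sn. D n1 n2) / 2))"
      unfolding sum.distrib by (subst (2) sum.swap) (simp add: sum_distrib_left sum_divide_distrib)
    also have "\<dots> \<le> (\<Sum>n\<in>Sn. (b n)\<^sup>2 * (G / 2)) + (\<Sum>n\<in>Sn. (b n)\<^sup>2 * (G / 2))"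
      by (intro add_mono sum_mono mult_left_mono divide_right_mono G1 G2) auto
    also have "\<dots> = (\<Sum>n\<in>Sn. (b n)\<^sup>2) * G" unfolding sum_distrib_right[symmetric] by simp
    finally show ?thesis .
  qed
  have "(\<Sum>m\<in>gann M (2 * M). \<Sum>n | n \<in> Sn \<and> A < gauss_norm (n * m) \<and> gauss_norm (n * m) \<le> B.
       of_real (a m * b n) * gchar \<alpha> (n * m)) = (\<Sum>m\<in>S. of_real (a m) * Z m)"
    unfolding S_def Z_def sum_distrib_left
    by (rule sum.cong[OF refl], rule sum.mono_neutral_cong_left) (use fin in \<open>auto simp: c_def\<close>)
  then have "norm (\<Sum>m\<in>gann M (2 * M). \<Sum>n | n \<in> Sn \<and> A < gauss_norm (n * m) \<and> gauss_norm (n * m) \<le> B.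
       of_real (a m * b n) * gchar \<alpha> (n * m)) \<le> (\<Sum>m\<in>S. \<bar>a m\<bar> * norm (Z m))"
    by (auto intro!: order_trans[OF norm_sum] sum_mono simp: norm_mult)
  then have "(norm (\<Sum>m\<in>gann M (2 * M). \<Sum>n | n \<in> Sn \<and> A < gauss_norm (n * m) \<and> gauss_norm (n * m) \<le> B.
       of_real (a m * b n) * gchar \<alpha> (n * m)))\<^sup>2 \<le> (\<Sum>m\<in>S. \<bar>a m\<bar> * norm (Z m))\<^sup>2"
    by (intro power_mono) auto
  also have "\<dots> \<le> (\<Sum>m\<in>S. \<bar>a m\<bar>\<^sup>2) * (\<Sum>m\<in>S. (norm (Z m))\<^sup>2)"
    by (rule Cauchy_Schwarz_ineq_sum)
  also have "\<dots> \<le> (\<Sum>m\<in>S. \<bar>a m\<bar>\<^sup>2) * ((\<Sum>n\<in>Sn. (b n)\<^sup>2) * G)"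
    by (intro mult_left_mono Zsum sum_nonneg) auto
  finally show ?thesis unfolding S_def G_def by simp
qed

text \<open>Two divisors d, e of k with gcd g have the form g a and g b with a, b coprime, and then
  g a b divides k. Pairs of divisors are thus covered by quadruples (g, a, b, r) with g a b r = k.
  Counting r first leaves three sums of inverse norms, hence the cube of a logarithm.\<close>

lemma card_gdiv_square_sum_le:
  assumes "X \<ge> 1"
  shows "(\<Sum>k\<in>gann 0 X. (real (card (gdiv k)))\<^sup>2) \<le> 9 * X * (36 * (1 + ln X)) ^ 3"
proof -
  define T where "T = (SIGMA g:gann 0 X. SIGMA a:gann 0 X. SIGMA b:gann 0 X. gann 0 (X / (gauss_norm g * gauss_norm a * gauss_norm b)))"
  define R where "R = (SIGMA k:gann 0 X. gdiv k \<times> gdiv k)"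
  have nz: "k \<noteq> 0" if "k \<in> gann 0 X" for k using that by (auto simp: gann_def)
  have "R \<subseteq> (\<lambda>(g, a, b, r). (g * a * b * r, g * a, g * b)) ` T"
  proof
    fix p assume "p \<in> R"
    then obtain k d e where p: "p = (k, d, e)" "k \<in> gann 0 X" "d dvd k" "e dvd k"
      by (auto simp: R_def gdiv_def)
    have k0: "k \<noteq> 0" using nz p by blast
    then have de0: "d \<noteq> 0" "e \<noteq> 0" using p by auto
    define g where "g = gcd d e"
    have g0: "g \<noteq> 0" using de0 by (simp add: g_def)
    obtain a b where ab': "d = a * g" "e = b * g" "coprime a b"
      using gcd_coprime_exists[of d e] g0 unfolding g_def by blast
    then have ab: "d = g * a" "e = g * b" "coprime a b" by (simp_all only: mult.commute)
    have "g * a * b dvd k"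
    proof -
      obtain k' where k': "k = g * k'" using p(3) ab(1) by (metis dvd_def dvd_mult_left)
      have "a dvd k'" "b dvd k'" using p ab k' g0 by auto
      then have "a * b dvd k'" using ab(3) by (simp add: divides_mult)
      then show ?thesis using k' by (simp add: mult.assoc)
    qed
    then obtain r where r: "k = g * a * b * r" by (meson dvdE)
    have n0: "a \<noteq> 0" "b \<noteq> 0" "r \<noteq> 0" using k0 r by auto
    have kX: "gauss_norm k \<le> X" using p by (simp add: gann_def)
    have le: "gauss_norm x \<le> X" if "x dvd k" for x
      using gauss_norm_dvd_le[OF that k0] kX by linarith
    have "g dvd k" "a dvd k" "b dvd k" using r by auto
    moreover have "gauss_norm r \<le> X / (gauss_norm g * gauss_norm a * gauss_norm b)"
      using kX g0 n0 unfolding r gauss_norm_mult by (simp add: field_simps gauss_norm_pos)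
    ultimately have "(g, a, b, r) \<in> T"
      using g0 n0 by (auto simp: T_def gann_def gauss_norm_pos intro!: le)
    then show "p \<in> (\<lambda>(g, a, b, r). (g * a * b * r, g * a, g * b)) ` T"
      using p r ab by (intro image_eqI[of _ _ "(g, a, b, r)"]) auto
  qed
  moreover have finT: "finite T" unfolding T_def by (intro finite_SigmaI finite_gann)
  ultimately have "card R \<le> card T" by (rule surj_card_le[rotated])
  have "(\<Sum>k\<in>gann 0 X. (real (card (gdiv k)))\<^sup>2) = real (card R)"
    unfolding R_def using nz by (subst card_SigmaI) (auto simp: power2_eq_square card_cartesian_product)
  also have "\<dots> \<le> real (card T)" using \<open>card R \<le> card T\<close> by simp
  also have "real (card T) = (\<Sum>g\<in>gann 0 X. \<Sum>a\<in>gann 0 X. \<Sum>b\<in>gann 0 X.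
      real (card (gann 0 (X / (gauss_norm g * gauss_norm a * gauss_norm b)))))"
    unfolding T_def by (simp add: card_SigmaI)
  also have "\<dots> \<le> (\<Sum>g\<in>gann 0 X. \<Sum>a\<in>gann 0 X. \<Sum>b\<in>gann 0 X.
      9 * X * ((1 / gauss_norm g) * ((1 / gauss_norm a) * (1 / gauss_norm b))))"
  proof (intro sum_mono)
    fix g a b
    define Y where "Y = X / (gauss_norm g * gauss_norm a * gauss_norm b)"
    have "real (card (gann 0 Y)) \<le> 9 * Y"
    proof (cases "Y \<ge> 1")
      case True
      then show ?thesis by (intro card_gann_le) auto
    next
      case False
      then have "gann 0 Y = {}" by (intro gann_eq_empty) auto
      moreover have "Y \<ge> 0" using assms by (simp add: Y_def)
      ultimately show ?thesis by simp
    qed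
    then show "real (card (gann 0 (X / (gauss_norm g * gauss_norm a * gauss_norm b)))) \<le>
       9 * X * ((1 / gauss_norm g) * ((1 / gauss_norm a) * (1 / gauss_norm b)))"
      by (simp add: Y_def mult_ac)
  qed
  also have "\<dots> = 9 * X * (\<Sum>t\<in>gann 0 X. 1 / gauss_norm t) ^ 3"
    by (simp only: power3_eq_cube sum_product sum_distrib_left sum_distrib_right mult_ac)
  also have "\<dots> \<le> 9 * X * (36 * (1 + ln X)) ^ 3"
    using assms by (intro mult_left_mono power_mono inverse_norm_sum_le sum_nonneg) auto
  finally show ?thesis .
qed

section \<open>Vaughan's identity for exponential sums\<close>

definition vaughan_coeff :: "real \<Rightarrow> gauss_int \<Rightarrow> real" where
  "vaughan_coeff U k = (\<Sum>e\<in>gdiv k. if gauss_norm e > U then gmoebius e else 0)"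

definition vaughan_I :: "complex \<Rightarrow> real \<Rightarrow> real \<Rightarrow> real \<Rightarrow> complex" where
  "vaughan_I \<alpha> U A B = (\<Sum>e\<in>gcanon \<inter> gball B. if gauss_norm e \<le> U then of_real (gmoebius e) *
        (\<Sum>m\<in>gann (A / gauss_norm e) (B / gauss_norm e). of_real (ln (gauss_norm m)) * gchar \<alpha> (e * m)) else 0)"

text \<open>Effectively a Type I sum in the product d e, whose norm goes up to U^2. This is the
  longer of the two Type I ranges and the reason to keep U small.\<close>

definition vaughan_I2 :: "complex \<Rightarrow> real \<Rightarrow> real \<Rightarrow> real \<Rightarrow> complex" where
  "vaughan_I2 \<alpha> U A B = (\<Sum>d\<in>gcanon \<inter> gball B. if gauss_norm d \<le> U then of_real (gmangoldt d) *
        (\<Sum>e\<in>gcanon \<inter> gball (B / gauss_norm d). if gauss_norm e \<le> U then of_real (gmoebius e) *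
          (\<Sum>m\<in>gann (A / gauss_norm (d * e)) (B / gauss_norm (d * e)). gchar \<alpha> (d * e * m)) else 0) else 0)"

text \<open>The bilinear part: the weights of d and of k both vanish at norms from 1 to U, so
  neither variable can be short.\<close>

definition vaughan_II :: "complex \<Rightarrow> real \<Rightarrow> real \<Rightarrow> real \<Rightarrow> complex" where
  "vaughan_II \<alpha> U A B = (\<Sum>d\<in>gcanon \<inter> gball B. \<Sum>k\<in>gann (A / gauss_norm d) (B / gauss_norm d).
     of_real ((if gauss_norm d > U then gmangoldt d else 0) * vaughan_coeff U k) * gchar \<alpha> (d * k))"

text \<open>As A is at least U, every n in the annulus lies in the range of the pointwise identity.
  Exchanging the sums over n and over its divisors then frees the cofactor.\<close>

lemma vaughan_gchar:
  assumes "U \<ge> 0" "A \<ge> U"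
  shows "(\<Sum>n\<in>gann A B. of_real (gmangoldt n) * gchar \<alpha> n) =
    vaughan_I \<alpha> U A B
    - vaughan_I2 \<alpha> U A B
    + vaughan_II \<alpha> U A B"
proof -
  have A0: "A \<ge> 0" using assms by linarith
  define G1 where "G1 e m = (if gauss_norm e \<le> U then of_real (gmoebius e) * (of_real (ln (gauss_norm m)) * gchar \<alpha> (e * m)) else 0)" for e m
  define G2 where "G2 d k = (if gauss_norm d \<le> U then of_real (gmangoldt d) *
     (\<Sum>e\<in>gdiv k. if gauss_norm e \<le> U then of_real (gmoebius e) * gchar \<alpha> (d * e * (k div e)) else 0) else 0)" for d k
  define G3 where "G3 d k = of_real ((if gauss_norm d > U then gmangoldt d else 0) *
          (\<Sum>e\<in>gdiv k. if gauss_norm e > U then gmoebius e else 0)) * gchar \<alpha> (d * k)" for d k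
  have "(\<Sum>n\<in>gann A B. of_real (gmangoldt n) * gchar \<alpha> n) =
     (\<Sum>n\<in>gann A B. (\<Sum>e\<in>gdiv n. G1 e (n div e)) - (\<Sum>d\<in>gdiv n. G2 d (n div d)) + (\<Sum>d\<in>gdiv n. G3 d (n div d)))"
  proof (intro sum.cong refl)
    fix n assume n: "n \<in> gann A B"
    have n0: "n \<noteq> 0" "gauss_norm n > U" using n assms by (auto simp: gann_def)
    have dv: "d * (n div d) = n" if "d \<in> gdiv n" for d using that by (simp add: gdiv_def)
    have dv2: "d * e * (n div d div e) = n" if "d \<in> gdiv n" "e \<in> gdiv (n div d)" for d e
      using that by (simp add: gdiv_def mult.assoc)
    have 1: "(\<Sum>e\<in>gdiv n. G1 e (n div e)) =
       of_real (\<Sum>e\<in>gdiv n. if gauss_norm e \<le> U then gmoebius e * ln (gauss_norm (n div e)) else 0) * gchar \<alpha> n"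
      unfolding of_real_sum sum_distrib_right by (intro sum.cong refl) (auto simp: G1_def dv)
    have 2: "(\<Sum>d\<in>gdiv n. G2 d (n div d)) =
       of_real (\<Sum>d\<in>gdiv n. \<Sum>e\<in>gdiv (n div d). if gauss_norm d \<le> U \<and> gauss_norm e \<le> U then gmangoldt d * gmoebius e else 0) * gchar \<alpha> n"
      unfolding of_real_sum sum_distrib_right
    proof (intro sum.cong refl)
      fix d assume d: "d \<in> gdiv n"
      show "G2 d (n div d) = (\<Sum>e\<in>gdiv (n div d).
           of_real (if gauss_norm d \<le> U \<and> gauss_norm e \<le> U then gmangoldt d * gmoebius e else 0) * gchar \<alpha> n)"
      proof (cases "gauss_norm d \<le> U")
        case True
        then show ?thesis unfolding G2_def sum_distrib_left
          by (simp add: sum_distrib_left) (intro sum.cong refl; auto simp: dv2[OF d])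
      qed (simp add: G2_def)
    qed
    have 3: "(\<Sum>d\<in>gdiv n. G3 d (n div d)) =
       of_real (\<Sum>d\<in>gdiv n. \<Sum>e\<in>gdiv (n div d). if gauss_norm d > U \<and> gauss_norm e > U then gmangoldt d * gmoebius e else 0) * gchar \<alpha> n"
      unfolding of_real_sum[of _ "gdiv n"] sum_distrib_right
    proof (intro sum.cong refl)
      fix d assume d: "d \<in> gdiv n"
      have "(\<Sum>e\<in>gdiv (n div d). if gauss_norm d > U \<and> gauss_norm e > U then gmangoldt d * gmoebius e else 0)
        = (if gauss_norm d > U then gmangoldt d else 0) * (\<Sum>e\<in>gdiv (n div d). if gauss_norm e > U then gmoebius e else 0)"
        unfolding sum_distrib_left by (intro sum.cong refl) auto
      then show "G3 d (n div d) = of_real (\<Sum>e\<in>gdiv (n div d). if gauss_norm d > U \<and> gauss_norm e > U then gmangoldt d * gmoebius e else 0) * gchar \<alpha> n"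
        by (simp add: G3_def dv[OF d])
    qed
    show "of_real (gmangoldt n) * gchar \<alpha> n = (\<Sum>e\<in>gdiv n. G1 e (n div e)) - (\<Sum>d\<in>gdiv n. G2 d (n div d)) + (\<Sum>d\<in>gdiv n. G3 d (n div d))"
      unfolding 1 2 3 using vaughan_identity[OF n0]
      by (metis (no_types, lifting) distrib_right left_diff_distrib of_real_add of_real_diff)
  qed
  also have "\<dots> = (\<Sum>n\<in>gann A B. \<Sum>e\<in>gdiv n. G1 e (n div e)) - (\<Sum>n\<in>gann A B. \<Sum>d\<in>gdiv n. G2 d (n div d))
      + (\<Sum>n\<in>gann A B. \<Sum>d\<in>gdiv n. G3 d (n div d))"
    by (simp add: sum.distrib sum_subtractf)
  also have "(\<Sum>n\<in>gann A B. \<Sum>e\<in>gdiv n. G1 e (n div e)) = vaughan_I \<alpha> U A B"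
    unfolding vaughan_I_def sum_gann_gdiv[OF A0] by (intro sum.cong refl) (simp add: G1_def sum_distrib_left)
  also have "(\<Sum>n\<in>gann A B. \<Sum>d\<in>gdiv n. G3 d (n div d)) = vaughan_II \<alpha> U A B"
    unfolding vaughan_II_def vaughan_coeff_def sum_gann_gdiv[OF A0] by (simp add: G3_def)
  also have "(\<Sum>n\<in>gann A B. \<Sum>d\<in>gdiv n. G2 d (n div d)) = vaughan_I2 \<alpha> U A B"
    unfolding vaughan_I2_def sum_gann_gdiv[OF A0]
  proof (intro sum.cong refl)
    fix d
    show "(\<Sum>k\<in>gann (A / gauss_norm d) (B / gauss_norm d). G2 d k) =
      (if gauss_norm d \<le> U then of_real (gmangoldt d) *
        (\<Sum>e\<in>gcanon \<inter> gball (B / gauss_norm d). if gauss_norm e \<le> U then of_real (gmoebius e) *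
          (\<Sum>m\<in>gann (A / gauss_norm (d * e)) (B / gauss_norm (d * e)). gchar \<alpha> (d * e * m)) else 0) else 0)"
    proof (cases "gauss_norm d \<le> U")
      case True
      have A': "A / gauss_norm d \<ge> 0" using A0 by simp
      have "(\<Sum>k\<in>gann (A / gauss_norm d) (B / gauss_norm d). G2 d k) = of_real (gmangoldt d) *
        (\<Sum>k\<in>gann (A / gauss_norm d) (B / gauss_norm d). \<Sum>e\<in>gdiv k. if gauss_norm e \<le> U then of_real (gmoebius e) * gchar \<alpha> (d * e * (k div e)) else 0)"
        using True by (simp add: G2_def sum_distrib_left)
      also have "\<dots> = of_real (gmangoldt d) * (\<Sum>e\<in>gcanon \<inter> gball (B / gauss_norm d).
          \<Sum>m\<in>gann (A / gauss_norm d / gauss_norm e) (B / gauss_norm d / gauss_norm e). if gauss_norm e \<le> U then of_real (gmoebius e) * gchar \<alpha> (d * e * m) else 0)"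
        by (subst sum_gann_gdiv[OF A', of "\<lambda>e m. if gauss_norm e \<le> U then of_real (gmoebius e) * gchar \<alpha> (d * e * m) else 0"]) (rule refl)
      also have "\<dots> = of_real (gmangoldt d) *
        (\<Sum>e\<in>gcanon \<inter> gball (B / gauss_norm d). if gauss_norm e \<le> U then of_real (gmoebius e) *
          (\<Sum>m\<in>gann (A / gauss_norm (d * e)) (B / gauss_norm (d * e)). gchar \<alpha> (d * e * m)) else 0)"
        by (intro arg_cong2[of _ _ _ _ "(*)"] sum.cong refl) (simp add: sum_distrib_left gauss_norm_mult)
      finally show ?thesis using True by simp
    qed (simp add: G2_def)
  qed
  finally show ?thesis .
qed

lemma gmangoldt_le_ln: "d \<noteq> 0 \<Longrightarrow> gmangoldt d \<le> ln (gauss_norm d)"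
proof -
  assume d: "d \<noteq> 0"
  have "gmangoldt d = gmangoldt (normalize d)" by (simp add: gmangoldt_normalize)
  also have "\<dots> \<le> (\<Sum>e\<in>gdiv d. gmangoldt e)"
    using d by (intro member_le_sum) (auto simp: gmangoldt_nonneg gdiv_def finite_gdiv[unfolded gdiv_def])
  finally show ?thesis by (simp add: sum_gmangoldt_gdiv[OF d])
qed

text \<open>The outer weights are bounded by 1 and the logarithm inside is removed by partial
  summation, so \<open>type_I_sum\<close> applies with the weight ln N.\<close>

lemma vaughan_first_bound:
  assumes sp: "spaced_freq \<alpha> q \<Delta>" and q: "q > 0" and \<Delta>: "0 < \<Delta>"
    and U: "1 \<le> U" "U \<le> N" and A: "A \<ge> 0" and B: "B \<le> N"
  shows "norm (vaughan_I \<alpha> U A B)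
    \<le> ln N * (276 * (1 + ln N) * sqrt (N * U) / \<Delta> + 9 * N / q * (16 * U / q + 8))"
proof -
  define V where "V e = norm (\<Sum>m\<in>gann (A / gauss_norm e) (B / gauss_norm e). of_real (ln (gauss_norm m)) * gchar \<alpha> (e * m))" for e
  have V: "V e * c \<le> ln N * X"
    if e: "e \<in> gann 0 U" and c: "c \<ge> 0" "X \<ge> 0"
      and *: "\<And>A'. A' \<ge> 0 \<Longrightarrow> norm (\<Sum>m\<in>gann A' (B / gauss_norm e). gchar (complex_of_gauss e * \<alpha>) m) * c \<le> X"
    for e c X
  proof -
    have e: "gauss_norm e > 0" "gauss_norm e \<le> U" "gauss_norm e \<ge> 1" using e by (auto simp: gann_def)
    have P: "N / gauss_norm e \<ge> 1" using e(1,2) U by simp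
    have "V e * c \<le> ln (N / gauss_norm e) * X"
      unfolding V_def gchar_mult
      by (intro sum_ln_gchar_gann_bound * P) (use e A B U c in \<open>auto simp: divide_right_mono\<close>)
    also have "\<dots> \<le> ln N * X"
      using e U c by (intro mult_right_mono) (auto simp: ln_div)
    finally show ?thesis .
  qed
  have "(\<Sum>e\<in>gann 0 U. V e) \<le> ln N * (276 * (1 + ln N) * sqrt (N * U) / \<Delta> + 9 * N / q * (16 * U / q + 8))"
  proof (rule type_I_sum[OF sp q \<Delta>])
    fix e assume e: "e \<in> gann 0 U"
    then have e': "gauss_norm e > 0" "gauss_norm e \<le> N" "B / gauss_norm e \<le> N / gauss_norm e" using U B by (auto simp: gann_def divide_right_mono)
    then have P: "N / gauss_norm e \<ge> 1" by simp
    have "norm (\<Sum>m\<in>gann A' (B / gauss_norm e). gchar (complex_of_gauss e * \<alpha>) m) * 1 \<le> 9 * (N / gauss_norm e)" for A'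
      using norm_sum_gchar_le_card[of "complex_of_gauss e * \<alpha>" "gann A' (B / gauss_norm e)"] card_gann_le[OF P e'(3), of A'] by linarith
    from V[OF e _ _ this] show "V e \<le> ln N * (9 * N / gauss_norm e)" using P by simp
    have "norm (\<Sum>m\<in>gann A' (B / gauss_norm e). gchar (complex_of_gauss e * \<alpha>) m) * dist_gauss (complex_of_gauss e * \<alpha>)
       \<le> 6 * sqrt (N / gauss_norm e)" if "A' \<ge> 0" for A'
      using that e' P by (intro sum_gchar_gann_bound)
    from V[OF e _ _ this] show "V e * dist_gauss (complex_of_gauss e * \<alpha>) \<le> ln N * (6 * sqrt (N / gauss_norm e))"
      using P by simp
  qed (use U in auto)
  moreover have "norm (vaughan_I \<alpha> U A B)
     \<le> (\<Sum>e\<in>gcanon \<inter> gball B. if gauss_norm e \<le> U then V e else 0)"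
    unfolding vaughan_I_def
  proof (rule order_trans[OF norm_sum], rule sum_mono)
    fix e
    show "norm (if gauss_norm e \<le> U then of_real (gmoebius e) *
        (\<Sum>m\<in>gann (A / gauss_norm e) (B / gauss_norm e). of_real (ln (gauss_norm m)) * gchar \<alpha> (e * m)) else 0)
      \<le> (if gauss_norm e \<le> U then V e else 0)"
      using abs_gmoebius_le[of e] mult_right_mono[of "\<bar>gmoebius e\<bar>" 1 "V e"] by (auto simp: norm_mult V_def)
  qed
  moreover have "(\<Sum>e\<in>gcanon \<inter> gball B. if gauss_norm e \<le> U then V e else 0) \<le> (\<Sum>e\<in>gann 0 U. V e)"
  proof -
    have "(\<Sum>e\<in>gcanon \<inter> gball B. if gauss_norm e \<le> U then V e else 0) = (\<Sum>e\<in>{e \<in> gcanon \<inter> gball B. gauss_norm e \<le> U}. V e)"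
      by (rule sum.inter_filter[symmetric]) auto
    also have "\<dots> \<le> (\<Sum>e\<in>gann 0 U. V e)"
      by (rule sum_mono2[OF finite_gann]) (auto simp: gcanon_def gann_def V_def gauss_norm_pos)
    finally show ?thesis .
  qed
  ultimately show ?thesis by linarith
qed

text \<open>Pairs are grouped by their product t. The total weight of t is at most the sum of
  \<open>gmangoldt\<close> over the divisors of t, which is the logarithm of its norm; so no divisor
  function is lost.\<close>

lemma vaughan_second_bound:
  assumes sp: "spaced_freq \<alpha> q \<Delta>" and q: "q > 0" and \<Delta>: "0 < \<Delta>"
    and U: "1 \<le> U" "U\<^sup>2 \<le> N" and A: "A \<ge> 0" and B: "B \<le> N"
  shows "norm (vaughan_I2 \<alpha> U A B)
    \<le> ln N * (276 * (1 + ln N) * sqrt (N * U\<^sup>2) / \<Delta> + 9 * N / q * (16 * U\<^sup>2 / q + 8))"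
proof -
  have U2: "1 \<le> U\<^sup>2" using U by simp
  have N1: "N \<ge> 1" using U U2 by linarith
  define T where "T t = norm (\<Sum>m\<in>gann (A / gauss_norm t) (B / gauss_norm t). gchar \<alpha> (t * m))" for t
  have T0: "T t \<ge> 0" for t by (simp add: T_def)
  define C where "C = gcanon \<inter> gball U"
  have C: "finite C" "\<And>d. d \<in> C \<Longrightarrow> d \<noteq> 0 \<and> normalize d = d \<and> gauss_norm d \<le> U"
    unfolding C_def by simp (simp add: gcanon_def gball_def)
  have "norm (vaughan_I2 \<alpha> U A B)
     \<le> (\<Sum>d\<in>gcanon \<inter> gball B. if gauss_norm d \<le> U then (\<Sum>e\<in>C. gmangoldt d * T (d * e)) else 0)"
    unfolding vaughan_I2_def
  proof (rule order_trans[OF norm_sum], rule sum_mono)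
    fix d
    have "norm (\<Sum>e\<in>gcanon \<inter> gball (B / gauss_norm d). if gauss_norm e \<le> U then of_real (gmoebius e) *
          (\<Sum>m\<in>gann (A / gauss_norm (d * e)) (B / gauss_norm (d * e)). gchar \<alpha> (d * e * m)) else 0)
       \<le> (\<Sum>e\<in>gcanon \<inter> gball (B / gauss_norm d). if gauss_norm e \<le> U then T (d * e) else 0)"
    proof (rule order_trans[OF norm_sum], rule sum_mono)
      fix e
      show "norm (if gauss_norm e \<le> U then of_real (gmoebius e) *
          (\<Sum>m\<in>gann (A / gauss_norm (d * e)) (B / gauss_norm (d * e)). gchar \<alpha> (d * e * m)) else 0)
        \<le> (if gauss_norm e \<le> U then T (d * e) else 0)"
        using abs_gmoebius_le[of e] mult_right_mono[OF abs_gmoebius_le T0[of "d * e"]]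
        by (auto simp: norm_mult T_def)
    qed
    also have "\<dots> = (\<Sum>e\<in>{e \<in> gcanon \<inter> gball (B / gauss_norm d). gauss_norm e \<le> U}. T (d * e))"
      by (rule sum.inter_filter[symmetric]) auto
    also have "\<dots> \<le> (\<Sum>e\<in>C. T (d * e))"
      by (rule sum_mono2[OF C(1)]) (auto simp: C_def gball_def T0)
    finally show "norm (if gauss_norm d \<le> U then of_real (gmangoldt d) *
        (\<Sum>e\<in>gcanon \<inter> gball (B / gauss_norm d). if gauss_norm e \<le> U then of_real (gmoebius e) *
          (\<Sum>m\<in>gann (A / gauss_norm (d * e)) (B / gauss_norm (d * e)). gchar \<alpha> (d * e * m)) else 0) else 0)
      \<le> (if gauss_norm d \<le> U then (\<Sum>e\<in>C. gmangoldt d * T (d * e)) else 0)"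
      using gmangoldt_nonneg[of d] by (auto simp: norm_mult mult_left_mono simp flip: sum_distrib_left)
  qed
  also have "\<dots> = (\<Sum>d\<in>{d \<in> gcanon \<inter> gball B. gauss_norm d \<le> U}. \<Sum>e\<in>C. gmangoldt d * T (d * e))"
    by (rule sum.inter_filter[symmetric]) auto
  also have "\<dots> \<le> (\<Sum>d\<in>C. \<Sum>e\<in>C. gmangoldt d * T (d * e))"
    by (rule sum_mono2[OF C(1)]) (auto simp: C_def gball_def T0 gmangoldt_nonneg intro!: sum_nonneg)
  also have "\<dots> = (\<Sum>p\<in>C \<times> C. gmangoldt (fst p) * T (fst p * snd p))"
    by (simp add: sum.cartesian_product case_prod_unfold)
  also have "\<dots> = (\<Sum>t\<in>(\<lambda>p. fst p * snd p) ` (C \<times> C). \<Sum>p | p \<in> C \<times> C \<and> fst p * snd p = t. gmangoldt (fst p) * T (fst p * snd p))"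
    using C by (intro sum.image_gen) auto
  also have "\<dots> \<le> (\<Sum>t\<in>(\<lambda>p. fst p * snd p) ` (C \<times> C). ln (gauss_norm t) * T t)"
  proof (rule sum_mono)
    fix t assume "t \<in> (\<lambda>p. fst p * snd p) ` (C \<times> C)"
    then have t0: "t \<noteq> 0" using C by auto
    define F where "F = {p \<in> C \<times> C. fst p * snd p = t}"
    have inj: "inj_on fst F"
    proof (rule inj_onI)
      fix x y assume "x \<in> F" "y \<in> F" "fst x = fst y"
      moreover then have "fst x * snd x = fst x * snd y" "fst x \<noteq> 0" using C by (auto simp: F_def)
      ultimately show "x = y" by (simp add: prod_eq_iff)
    qed
    have "(\<Sum>p | p \<in> C \<times> C \<and> fst p * snd p = t. gmangoldt (fst p) * T (fst p * snd p)) = (\<Sum>p\<in>F. gmangoldt (fst p)) * T t"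
      unfolding F_def sum_distrib_right by (intro sum.cong refl) auto
    also have "(\<Sum>p\<in>F. gmangoldt (fst p)) = (\<Sum>d\<in>fst ` F. gmangoldt d)"
      by (subst sum.reindex[OF inj]) simp
    also have "(\<Sum>d\<in>fst ` F. gmangoldt d) * T t \<le> (\<Sum>d\<in>gdiv t. gmangoldt d) * T t"
      using C t0 by (intro mult_right_mono T0 sum_mono2[OF finite_gdiv[OF t0]]) (auto simp: F_def gdiv_def gmangoldt_nonneg)
    finally show "(\<Sum>p | p \<in> C \<times> C \<and> fst p * snd p = t. gmangoldt (fst p) * T (fst p * snd p)) \<le> ln (gauss_norm t) * T t"
      by (simp add: sum_gmangoldt_gdiv[OF t0])
  qed
  also have "\<dots> \<le> (\<Sum>t\<in>gann 0 (U\<^sup>2). ln (gauss_norm t) * T t)"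
  proof (rule sum_mono2)
    show "(\<lambda>p. fst p * snd p) ` (C \<times> C) \<subseteq> gann 0 (U\<^sup>2)"
    proof
      fix t assume "t \<in> (\<lambda>p. fst p * snd p) ` (C \<times> C)"
      then obtain d e where t: "t = d * e" "d \<in> C" "e \<in> C" by auto
      have "gauss_norm d * gauss_norm e \<le> U * U"
        using C(2)[OF t(2)] C(2)[OF t(3)] U by (intro mult_mono) auto
      then show "t \<in> gann 0 (U\<^sup>2)" using C(2)[OF t(2)] C(2)[OF t(3)]
        by (auto simp: t(1) gann_def gauss_norm_mult power2_eq_square gauss_norm_pos)
    qed
    show "0 \<le> ln (gauss_norm t) * T t" if "t \<in> gann 0 (U\<^sup>2) - (\<lambda>p. fst p * snd p) ` (C \<times> C)" for t
      using that by (intro mult_nonneg_nonneg T0) (auto simp: gann_def)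
  qed auto
  also have "\<dots> \<le> ln N * (276 * (1 + ln N) * sqrt (N * U\<^sup>2) / \<Delta> + 9 * N / q * (16 * U\<^sup>2 / q + 8))"
  proof (rule type_I_sum[OF sp q \<Delta> U2 U(2)])
    fix t assume t: "t \<in> gann 0 (U\<^sup>2)"
    then have t': "gauss_norm t > 0" "gauss_norm t \<le> N" "B / gauss_norm t \<le> N / gauss_norm t" "gauss_norm t \<ge> 1"
      using U B by (auto simp: gann_def divide_right_mono)
    have P: "N / gauss_norm t \<ge> 1" using t'(1,2) by simp
    have ln: "0 \<le> ln (gauss_norm t)" "ln (gauss_norm t) \<le> ln N" using t' by (simp_all only: ln_ge_zero ln_le_cancel_iff less_le_trans[OF t'(1,2)])
    have "T t \<le> 9 * (N / gauss_norm t)"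
      unfolding T_def gchar_mult
      using norm_sum_gchar_le_card[of "complex_of_gauss t * \<alpha>" "gann (A / gauss_norm t) (B / gauss_norm t)"]
        card_gann_le[OF P t'(3), of "A / gauss_norm t"] by linarith
    then show "ln (gauss_norm t) * T t \<le> ln N * (9 * N / gauss_norm t)"
      using ln T0 by (intro mult_mono) auto
    have TT: "T t * dist_gauss (complex_of_gauss t * \<alpha>) \<le> 6 * sqrt (N / gauss_norm t)"
      unfolding T_def gchar_mult using A t' P by (intro sum_gchar_gann_bound) auto
    show "ln (gauss_norm t) * T t * dist_gauss (complex_of_gauss t * \<alpha>) \<le> ln N * (6 * sqrt (N / gauss_norm t))"
      unfolding mult.assoc by (rule mult_mono[OF ln(2) TT]) (use ln T0 in auto)
  qed (use N1 in auto)
  finally show ?thesis .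
qed

section \<open>Bilinear sums over dyadic blocks\<close>

lemma sum_dyadic:
  "(\<Sum>d\<in>gann 1 (2 ^ K). f d) = (\<Sum>i<K. \<Sum>d\<in>gann (2 ^ i) (2 * 2 ^ i). f d)"
proof (induction K)
  case 0
  have "gann 1 (2 ^ 0) = {}" by (auto simp: gann_def)
  then show ?case by simp
next
  case (Suc K)
  have "gann 1 (2 ^ Suc K) = gann 1 (2 ^ K) \<union> gann (2 ^ K) (2 * 2 ^ K)"
  proof -
    have lt: "1 < x" if "2 ^ K < x" for x :: real
      using that one_le_power[of "2 :: real" K] by linarith
    show ?thesis by (auto simp: gann_def intro: lt)
  qed
  moreover have "gann 1 (2 ^ K) \<inter> gann (2 ^ K) (2 * 2 ^ K) = {}" by (auto simp: gann_def)
  ultimately show ?case using Suc by (simp add: sum.union_disjoint)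
qed

text \<open>For blocks of size M2 \<le> M with M M2 about N and M at most about N/U, these terms
  bound, in this order, the four products in the expansion of (M2/q + 1)(M + sqrt M /
  \<Delta>^2).\<close>

definition bilinear_gain :: "real \<Rightarrow> real \<Rightarrow> real \<Rightarrow> real \<Rightarrow> real" where
  "bilinear_gain N U q \<Delta> = N / q + N powr (3 / 4) / (q * \<Delta>\<^sup>2) + N / U + sqrt (N / U) / \<Delta>\<^sup>2"

text \<open>The exponent 3/4 arises from M2 sqrt M = M M2 / sqrt M, since the larger block has M at
  least about sqrt N.\<close>

lemma dyadic_gain:
  assumes q: "q > 0" and \<Delta>: "\<Delta> > 0" and U: "U \<ge> 1" and N: "N \<ge> 1"
    and M: "M \<ge> 1" "M2 \<ge> 1" "M2 \<le> M" "M * M2 \<le> N" "N \<le> 8 * (M * M2)" "U \<le> 2 * M2"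
  shows "(16 * (2 * M2) / q + 8) * (216 * M + 72 * sqrt (2 * M) / \<Delta>\<^sup>2) \<le> 6912 * bilinear_gain N U q \<Delta>"
proof -
  have MU: "M \<le> 2 * (N / U)"
  proof -
    have "M * U \<le> M * (2 * M2)" using M by (intro mult_left_mono) auto
    also have "\<dots> \<le> 2 * N" using M by simp
    finally show ?thesis using U by (simp add: field_simps)
  qed
  have sq2: "sqrt (2 * M) \<le> 3 / 2 * sqrt M"
  proof -
    have "sqrt 2 \<le> 3 / 2" by (rule real_le_lsqrt) (auto simp: power2_eq_square)
    then show ?thesis using M by (simp add: real_sqrt_mult mult_right_mono)
  qed
  have "N powr (1 / 4) \<le> 2 * sqrt M"
  proof -
    have "M * M2 \<le> M * M" using M by (intro mult_left_mono) auto
    then have "N \<le> 8 * (M * M)" using M by linarith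
    also have "\<dots> \<le> (2 * sqrt M) ^ 4" using M by (simp add: power4_eq_xxxx)
    finally have "N powr (1 / 4) \<le> ((2 * sqrt M) ^ 4) powr (1 / 4)"
      using N by (intro powr_mono2) auto
    also have "\<dots> = 2 * sqrt M"
    proof -
      have x: "2 * sqrt M > 0" using M by simp
      then have "(2 * sqrt M) ^ 4 = (2 * sqrt M) powr 4" by simp
      then have "((2 * sqrt M) ^ 4) powr (1 / 4) = (2 * sqrt M) powr (4 * (1 / 4))"
        by (simp only: powr_powr)
      then show ?thesis using x by simp
    qed
    finally show ?thesis .
  qed
  have M2M: "M2 * sqrt M \<le> 2 * N powr (3 / 4)"
  proof -
    have "M2 * sqrt M * N powr (1 / 4) \<le> M2 * sqrt M * (2 * sqrt M)"
      using M \<open>N powr (1 / 4) \<le> 2 * sqrt M\<close> by (intro mult_left_mono) auto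
    also have "\<dots> = 2 * (M * M2)" using M by simp
    also have "\<dots> \<le> 2 * N" using M by simp
    also have "\<dots> = 2 * N powr (3 / 4) * N powr (1 / 4)" using N powr_add[of N "3 / 4" "1 / 4"] by simp
    finally show ?thesis using N by simp
  qed
  have "(16 * (2 * M2) / q + 8) * (216 * M + 72 * sqrt (2 * M) / \<Delta>\<^sup>2) =
     6912 * ((M * M2) / q) + 2304 * (M2 * sqrt (2 * M)) / (q * \<Delta>\<^sup>2) + 1728 * M + 576 * sqrt (2 * M) / \<Delta>\<^sup>2"
    using q \<Delta> by (simp add: field_simps)
  also have "\<dots> \<le> 6912 * (N / q) + 2304 * (3 * N powr (3 / 4)) / (q * \<Delta>\<^sup>2) + 1728 * (2 * (N / U)) + 576 * (2 * sqrt (N / U)) / \<Delta>\<^sup>2"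
  proof (intro add_mono mult_left_mono divide_right_mono)
    have "M2 * sqrt (2 * M) \<le> M2 * (3 / 2 * sqrt M)" using sq2 M by (intro mult_left_mono) auto
    then show "M2 * sqrt (2 * M) \<le> 3 * N powr (3 / 4)" using M2M by linarith
    have "sqrt (2 * M) \<le> sqrt (2\<^sup>2 * (N / U))" using MU by simp
    then show "sqrt (2 * M) \<le> 2 * sqrt (N / U)" by (simp only: real_sqrt_mult) simp
  qed (use M q MU in auto)
  also have "\<dots> \<le> 6912 * (N / q) + 6912 * (N powr (3 / 4) / (q * \<Delta>\<^sup>2)) + 6912 * (N / U) + 6912 * (sqrt (N / U) / \<Delta>\<^sup>2)"
    using N U \<Delta> q by (intro add_mono) (auto simp: divide_right_mono)
  finally show ?thesis by (simp add: bilinear_gain_def)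
qed

text \<open>Both variables are cut into dyadic blocks, at most 4 l^2 pairs with l = 1 + ln N, and
  each pair is an instance of \<open>type_II_sum\<close>.\<close>

lemma vaughan_third_bound:
  assumes sp: "spaced_freq \<alpha> q \<Delta>" and q: "q > 0" and \<Delta>: "0 < \<Delta>" "\<Delta> \<le> 1 / 2"
    and U: "1 \<le> U" and N: "N \<ge> 1" and A: "N / 2 \<le> A" and B: "B \<le> N"
  shows "norm (vaughan_II \<alpha> U A B)
    \<le> 4 * (1 + ln N)\<^sup>2 * sqrt (324 * 72 ^ 3 * 6912 * (1 + ln N) ^ 5 * (N * bilinear_gain N U q \<Delta>))"
proof -
  define l where "l = 1 + ln N"
  have l1: "l \<ge> 1" using N by (simp add: l_def)
  have ln2N: "ln (2 * N) \<le> l"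
    using N ln_2_less_1 by (simp add: l_def ln_mult)
  define a where "a d = (if d \<in> gcanon \<and> gauss_norm d > U then gmangoldt d else 0)" for d
  define b where "b = vaughan_coeff U"
  define t where "t d k = (if A < gauss_norm (k * d) \<and> gauss_norm (k * d) \<le> B then of_real (a d * b k) * gchar \<alpha> (k * d) else 0)" for d k
  define K where "K = nat \<lceil>log 2 N\<rceil>"
  have K: "N \<le> 2 ^ K" "real K \<le> 2 * l"
  proof -
    have nn: "log 2 N \<ge> 0" using N by simp
    have "log 2 N \<le> real K" using nn by (simp add: K_def) 
    then show "N \<le> 2 ^ K" using N by (simp add: log_le_iff powr_realpow)
    have "real K \<le> log 2 N + 1" using nn unfolding K_def by linarith
    also have "log 2 N \<le> ln N / (1 / 2)"
      unfolding log_def using N ln2_ge_two_thirds by (intro divide_left_mono) auto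
    finally show "real K \<le> 2 * l" using N by (simp add: l_def)
  qed
  have b0: "b k = 0" if "k \<noteq> 0" "gauss_norm k \<le> U" for k
  proof -
    have "gauss_norm e \<le> U" if "e \<in> gdiv k" for e
      using that gauss_norm_dvd_le[of e k] \<open>k \<noteq> 0\<close> \<open>gauss_norm k \<le> U\<close> by (auto simp: gdiv_def)
    from leD[OF this] show ?thesis unfolding b_def vaughan_coeff_def by (intro sum.neutral ballI if_not_P)
  qed
  have a0: "a d = 0" if "gauss_norm d \<le> U" for d using that by (simp add: a_def)
  have A0: "A \<ge> 0" using A N by simp
  have b_le: "(b k)\<^sup>2 \<le> (real (card (gdiv k)))\<^sup>2" for k
  proof -
    have "\<bar>b k\<bar> \<le> (\<Sum>e\<in>gdiv k. 1)"
      unfolding b_def vaughan_coeff_def by (rule order_trans[OF sum_abs], rule sum_mono) (simp add: abs_gmoebius_le)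
    then have "\<bar>b k\<bar>\<^sup>2 \<le> (real (card (gdiv k)))\<^sup>2" by (intro power_mono) auto
    then show ?thesis by simp
  qed
  define D where "D i = gann (2 ^ i) (2 * 2 ^ i)" for i :: nat
  have D_card: "real (card (D i)) \<le> 18 * 2 ^ i" for i
  proof -
    have "1 \<le> 2 * (2 :: real) ^ i" using one_le_power[of "2 :: real" i] by linarith
    from card_gann_le[OF this order_refl, of "2 ^ i"] show ?thesis by (simp add: D_def)
  qed
  have pow_pos: "0 < x" if "2 ^ j < x" for x :: real and j :: nat
    by (rule less_trans[OF _ that]) simp
  have D_sub: "D j \<subseteq> gann 0 (2 * 2 ^ j)" for j :: nat
    by (auto simp: D_def gann_def intro: pow_pos)
  have suma: "(\<Sum>d\<in>D i. (a d)\<^sup>2) \<le> 18 * 2 ^ i * l\<^sup>2" if i: "2 ^ i \<le> N" for i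
  proof -
    have "(a d)\<^sup>2 \<le> l\<^sup>2" if d: "d \<in> D i" for d
    proof -
      have "1 \<le> (2 :: real) ^ i" by simp
      then have d': "gauss_norm d > 1" "gauss_norm d \<le> 2 * N" using d i unfolding D_def gann_def mem_Collect_eq by linarith+
      then have "d \<noteq> 0" by auto
      have "ln (gauss_norm d) \<le> ln (2 * N)" using d' by simp
      then have "\<bar>a d\<bar> \<le> l"
        using gmangoldt_le_ln[OF \<open>d \<noteq> 0\<close>] gmangoldt_nonneg[of d] ln2N l1 by (auto simp: a_def)
      then have "\<bar>a d\<bar>\<^sup>2 \<le> l\<^sup>2" by (intro power_mono) auto
      then show ?thesis by simp
    qed
    then have "(\<Sum>d\<in>D i. (a d)\<^sup>2) \<le> real (card (D i)) * l\<^sup>2" by (rule sum_bounded_above)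
    also have "\<dots> \<le> 18 * 2 ^ i * l\<^sup>2" by (intro mult_right_mono D_card) auto
    finally show ?thesis .
  qed
  have sumb: "(\<Sum>k\<in>D j. (b k)\<^sup>2) \<le> 18 * 2 ^ j * (72 * l) ^ 3" if j: "2 ^ j \<le> N" for j
  proof -
    have p1: "(1 :: real) \<le> 2 ^ j" by simp
    have "(\<Sum>k\<in>D j. (b k)\<^sup>2) \<le> (\<Sum>k\<in>D j. (real (card (gdiv k)))\<^sup>2)"
      by (intro sum_mono b_le)
    also have "\<dots> \<le> (\<Sum>k\<in>gann 0 (2 * 2 ^ j). (real (card (gdiv k)))\<^sup>2)"
      by (rule sum_mono2[OF finite_gann D_sub]) auto
    also have "\<dots> \<le> 9 * (2 * 2 ^ j) * (36 * (1 + ln (2 * 2 ^ j))) ^ 3"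
      using p1 by (intro card_gdiv_square_sum_le) linarith
    also have "\<dots> \<le> 9 * (2 * 2 ^ j) * (72 * l) ^ 3"
    proof (intro mult_left_mono power_mono)
      have "ln (2 * 2 ^ j) \<le> ln (2 * N)" using j N by simp
      then have "ln (2 * 2 ^ j) \<le> l" using ln2N by (rule order_trans)
      moreover have "36 * (1 + y) \<le> 72 * l" if "y \<le> l" for y using that l1 by (simp add: distrib_left)
      ultimately show "36 * (1 + ln (2 * 2 ^ j)) \<le> 72 * l" by blast
      have "ln (2 * 2 ^ j :: real) \<ge> 0" using p1 by (intro ln_ge_zero) linarith
      then show "0 \<le> 36 * (1 + ln (2 * 2 ^ j :: real))" by (intro mult_nonneg_nonneg add_nonneg_nonneg) auto
    qed auto
    finally show ?thesis by simp
  qed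
  define H where "H = bilinear_gain N U q \<Delta>"
  have H0: "H \<ge> 0" using N U q by (simp add: H_def bilinear_gain_def)
  \<comment> \<open>Of the power of l, l^2 comes from the mean square of the von Mangoldt weights
    and l^3 from that of the divisor function.\<close>
  define E where "E = 324 * 72 ^ 3 * 6912 * l ^ 5 * (N * H)"
  have E0: "E \<ge> 0" using H0 N l1 by (simp add: E_def)
  define P where "P i j = (\<Sum>d\<in>D i. \<Sum>k\<in>D j. t d k)" for i j
  have P_le: "norm (P i j) \<le> sqrt E" for i j
  \<comment> \<open>Outside these conditions the block is empty. The factor 8 arises since a product
    lies above A \<ge> N/2 and is at most 4 * 2^i * 2^j.\<close>
  proof (cases "2 ^ i * 2 ^ j \<le> N \<and> N \<le> 8 * (2 ^ i * 2 ^ j) \<and> U \<le> 2 * 2 ^ i \<and> U \<le> 2 * 2 ^ j")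
    case False
    have "t d k = 0" if d: "d \<in> D i" and k: "k \<in> D j" for d k
    proof (rule ccontr)
      assume nz: "t d k \<noteq> 0"
      have pos: "(0 :: real) < 2 ^ i" "(0 :: real) < 2 ^ j" by simp_all
      have d': "2 ^ i < gauss_norm d" "gauss_norm d \<le> 2 * 2 ^ i" and k': "2 ^ j < gauss_norm k" "gauss_norm k \<le> 2 * 2 ^ j"
        using d k by (auto simp: D_def gann_def)
      have "k \<noteq> 0" using k' pos by auto
      have AB: "A < gauss_norm (k * d)" "gauss_norm (k * d) \<le> B" and ab: "a d \<noteq> 0" "b k \<noteq> 0"
        using nz by (auto simp: t_def split: if_splits)
      have "gauss_norm d > U" "gauss_norm k > U" using a0 b0[OF \<open>k \<noteq> 0\<close>] ab by (meson not_le)+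
      moreover have "2 ^ i * 2 ^ j \<le> gauss_norm d * gauss_norm k" using d' k' pos by (intro mult_mono) auto
      moreover have "gauss_norm d * gauss_norm k \<le> (2 * 2 ^ i) * (2 * 2 ^ j)" using d' k' pos by (intro mult_mono) auto
      ultimately show False using False AB A B d' k' by (simp add: gauss_norm_mult mult.commute)
    qed
    then have "P i j = 0" unfolding P_def by (intro sum.neutral ballI) blast
    then show ?thesis using E0 by simp
  next
    case True
    have p1: "(1 :: real) \<le> 2 ^ i" "(1 :: real) \<le> 2 ^ j" by simp_all
    have le: "2 ^ i \<le> N" "2 ^ j \<le> N"
    proof -
      have "(2 :: real) ^ i * 1 \<le> 2 ^ i * 2 ^ j" by (rule mult_left_mono[OF p1(2)]) simp
      from order_trans[OF this conjunct1[OF True]] show "2 ^ i \<le> N" by (simp only: mult_1_right)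
      have "1 * (2 :: real) ^ j \<le> 2 ^ i * 2 ^ j" by (rule mult_right_mono[OF p1(1)]) simp
      from order_trans[OF this conjunct1[OF True]] show "2 ^ j \<le> N" by (simp only: mult_1_left)
    qed
    have "(norm (P i j))\<^sup>2 \<le> (\<Sum>d\<in>D i. (a d)\<^sup>2) * ((\<Sum>k\<in>D j. (b k)\<^sup>2) * (6912 * H))"
    \<comment> \<open>The larger block must be the variable over which the character sum runs after
      Cauchy's inequality. This forces the two symmetric cases.\<close>
    proof (cases "j \<le> i")
      case ji: True
      then have ij: "(2 :: real) ^ j \<le> 2 ^ i" by simp
      have "P i j = (\<Sum>m\<in>gann (2 ^ i) (2 * 2 ^ i). \<Sum>n | n \<in> D j \<and> A < gauss_norm (n * m) \<and> gauss_norm (n * m) \<le> B.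
          of_real (a m * b n) * gchar \<alpha> (n * m))"
        unfolding P_def t_def D_def by (intro sum.cong refl sum.inter_filter[symmetric]) auto
      then have "(norm (P i j))\<^sup>2 \<le> (\<Sum>d\<in>D i. (a d)\<^sup>2) * ((\<Sum>k\<in>D j. (b k)\<^sup>2) *
          ((16 * (2 * 2 ^ j) / q + 8) * (216 * 2 ^ i + 72 * sqrt (2 * 2 ^ i) / \<Delta>\<^sup>2)))"
        using type_II_sum[where a = a and b = b and B = B, OF sp q \<Delta> p1(1) _ A0 D_sub[of j]] unfolding D_def by simp
      also have "\<dots> \<le> (\<Sum>d\<in>D i. (a d)\<^sup>2) * ((\<Sum>k\<in>D j. (b k)\<^sup>2) * (6912 * H))"
        unfolding H_def using True
        by (intro mult_left_mono dyadic_gain q \<Delta>(1) U N p1 ij sum_nonneg) auto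
      finally show ?thesis .
    next
      case ji: False
      then have ij: "(2 :: real) ^ i \<le> 2 ^ j" by simp
      have t': "t d k = (if A < gauss_norm (d * k) \<and> gauss_norm (d * k) \<le> B then of_real (b k * a d) * gchar \<alpha> (d * k) else 0)" for d k
        by (simp add: t_def mult.commute)
      have "P i j = (\<Sum>k\<in>D j. \<Sum>d\<in>D i. t d k)" unfolding P_def by (rule sum.swap)
      also have "\<dots> = (\<Sum>m\<in>gann (2 ^ j) (2 * 2 ^ j). \<Sum>n | n \<in> D i \<and> A < gauss_norm (n * m) \<and> gauss_norm (n * m) \<le> B.
          of_real (b m * a n) * gchar \<alpha> (n * m))"
        unfolding t' D_def by (intro sum.cong refl sum.inter_filter[symmetric]) auto
      finally have "(norm (P i j))\<^sup>2 \<le> (\<Sum>k\<in>D j. (b k)\<^sup>2) * ((\<Sum>d\<in>D i. (a d)\<^sup>2) *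
          ((16 * (2 * 2 ^ i) / q + 8) * (216 * 2 ^ j + 72 * sqrt (2 * 2 ^ j) / \<Delta>\<^sup>2)))"
        using type_II_sum[where a = b and b = a and B = B, OF sp q \<Delta> p1(2) _ A0 D_sub[of i]] unfolding D_def by simp
      also have "\<dots> \<le> (\<Sum>k\<in>D j. (b k)\<^sup>2) * ((\<Sum>d\<in>D i. (a d)\<^sup>2) * (6912 * H))"
        unfolding H_def using True
        by (intro mult_left_mono dyadic_gain q \<Delta>(1) U N p1 ij sum_nonneg) (auto simp: mult.commute)
      finally show ?thesis by (simp add: mult_ac)
    qed
    also have "\<dots> \<le> (18 * 2 ^ i * l\<^sup>2) * ((18 * 2 ^ j * (72 * l) ^ 3) * (6912 * H))"
      by (intro mult_mono suma sumb le mult_nonneg_nonneg sum_nonneg) (use H0 l1 in auto)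
    also have "\<dots> = 324 * 72 ^ 3 * 6912 * l ^ 5 * ((2 ^ i * 2 ^ j) * H)"
      by (simp add: power_mult_distrib eval_nat_numeral mult_ac)
    also have "\<dots> \<le> E"
      unfolding E_def using True H0 l1 by (intro mult_left_mono mult_right_mono) auto
    finally show ?thesis by (rule real_le_rsqrt)
  qed
  have "vaughan_II \<alpha> U A B
     = (\<Sum>d\<in>gann 1 (2 ^ K). \<Sum>k\<in>gann 1 (2 ^ K). t d k)"
    unfolding vaughan_II_def b_def[symmetric]
  \<comment> \<open>Restricting both variables to norms above 1 loses nothing: the weights vanish at
    norms from 1 to U, and U is at least 1.\<close>
  proof (rule sum.mono_neutral_cong)
    show "(\<Sum>k\<in>gann (A / gauss_norm d) (B / gauss_norm d).
        of_real ((if gauss_norm d > U then gmangoldt d else 0) * b k) * gchar \<alpha> (d * k)) = 0"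
      if "d \<in> gcanon \<inter> gball B - gann 1 (2 ^ K)" for d
    proof -
      have "gauss_norm d \<le> U" using that U B K(1) by (auto simp: gball_def gann_def)
      then show ?thesis by simp
    qed
    show "(\<Sum>k\<in>gann 1 (2 ^ K). t d k) = 0" if d: "d \<in> gann 1 (2 ^ K) - gcanon \<inter> gball B" for d
    proof (intro sum.neutral ballI)
      fix k assume k: "k \<in> gann 1 (2 ^ K)"
      show "t d k = 0"
      proof (cases "d \<in> gcanon")
        case True
        then have "gauss_norm d > B" using d by (auto simp: gball_def)
        moreover have "1 * gauss_norm d \<le> gauss_norm k * gauss_norm d"
          using k by (intro mult_right_mono) (auto simp: gann_def)
        ultimately show ?thesis by (simp add: t_def gauss_norm_mult)
      qed (simp add: t_def a_def)
    qed
    show "(\<Sum>k\<in>gann (A / gauss_norm d) (B / gauss_norm d).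
        of_real ((if gauss_norm d > U then gmangoldt d else 0) * b k) * gchar \<alpha> (d * k)) =
       (\<Sum>k\<in>gann 1 (2 ^ K). t d k)" if d: "d \<in> gcanon \<inter> gball B \<inter> gann 1 (2 ^ K)" for d
    proof (rule sum.mono_neutral_cong)
      have dpos: "gauss_norm d > 1" "d \<in> gcanon" using d by (auto simp: gann_def)
      have mem: "k \<in> gann (A / gauss_norm d) (B / gauss_norm d) \<longleftrightarrow> A < gauss_norm (k * d) \<and> gauss_norm (k * d) \<le> B" for k
        using dpos by (simp add: gann_def gauss_norm_mult field_simps)
      show "t d k = 0" if "k \<in> gann 1 (2 ^ K) - gann (A / gauss_norm d) (B / gauss_norm d)" for k
        using that mem[of k] unfolding t_def by (intro if_not_P) blast
      show "of_real ((if gauss_norm d > U then gmangoldt d else 0) * b k) * gchar \<alpha> (d * k) = t d k"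
        if "k \<in> gann (A / gauss_norm d) (B / gauss_norm d) \<inter> gann 1 (2 ^ K)" for k
        using that mem[of k] dpos by (simp add: t_def a_def mult.commute)
      show "of_real ((if gauss_norm d > U then gmangoldt d else 0) * b k) * gchar \<alpha> (d * k) = 0"
        if k: "k \<in> gann (A / gauss_norm d) (B / gauss_norm d) - gann 1 (2 ^ K)" for k
      proof -
        have kk: "A < gauss_norm k * gauss_norm d" "gauss_norm k * gauss_norm d \<le> B"
          using k mem[of k] by (auto simp: gauss_norm_mult)
        then have "k \<noteq> 0" using A0 by auto
        have "gauss_norm k * 1 \<le> gauss_norm k * gauss_norm d" using dpos by (intro mult_left_mono) auto
        then have "gauss_norm k \<le> 2 ^ K" using kk B K(1) by linarith
        then have "gauss_norm k \<le> 1" using k by (auto simp: gann_def)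
        then have "b k = 0" using b0[OF \<open>k \<noteq> 0\<close>] U by linarith
        then show ?thesis by simp
      qed
    qed auto
  qed auto
  also have "\<dots> = (\<Sum>i<K. \<Sum>j<K. P i j)"
    unfolding sum_dyadic P_def D_def by (intro sum.cong refl sum.swap)
  also have "norm \<dots> \<le> (\<Sum>i<K. \<Sum>j<K. norm (P i j))"
    by (rule order_trans[OF norm_sum], rule sum_mono, rule norm_sum)
  also have "\<dots> \<le> (\<Sum>i<K. \<Sum>j<K. sqrt E)" by (intro sum_mono P_le)
  also have "\<dots> = (real K)\<^sup>2 * sqrt E" by (simp add: power2_eq_square)
  also have "\<dots> \<le> (2 * l)\<^sup>2 * sqrt E" using K(2) E0 by (intro mult_right_mono power_mono) auto
  also have "\<dots> = 4 * (1 + ln N)\<^sup>2 * sqrt (324 * 72 ^ 3 * 6912 * (1 + ln N) ^ 5 * (N * bilinear_gain N U q \<Delta>))"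
  proof -
    have "(2 * l)\<^sup>2 = 4 * l\<^sup>2" by (simp add: power_mult_distrib)
    then show ?thesis by (simp only: l_def E_def H_def)
  qed
  finally show ?thesis .
qed

subsection \<open>The exponential sum over Gaussian primes\<close>

text \<open>With \<open>U = N\<^bsup>1/6\<^esup>\<close> the Type I and Type II contributions both save \<open>N\<^bsup>1/12\<^esup>\<close>.\<close>

lemma sum_gmangoldt_gchar_bound:
  assumes sp: "spaced_freq \<alpha> q \<Delta>" and N: "N \<ge> 64" and A: "N / 2 \<le> A" and B: "B \<le> N"
    and c: "0 < c" "c \<le> 1"
    and q: "q \<ge> N powr (1 / 4)" and \<Delta>: "\<Delta> \<le> 1 / 2" "\<Delta> \<ge> c * N powr (- 1 / 5)"
    and q\<Delta>: "q * \<Delta>\<^sup>2 \<ge> c * N powr (- 1 / 12)"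
  shows "norm (\<Sum>n\<in>gann A B. of_real (gmangoldt n) * gchar \<alpha> n) \<le>
    10 ^ 8 / c * (1 + ln N) ^ 5 * N powr (11 / 12)"
proof -
  define l where "l = 1 + ln N"
  define U where "U = N powr (1 / 6)"
  have N0: "N > 0" "N \<ge> 1" using N by auto
  have l1: "l \<ge> 1" and lnl: "0 \<le> ln N" "ln N \<le> l" using N by (auto simp: l_def)
  have U1: "1 \<le> U" unfolding U_def using N by (intro ge_one_powr_ge_zero) auto
  have U2: "U\<^sup>2 = N powr (1 / 3)" unfolding U_def using N0 by (simp add: powr_power)
  have mono: "N powr x \<le> N powr y" if "x \<le> y" for x y using that N0 by (intro powr_mono) auto
  have Npow: "N powr 1 = N" using N0 by simp
  have U2N: "U\<^sup>2 \<le> N" unfolding U2 using mono[of "1 / 3" 1] Npow by simp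
  have UN: "U \<le> N" unfolding U_def using mono[of "1 / 6" 1] Npow by simp
  have UA: "U \<le> A"
  proof -
    have "U * U \<le> N" using U2N by (simp add: power2_eq_square)
    \<comment> \<open>Here N \<ge> 64 enters: it means U \<ge> 2, and then U \<le> N/2 follows from
      U^2 \<le> N.\<close>
    moreover have "2 * U \<le> U * U"
    proof -
      have "(64 :: real) powr (1 / 6) \<le> U" unfolding U_def using N by (intro powr_mono2) auto
      moreover have "(64 :: real) powr (1 / 6) = 2"
      proof -
        have "(64 :: real) = 2 powr 6" by simp
        then show ?thesis by (simp only: powr_powr) simp
      qed
      ultimately show ?thesis using U1 by (intro mult_right_mono) auto
    qed
    ultimately show ?thesis using A by linarith
  qed
  have Npos: "N powr x > 0" for x using N0 by simp
  have \<Delta>0: "\<Delta> > 0" using \<Delta>(2) c Npos[of "-1/5"] by (meson less_le_trans mult_pos_pos)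
  have q0: "q > 0" using q Npos[of "1/4"] by linarith
  have inv\<Delta>: "1 / \<Delta> \<le> 1 / c * N powr (1 / 5)"
  proof -
    have "1 / \<Delta> \<le> 1 / (c * N powr (- 1 / 5))"
      using \<Delta> \<Delta>0 c Npos by (intro divide_left_mono mult_pos_pos) auto
    also have "\<dots> = 1 / c * N powr (1 / 5)" by (simp add: powr_minus_divide)
    finally show ?thesis .
  qed
  have invq: "N / q \<le> N powr (3 / 4)"
  proof -
    have "N / q \<le> N / N powr (1 / 4)" using q Npos N0 q0 by (intro divide_left_mono mult_pos_pos) auto
    also have "\<dots> = N powr (3 / 4)" using N0 powr_diff[of N 1 "1 / 4"] by simp
    finally show ?thesis .
  qed
  have invq\<Delta>: "1 / (q * \<Delta>\<^sup>2) \<le> 1 / c * N powr (1 / 12)"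
  proof -
    have "1 / (q * \<Delta>\<^sup>2) \<le> 1 / (c * N powr (- 1 / 12))"
      using q\<Delta> \<Delta>0 c q0 Npos by (intro divide_left_mono mult_pos_pos) auto
    also have "\<dots> = 1 / c * N powr (1 / 12)" by (simp add: powr_minus_divide)
    finally show ?thesis .
  qed
  define Z where "Z = N powr (11 / 12)"
  have le_Z: "N powr x \<le> Z" if "x \<le> 11 / 12" for x unfolding Z_def by (rule mono[OF that])
  have I1: "sqrt (N * U\<^sup>2) / \<Delta> \<le> 1 / c * Z"
  proof -
    have "N * U\<^sup>2 = N powr (4 / 3)"
      unfolding U2 using N0 powr_add[of N 1 "1 / 3"] by simp
    then have "sqrt (N * U\<^sup>2) = N powr (2 / 3)"
      by (simp add: powr_half_sqrt[symmetric] powr_powr)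
    then have "sqrt (N * U\<^sup>2) / \<Delta> = N powr (2 / 3) * (1 / \<Delta>)" by simp
    also have "\<dots> \<le> N powr (2 / 3) * (1 / c * N powr (1 / 5))" by (intro mult_left_mono inv\<Delta>) auto
    also have "\<dots> = 1 / c * N powr (13 / 15)" by (simp add: powr_add[symmetric])
    also have "\<dots> \<le> 1 / c * Z" using c by (intro mult_left_mono le_Z) auto
    finally show ?thesis .
  qed
  have I2: "9 * N / q * (16 * U\<^sup>2 / q + 8) \<le> 216 * Z"
  proof -
    have "U\<^sup>2 / q \<le> N powr (1 / 3) / N powr (1 / 4)"
      unfolding U2 using q Npos q0 by (intro divide_left_mono mult_pos_pos) auto
    also have "\<dots> = N powr (1 / 12)" by (simp add: powr_diff[symmetric])
    finally have u: "U\<^sup>2 / q \<le> N powr (1 / 12)" .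
    have "1 \<le> N powr (1 / 12)" using mono[of 0 "1 / 12"] N0 by simp
    then have "16 * U\<^sup>2 / q + 8 \<le> 24 * N powr (1 / 12)" using u by simp
    then have "9 * (N / q) * (16 * U\<^sup>2 / q + 8) \<le> 9 * N powr (3 / 4) * (24 * N powr (1 / 12))"
      using invq q0 N0 by (intro mult_mono) auto
    also have "\<dots> = 216 * N powr (5 / 6)" by (simp add: powr_add[symmetric])
    also have "\<dots> \<le> 216 * Z" by (intro mult_left_mono le_Z) auto
    finally show ?thesis by simp
  qed
  have H: "N * bilinear_gain N U q \<Delta> \<le> (2 / c * Z)\<^sup>2"
  proof -
    have c2: "1 \<le> 1 / c" "1 / c \<le> 1 / c\<^sup>2" "1 \<le> 1 / c\<^sup>2"
      using c by (auto simp: field_simps power2_eq_square mult_le_one)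
    \<comment> \<open>The target size of each of the four terms, because N * W is the square of
      Z.\<close>
    define W where "W = N powr (5 / 6)"
    have le_W: "N powr x \<le> W" if "x \<le> 5 / 6" for x unfolding W_def by (rule mono[OF that])
    have W0: "W > 0" unfolding W_def by (rule Npos)
    have up: "y \<le> 1 / c\<^sup>2 * W" if "y \<le> d * W" "d \<le> 1 / c\<^sup>2" for y d
      using that(1) mult_right_mono[OF that(2), of W] W0 by linarith
    have h1: "N / q \<le> 1 / c\<^sup>2 * W"
      by (rule up[of _ 1]) (use invq le_W[of "3 / 4"] c2 in auto)
    have h2: "N powr (3 / 4) / (q * \<Delta>\<^sup>2) \<le> 1 / c\<^sup>2 * W"
    proof (rule up[OF _ c2(2)])
      have "N powr (3 / 4) / (q * \<Delta>\<^sup>2) = N powr (3 / 4) * (1 / (q * \<Delta>\<^sup>2))" by simp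
      also have "\<dots> \<le> N powr (3 / 4) * (1 / c * N powr (1 / 12))" by (intro mult_left_mono invq\<Delta>) auto
      also have "\<dots> = 1 / c * W" by (simp add: W_def powr_add[symmetric])
      finally show "N powr (3 / 4) / (q * \<Delta>\<^sup>2) \<le> 1 / c * W" .
    qed
    have NU: "N / U = W" using N0 powr_diff[of N 1 "1 / 6"] by (simp add: U_def W_def)
    have h3: "N / U \<le> 1 / c\<^sup>2 * W" by (rule up[of _ 1]) (use NU c2 in auto)
    have h4: "sqrt (N / U) / \<Delta>\<^sup>2 \<le> 1 / c\<^sup>2 * W"
    proof -
      have "sqrt (N / U) = N powr (5 / 12)" unfolding NU W_def by (simp add: powr_half_sqrt[symmetric] powr_powr)
      then have "sqrt (N / U) / \<Delta>\<^sup>2 = N powr (5 / 12) * (1 / \<Delta>)\<^sup>2" by (simp add: power_divide)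
      also have "\<dots> \<le> N powr (5 / 12) * (1 / c * N powr (1 / 5))\<^sup>2"
        using \<Delta>0 by (intro mult_left_mono power_mono inv\<Delta>) auto
      \<comment> \<open>5/12 + 2/5 = 49/60 is barely below 5/6. This is the term that limits how
        small the spacing \<Delta> may be.\<close>
      also have "\<dots> = 1 / c\<^sup>2 * N powr (49 / 60)"
      proof -
        have "(N powr (1 / 5))\<^sup>2 = N powr (2 / 5)" using N0 by (simp add: powr_power)
        then show ?thesis by (simp add: power_mult_distrib power_divide powr_add[symmetric])
      qed
      also have "\<dots> \<le> 1 / c\<^sup>2 * W" by (intro mult_left_mono le_W) auto
      finally show ?thesis .
    qed
    have "N * bilinear_gain N U q \<Delta> \<le> N * (4 / c\<^sup>2 * W)"
      unfolding bilinear_gain_def using h1 h2 h3 h4 N0 by (intro mult_left_mono) auto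
    also have "\<dots> = (2 / c)\<^sup>2 * (N powr 1 * N powr (5 / 6))" using Npow by (simp add: W_def power_divide)
    also have "\<dots> = (2 / c * Z)\<^sup>2"
      unfolding powr_add[symmetric] power_mult_distrib Z_def using N0 by (simp add: powr_power)
    finally show ?thesis .
  qed
  define S where "S = (\<Sum>n\<in>gann A B. of_real (gmangoldt n) * gchar \<alpha> n)"
  have "norm S \<le> ln N * (276 * (1 + ln N) * sqrt (N * U) / \<Delta> + 9 * N / q * (16 * U / q + 8))
     + ln N * (276 * (1 + ln N) * sqrt (N * U\<^sup>2) / \<Delta> + 9 * N / q * (16 * U\<^sup>2 / q + 8))
     + 4 * (1 + ln N)\<^sup>2 * sqrt (324 * 72 ^ 3 * 6912 * (1 + ln N) ^ 5 * (N * bilinear_gain N U q \<Delta>))"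
    unfolding S_def using U1 UA N
    by (subst vaughan_gchar[of U], simp, simp)
       (intro norm_triangle_le[OF add_mono[OF norm_triangle_le_diff[OF add_mono]]]
         vaughan_first_bound[OF sp q0 \<Delta>0 U1 UN _ B] vaughan_second_bound[OF sp q0 \<Delta>0 U1 U2N _ B]
         vaughan_third_bound[OF sp q0 \<Delta>0 \<Delta>(1) U1 N0(2) A B]; linarith)
  also have "\<dots> \<le> l * (276 * l * (1 / c * Z) + 216 * Z) + l * (276 * l * (1 / c * Z) + 216 * Z)
     + 4 * l\<^sup>2 * sqrt (324 * 72 ^ 3 * 6912 * l ^ 5 * (2 / c * Z)\<^sup>2)"
  proof -
    have UU: "U \<le> U\<^sup>2" using U1 by (simp add: power2_eq_square)
    have "276 * (1 + ln N) * sqrt (N * U) / \<Delta> \<le> 276 * l * (sqrt (N * U\<^sup>2) / \<Delta>)"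
      using UU N0 \<Delta>0 l1 by (auto simp: l_def divide_right_mono mult_left_mono)
    also have "\<dots> \<le> 276 * l * (1 / c * Z)" using I1 l1 by (intro mult_left_mono) auto
    finally have i1: "276 * (1 + ln N) * sqrt (N * U) / \<Delta> \<le> 276 * l * (1 / c * Z)" .
    have i1': "276 * (1 + ln N) * sqrt (N * U\<^sup>2) / \<Delta> \<le> 276 * l * (1 / c * Z)"
      using mult_left_mono[OF I1, of "276 * l"] l1 by (simp add: l_def)
    have i2: "9 * N / q * (16 * U / q + 8) \<le> 216 * Z"
      using UU q0 N0 by (intro order_trans[OF _ I2] mult_left_mono) (auto simp: divide_right_mono)
    have nn: "0 \<le> sqrt (N * U) / \<Delta>" "0 \<le> sqrt (N * U\<^sup>2) / \<Delta>" "0 \<le> 9 * N / q * (16 * U / q + 8)" "0 \<le> 9 * N / q * (16 * U\<^sup>2 / q + 8)"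
      using N0 U1 \<Delta>0 q0 by auto
    show ?thesis
    proof (intro add_mono)
      show "ln N * (276 * (1 + ln N) * sqrt (N * U) / \<Delta> + 9 * N / q * (16 * U / q + 8)) \<le> l * (276 * l * (1 / c * Z) + 216 * Z)"
        by (rule mult_mono[OF lnl(2) add_mono[OF i1 i2]]; (rule add_nonneg_nonneg)?) (use nn lnl \<Delta>0 l1 N0 U1 in auto)
      show "ln N * (276 * (1 + ln N) * sqrt (N * U\<^sup>2) / \<Delta> + 9 * N / q * (16 * U\<^sup>2 / q + 8)) \<le> l * (276 * l * (1 / c * Z) + 216 * Z)"
        by (rule mult_mono[OF lnl(2) add_mono[OF i1' I2]]; (rule add_nonneg_nonneg)?) (use nn lnl \<Delta>0 l1 N0 U1 in auto)
      show "4 * (1 + ln N)\<^sup>2 * sqrt (324 * 72 ^ 3 * 6912 * (1 + ln N) ^ 5 * (N * bilinear_gain N U q \<Delta>))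
         \<le> 4 * l\<^sup>2 * sqrt (324 * 72 ^ 3 * 6912 * l ^ 5 * (2 / c * Z)\<^sup>2)"
        unfolding l_def[symmetric] using l1 by (intro mult_left_mono real_sqrt_le_mono H) auto
    qed
  qed
  also have "\<dots> \<le> 10 ^ 8 / c * l ^ 5 * Z"
  proof -
    have Z0: "Z > 0" unfolding Z_def by (rule Npos)
    have c1: "1 \<le> 1 / c" using c by simp
    have cz: "Z \<le> 1 / c * Z" using mult_right_mono[OF c1, of Z] Z0 by simp
    define Y where "Y = 1 / c * Z"
    have Y0: "Y > 0" using c Z0 by (simp add: Y_def)
    have p: "l ^ i * Y \<le> l ^ 5 * Y" if "i \<le> 5" for i
      using that l1 Y0 by (intro mult_right_mono power_increasing) auto
    \<comment> \<open>The root of 4 * 324 * 72^3 * 6912 is just below 2 * 10^6, and l^5 is raised to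
      l^6 to obtain a perfect square.\<close>
    have s: "sqrt (324 * 72 ^ 3 * 6912 * l ^ 5 * (2 / c * Z)\<^sup>2) \<le> 2 * 10 ^ 6 * (l ^ 3 * Y)"
    proof (rule real_le_lsqrt)
      have "l ^ 5 \<le> l ^ 6" using l1 by (intro power_increasing) auto
      then have "324 * 72 ^ 3 * 6912 * l ^ 5 * (2 * Y)\<^sup>2 \<le> 324 * 72 ^ 3 * 6912 * l ^ 6 * (2 * Y)\<^sup>2"
        by (intro mult_right_mono mult_left_mono) auto
      also have "\<dots> \<le> (2 * 10 ^ 6)\<^sup>2 * l ^ 6 * Y\<^sup>2"
        using l1 by (simp add: power_mult_distrib)
      also have "\<dots> = (2 * 10 ^ 6 * (l ^ 3 * Y))\<^sup>2" by (simp add: power_mult_distrib flip: power_mult)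
      finally show "324 * 72 ^ 3 * 6912 * l ^ 5 * (2 / c * Z)\<^sup>2 \<le> (2 * 10 ^ 6 * (l ^ 3 * Y))\<^sup>2"
        by (simp add: Y_def)
    qed (use l1 Y0 in auto)
    have "l * (276 * l * Y + 216 * Z) \<le> l * (276 * l * Y + 216 * Y)"
      using cz l1 by (intro mult_left_mono) (auto simp: Y_def)
    also have "\<dots> = 276 * (l ^ 2 * Y) + 216 * (l ^ 1 * Y)" by (simp add: power2_eq_square algebra_simps)
    also have "\<dots> \<le> 276 * (l ^ 5 * Y) + 216 * (l ^ 5 * Y)" by (intro add_mono mult_left_mono p) auto
    also have "\<dots> = 492 * (l ^ 5 * Y)" by (simp only: distrib_right[symmetric]) simp
    finally have a1: "l * (276 * l * Y + 216 * Z) \<le> 492 * (l ^ 5 * Y)" .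
    have "4 * l\<^sup>2 * sqrt (324 * 72 ^ 3 * 6912 * l ^ 5 * (2 / c * Z)\<^sup>2) \<le> 4 * l\<^sup>2 * (2 * 10 ^ 6 * (l ^ 3 * Y))"
      using l1 by (intro mult_left_mono s) auto
    also have "\<dots> = 8 * 10 ^ 6 * (l ^ 5 * Y)" by (simp add: eval_nat_numeral)
    finally have a2: "4 * l\<^sup>2 * sqrt (324 * 72 ^ 3 * 6912 * l ^ 5 * (2 / c * Z)\<^sup>2) \<le> 8 * 10 ^ 6 * (l ^ 5 * Y)" .
    have "492 * x + 492 * x + 8 * 10 ^ 6 * x \<le> 10 ^ 8 * x" if "x \<ge> 0" for x :: real
      using that by simp
    moreover have "l ^ 5 * Y \<ge> 0" using l1 Y0 by simp
    ultimately have big: "492 * (l ^ 5 * Y) + 492 * (l ^ 5 * Y) + 8 * 10 ^ 6 * (l ^ 5 * Y) \<le> 10 ^ 8 * (l ^ 5 * Y)"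
      by blast
    have "10 ^ 8 * (l ^ 5 * Y) = 10 ^ 8 / c * l ^ 5 * Z" by (simp add: Y_def)
    with order_trans[OF add_mono[OF add_mono[OF a1 a1] a2] big] show ?thesis
      unfolding Y_def by (simp only:)
  qed
  finally show ?thesis by (simp add: S_def l_def Z_def)
qed

section \<open>From von Mangoldt weights to primes\<close>

lemma gmangoldt_prime_elem:
  assumes "prime_elem p"
  shows "gmangoldt p = ln (gauss_norm p)"
proof -
  have "prime (normalize p)" using assms by (simp add: prime_def prime_elem_normalize_iff)
  then have "prime_factorization (normalize p) = {#normalize p#}" by (rule prime_factorization_prime)
  then have "prime_factors p = {normalize p}" by (simp add: prime_factorization_normalize)
  then show ?thesis by (simp add: gmangoldt_def)
qed

lemma gauss_norm_prime_ge_2: "prime p \<Longrightarrow> gauss_norm p \<ge> 2"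
proof -
  assume "prime p"
  then have "(gre p)\<^sup>2 + (gim p)\<^sup>2 > 1" using gauss_norm_prime_gt_1[of p] unfolding gauss_norm_int by linarith
  then show ?thesis unfolding gauss_norm_int by linarith
qed

text \<open>What remains are units times p^k with k \<ge> 2. Then p has norm at most sqrt X and k is
  at most log_2 X; with the four units these data determine n, so there are only about sqrt X ln X
  such n.\<close>

lemma sum_gmangoldt_nonprime_le:
  assumes "X \<ge> 1"
  shows "(\<Sum>n | n \<in> gball X \<and> \<not> prime_elem n. gmangoldt n) \<le> 72 * (1 + ln X)\<^sup>2 * sqrt X"
proof -
  define S where "S = {n \<in> gball X. \<not> prime_elem n \<and> is_singleton (prime_factors n)}"
  define K where "K = nat \<lfloor>log 2 X\<rfloor>"
  define T where "T = {1, - 1, Gauss_Int 0 1, Gauss_Int 0 (- 1)} \<times> gball (sqrt X) \<times> {1..K}"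
  define f where "f n = (unit_factor n, the_elem (prime_factors n), size (prime_factorization n))" for n :: gauss_int
  have pf: "prime_factorization n = replicate_mset (size (prime_factorization n)) (the_elem (prime_factors n))"
    if sing: "is_singleton (prime_factors n)" for n :: gauss_int
  proof -
    obtain p where p: "prime_factors n = {p}" using sing by (auto simp: is_singleton_def)
    then have "prime_factorization n = replicate_mset (count (prime_factorization n) p) p"
      by (intro multiset_eqI) (metis count_eq_zero_iff count_replicate_mset singletonD)
    then show ?thesis using p by (metis size_replicate_mset the_elem_eq)
  qed
  have "inj_on f S"
  proof (rule inj_onI)
    fix x y assume xy: "x \<in> S" "y \<in> S" "f x = f y"
    then have "prime_factorization x = prime_factorization y"
      using pf[of x] pf[of y] by (simp add: S_def f_def)
    moreover have "x \<noteq> 0" "y \<noteq> 0" using xy by (auto simp: S_def is_singleton_def)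
    ultimately have "normalize x = normalize y" by (metis prod_mset_prime_factorization_weak)
    moreover have "unit_factor x = unit_factor y" using xy by (simp add: f_def)
    ultimately show "x = y" by (metis unit_factor_mult_normalize)
  qed
  moreover have "f ` S \<subseteq> T"
  proof
    fix z assume "z \<in> f ` S"
    then obtain n where n: "n \<in> S" "z = f n" by auto
    define k where "k = size (prime_factorization n)"
    define p where "p = the_elem (prime_factors n)"
    have pfn: "prime_factorization n = replicate_mset k p"
      using n pf[of n] by (simp add: S_def k_def p_def)
    have "is_singleton (prime_factors n)" using n(1) by (simp add: S_def)
    then have sing: "prime_factors n = {p}" unfolding p_def by (simp add: is_singleton_the_elem)
    then have n0: "n \<noteq> 0" by (metis prime_factorization_0 set_mset_empty empty_not_insert)
    have p: "prime p" using sing by (metis in_prime_factors_imp_prime insertI1)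
    have nn: "normalize (p ^ k) = normalize n"
      using prod_mset_prime_factorization_weak[OF n0] by (simp add: pfn)
    have k0: "k \<noteq> 0"
    proof
      assume "k = 0"
      then have "prime_factors n = {}" unfolding pfn by simp
      then show False using sing by simp
    qed
    have "k \<noteq> 1"
    proof
      assume "k = 1"
      then have "prime_elem (normalize n)" using nn p by (metis normalize_prime power_one_right prime_def)
      then show False using n by (simp add: S_def)
    qed
    with k0 have k2: "k \<ge> 2" by linarith
    have norm: "gauss_norm n = gauss_norm p ^ k"
      using nn by (metis gauss_norm_normalize gauss_norm_power)
    have nX: "gauss_norm n \<le> X" using n by (auto simp: S_def gball_def)
    have p2: "gauss_norm p \<ge> 2" by (rule gauss_norm_prime_ge_2[OF p])
    have "gauss_norm p ^ 2 \<le> gauss_norm p ^ k" using k2 p2 by (intro power_increasing) auto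
    then have "gauss_norm p \<le> sqrt X" using norm nX by (intro real_le_rsqrt) linarith
    moreover have "k \<le> K"
    proof -
      have "2 ^ k \<le> gauss_norm p ^ k" using p2 by (intro power_mono) auto
      then have "2 ^ k \<le> X" using norm nX by linarith
      then have "real k \<le> log 2 X" using assms by (simp add: le_log_iff powr_realpow)
      then show ?thesis unfolding K_def by linarith
    qed
    moreover have "unit_factor n \<in> {1, - 1, Gauss_Int 0 1, Gauss_Int 0 (- 1)}"
      by (rule gauss_int_unit_cases) (use n0 in simp)
    ultimately show "z \<in> T" using k2 unfolding n(2) f_def T_def k_def[symmetric] p_def[symmetric]
      by (auto simp: gball_def)
  qed
  moreover have "finite T" by (simp add: T_def)
  ultimately have "card S \<le> card T" by (metis card_inj_on_le)
  also have "\<dots> \<le> 4 * (card (gball (sqrt X)) * K)"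
  proof -
    have "card {1, - 1, Gauss_Int 0 1, Gauss_Int 0 (- 1)} \<le> 4" by (simp add: card_insert_if)
    then show ?thesis unfolding T_def card_cartesian_product by (intro mult_le_mono) auto
  qed
  finally have "real (card S) \<le> real (4 * (card (gball (sqrt X)) * K))" by (rule of_nat_mono)
  also have "\<dots> \<le> 4 * ((9 * sqrt X) * (2 * (1 + ln X)))"
  proof -
    have "real (card (gball (sqrt X))) \<le> 9 * sqrt X" using assms by (intro card_gball_le) auto
    moreover have "real K \<le> 2 * (1 + ln X)"
    proof -
      have "real K \<le> log 2 X" using assms by (simp add: K_def)
      also have "log 2 X \<le> ln X / (1 / 2)"
        unfolding log_def using assms ln2_ge_two_thirds by (intro divide_left_mono) auto
      finally show ?thesis by simp
    qed
    ultimately have "real (card (gball (sqrt X))) * real K \<le> (9 * sqrt X) * (2 * (1 + ln X))"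
      using assms by (intro mult_mono) auto
    then have "4 * (real (card (gball (sqrt X))) * real K) \<le> 4 * ((9 * sqrt X) * (2 * (1 + ln X)))"
      by (rule mult_left_mono) simp
    then show ?thesis by (simp only: of_nat_mult of_nat_numeral)
  qed
  also have "\<dots> = 72 * sqrt X * (1 + ln X)" by (simp add: algebra_simps)
  finally have card: "real (card S) \<le> 72 * sqrt X * (1 + ln X)" .
  have "(\<Sum>n | n \<in> gball X \<and> \<not> prime_elem n. gmangoldt n) = (\<Sum>n\<in>S. gmangoldt n)"
  proof (rule sum.mono_neutral_right)
    show "finite {n. n \<in> gball X \<and> \<not> prime_elem n}" by (rule finite_subset[OF _ finite_gball[of X]]) auto
  qed (auto simp: S_def gmangoldt_def)
  also have "\<dots> \<le> real (card S) * (1 + ln X)"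
  proof (rule sum_bounded_above)
    fix n assume n: "n \<in> S"
    then have n0: "n \<noteq> 0" by (auto simp: S_def is_singleton_def)
    have "gmangoldt n \<le> ln (gauss_norm n)" by (rule gmangoldt_le_ln[OF n0])
    also have "\<dots> \<le> ln X"
    proof -
      have "gauss_norm n > 0" by (rule gauss_norm_pos[OF n0])
      moreover have "gauss_norm n \<le> X" using n by (simp add: S_def gball_def)
      ultimately show ?thesis by simp
    qed
    finally show "gmangoldt n \<le> 1 + ln X" by simp
  qed
  also have "\<dots> \<le> 72 * sqrt X * (1 + ln X) * (1 + ln X)"
    using card assms by (intro mult_right_mono) auto
  finally show ?thesis by (simp add: power2_eq_square mult_ac)
qed

definition gprimes :: "real \<Rightarrow> real \<Rightarrow> gauss_int set" where
  "gprimes A B = {p \<in> gann A B. prime_elem p}"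

lemma finite_gprimes [simp, intro]: "finite (gprimes A B)"
  by (rule finite_subset[OF _ finite_gann[of A B]]) (auto simp: gprimes_def)

text \<open>F is arbitrary because the estimate is used both for characters and, with F = 1, for
  counting primes.\<close>

lemma norm_prime_sum_diff_le:
  fixes F :: "gauss_int \<Rightarrow> complex"
  assumes "N \<ge> 1" "B \<le> N" and F: "\<And>n. norm (F n) \<le> 1"
  shows "norm ((\<Sum>n\<in>gann A B. of_real (gmangoldt n) * F n) - (\<Sum>p\<in>gprimes A B. of_real (ln (gauss_norm p)) * F p))
    \<le> 72 * (1 + ln N)\<^sup>2 * sqrt N"
proof -
  have "(\<Sum>p\<in>gprimes A B. of_real (ln (gauss_norm p)) * F p) = (\<Sum>p\<in>gprimes A B. of_real (gmangoldt p) * F p)"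
    by (intro sum.cong refl) (simp add: gprimes_def gmangoldt_prime_elem)
  then have "(\<Sum>n\<in>gann A B. of_real (gmangoldt n) * F n) - (\<Sum>p\<in>gprimes A B. of_real (ln (gauss_norm p)) * F p)
     = (\<Sum>n\<in>gann A B - gprimes A B. of_real (gmangoldt n) * F n)"
    by (simp add: sum_diff gprimes_def)
  also have "norm \<dots> \<le> (\<Sum>n\<in>gann A B - gprimes A B. gmangoldt n)"
    using F by (intro order_trans[OF norm_sum] sum_mono) (auto simp: norm_mult gmangoldt_nonneg intro: mult_right_le_one_le)
  also have "\<dots> \<le> (\<Sum>n | n \<in> gball N \<and> \<not> prime_elem n. gmangoldt n)"
  proof (rule sum_mono2)
    show "finite {n. n \<in> gball N \<and> \<not> prime_elem n}" by (rule finite_subset[OF _ finite_gball[of N]]) auto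
  qed (use assms in \<open>auto simp: gmangoldt_nonneg gprimes_def gann_def gball_def\<close>)
  also have "\<dots> \<le> 72 * (1 + ln N)\<^sup>2 * sqrt N" by (rule sum_gmangoldt_nonprime_le[OF assms(1)])
  finally show ?thesis .
qed

text \<open>Partial summation against \<open>1 / ln\<close>; norms of Gaussian integers are natural numbers.\<close>

lemma norm_prime_sum_unweighted_le:
  fixes F :: "gauss_int \<Rightarrow> complex"
  assumes N: "N \<ge> 6" and T: "\<And>B. B \<le> real N \<Longrightarrow> norm (\<Sum>p\<in>gprimes (real N / 2) B. of_real (ln (gauss_norm p)) * F p) \<le> T"
  shows "norm (\<Sum>p\<in>gprimes (real N / 2) (real N). F p) \<le> T"
proof -
  \<comment> \<open>The least integer above N/2, hence a lower bound for the norms that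
    occur.\<close>
  define K where "K = N div 2 + 1"
  have K: "real K > real N / 2" "K \<le> N" "K \<ge> 3" using N by (auto simp: K_def)
  have T0: "T \<ge> 0" using T[of "real N"] norm_ge_zero order_trans by blast
  define v where "v k = 1 / ln (real k) - 1 / ln (real (Suc k))" for k
  have v0: "v k \<ge> 0" if "k \<ge> K" for k
  proof -
    have "0 < ln (real k)" "ln (real k) \<le> ln (real (Suc k))" using that K by auto
    then show ?thesis by (simp add: v_def frac_le)
  qed
  have tel: "(\<Sum>k\<in>{n..<N}. v k) = 1 / ln (real n) - 1 / ln (real N)" if "n \<le> N" for n
    using sum_Suc_diff'[OF that, of "\<lambda>k. - 1 / ln (real k)"] by (simp add: v_def)
  define W where "W B = (\<Sum>p\<in>gprimes (real N / 2) B. of_real (ln (gauss_norm p)) * F p)" for B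
  \<comment> \<open>Abel summation pointwise: 1 / ln n is 1 / ln N plus the decrements v k for k
    from n to N - 1, so the weight ln n is undone.\<close>
  have repr: "F p = of_real (1 / ln (real N)) * (of_real (ln (gauss_norm p)) * F p) +
      (\<Sum>k\<in>{K..<N}. if gauss_norm p \<le> real k then of_real (v k) * (of_real (ln (gauss_norm p)) * F p) else 0)"
    if p: "p \<in> gprimes (real N / 2) (real N)" for p
  proof -
    define n where "n = euclidean_size p"
    have n: "gauss_norm p = real n" by (simp add: n_def real_euclidean_size_gauss_int)
    have "real n > real N / 2" "real n \<le> real N" using p by (auto simp: gprimes_def gann_def n)
    then have nK: "K \<le> n" "n \<le> N" unfolding K_def by linarith+
    then have lnn: "ln (real n) > 0" using K by auto
    have "(\<Sum>k\<in>{K..<N}. if gauss_norm p \<le> real k then of_real (v k) * (of_real (ln (gauss_norm p)) * F p) else 0)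
      = (\<Sum>k\<in>{n..<N}. of_real (v k) * (of_real (ln (gauss_norm p)) * F p))"
      unfolding n using nK by (intro sum.mono_neutral_cong_right) auto
    also have "\<dots> = of_real (1 / ln (real n) - 1 / ln (real N)) * (of_real (ln (real n)) * F p)"
      unfolding sum_distrib_right[symmetric] tel[OF nK(2), symmetric] n by simp
    also have "\<dots> = of_real (1 / ln (real n) * ln (real n)) * F p - of_real (1 / ln (real N)) * (of_real (ln (real n)) * F p)"
      by (simp only: of_real_diff of_real_mult left_diff_distrib mult.assoc)
    finally show ?thesis using lnn by (simp add: n)
  qed
  have "(\<Sum>p\<in>gprimes (real N / 2) (real N). F p) = of_real (1 / ln (real N)) * W (real N) +
     (\<Sum>p\<in>gprimes (real N / 2) (real N). \<Sum>k\<in>{K..<N}. if gauss_norm p \<le> real k then of_real (v k) * (of_real (ln (gauss_norm p)) * F p) else 0)"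
    unfolding W_def sum_distrib_left sum.distrib[symmetric] using repr by (intro sum.cong refl)
  also have "(\<Sum>p\<in>gprimes (real N / 2) (real N). \<Sum>k\<in>{K..<N}. if gauss_norm p \<le> real k then of_real (v k) * (of_real (ln (gauss_norm p)) * F p) else 0)
     = (\<Sum>k\<in>{K..<N}. of_real (v k) * W (real k))"
    unfolding W_def sum_distrib_left
    by (subst sum.swap, rule sum.cong[OF refl], rule sum.mono_neutral_cong_right[OF finite_gprimes])
       (auto simp: gprimes_def gann_def)
  finally have "norm (\<Sum>p\<in>gprimes (real N / 2) (real N). F p) \<le>
     norm (of_real (1 / ln (real N)) * W (real N)) + norm (\<Sum>k\<in>{K..<N}. of_real (v k) * W (real k))"
    by (simp only: norm_triangle_ineq)
  also have "norm (\<Sum>k\<in>{K..<N}. of_real (v k) * W (real k)) \<le> (\<Sum>k\<in>{K..<N}. v k * T)"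
    using v0 T unfolding W_def by (intro order_trans[OF norm_sum] sum_mono) (auto simp: norm_mult intro!: mult_mono)
  also have "norm (of_real (1 / ln (real N)) * W (real N)) \<le> 1 / ln (real N) * T"
  proof -
    have "1 / ln (real N) \<ge> 0" using N by simp
    then show ?thesis unfolding norm_mult norm_of_real W_def using T[of "real N"] by (intro mult_mono) auto
  qed
  also have "1 / ln (real N) * T + (\<Sum>k\<in>{K..<N}. v k * T) = 1 / ln (real K) * T"
    unfolding sum_distrib_right[symmetric] tel[OF K(2)] by (simp add: algebra_simps)
  \<comment> \<open>The decrements add up to 1 / ln K in total, and K \<ge> 3 > e makes this at most
    1.\<close>
  also have "\<dots> \<le> 1 * T"
  proof (intro mult_right_mono T0)
    have "exp 1 \<le> real K" using K(3) exp_le by linarith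
    then have "1 \<le> ln (real K)" using K(3) by (simp add: ln_ge_iff)
    then show "1 / ln (real K) \<le> 1" by simp
  qed
  finally show ?thesis by simp
qed

lemma gprimes_dyadic: "gauss_primes_dyadic N = gprimes (real N / 2) (real N)"
  by (auto simp: gauss_primes_dyadic_def gprimes_def gann_def)

lemma prime_gchar_bound:
  assumes sp: "spaced_freq \<alpha> q \<Delta>" and N: "real N \<ge> 64" and c: "0 < c" "c \<le> 1"
    and q: "q \<ge> real N powr (1 / 4)" and \<Delta>: "\<Delta> \<le> 1 / 2" "\<Delta> \<ge> c * real N powr (- 1 / 5)"
    and q\<Delta>: "q * \<Delta>\<^sup>2 \<ge> c * real N powr (- 1 / 12)"
  shows "norm (\<Sum>p\<in>gauss_primes_dyadic N. gchar \<alpha> p) \<le> 2 * 10 ^ 8 / c * (1 + ln (real N)) ^ 5 * real N powr (11 / 12)"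
  unfolding gprimes_dyadic
proof (rule norm_prime_sum_unweighted_le)
  define l where "l = 1 + ln (real N)"
  define Z where "Z = real N powr (11 / 12)"
  have l1: "l \<ge> 1" using N by (simp add: l_def)
  show "N \<ge> 6" using N by simp
  fix B assume B: "B \<le> real N"
  define S where "S = (\<Sum>n\<in>gann (real N / 2) B. of_real (gmangoldt n) * gchar \<alpha> n)"
  define S' where "S' = (\<Sum>p\<in>gprimes (real N / 2) B. of_real (ln (gauss_norm p)) * gchar \<alpha> p)"
  have 1: "norm S \<le> 10 ^ 8 / c * l ^ 5 * Z"
    unfolding S_def l_def Z_def by (rule sum_gmangoldt_gchar_bound[OF sp N order_refl B c q \<Delta> q\<Delta>])
  have 2: "norm (S - S') \<le> 72 * l\<^sup>2 * sqrt (real N)"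
    unfolding S_def S'_def l_def by (rule norm_prime_sum_diff_le) (use N B in auto)
  have "sqrt (real N) \<le> Z"
    unfolding Z_def using N by (auto simp: powr_half_sqrt[symmetric] intro!: powr_mono)
  moreover have "l\<^sup>2 \<le> l ^ 5" using l1 by (intro power_increasing) auto
  ultimately have "72 * l\<^sup>2 * sqrt (real N) \<le> 72 * l ^ 5 * Z" using l1 by (intro mult_mono) auto
  also have "\<dots> \<le> 10 ^ 8 / c * l ^ 5 * Z"
  proof (intro mult_right_mono)
    have "1 \<le> 1 / c" using c by simp
    moreover have "72 \<le> 10 ^ 8 * x" if "1 \<le> x" for x :: real using that by simp
    ultimately have "72 \<le> 10 ^ 8 * (1 / c)" by blast
    then show "72 \<le> 10 ^ 8 / c" by simp
  qed (use l1 in \<open>auto simp: Z_def\<close>)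
  finally have 3: "72 * l\<^sup>2 * sqrt (real N) \<le> 10 ^ 8 / c * l ^ 5 * Z" .
  have "norm S' \<le> norm S + norm (S - S')"
    using norm_triangle_ineq4[of S "S - S'"] by simp
  also have "\<dots> \<le> 10 ^ 8 / c * l ^ 5 * Z + 10 ^ 8 / c * l ^ 5 * Z" using 1 2 3 by linarith
  also have "\<dots> = 2 * 10 ^ 8 / c * l ^ 5 * Z" by simp
  finally show "norm S' \<le> 2 * 10 ^ 8 / c * l ^ 5 * Z" .
qed

subsection \<open>Trigonometric approximation of indicator functions\<close>

lemma ee_power: "ee y ^ n = ee (real n * y)"
  by (induction n) (simp_all add: distrib_right ee_add)

text \<open>The coefficient at u counts the ways to write u as an ordered sum of r integers from
  {0..<L}. Only its sign and its support matter later.\<close>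

lemma geometric_ee_power:
  "\<exists>c :: nat \<Rightarrow> real. (\<forall>u. c u \<ge> 0) \<and> (\<forall>u>r * L. c u = 0) \<and>
     (\<forall>x. (\<Sum>j<L. ee (real j * x)) ^ r = (\<Sum>u\<le>r * L. of_real (c u) * ee (real u * x)))"
proof (induction r)
  case 0
  show ?case by (rule exI[of _ "\<lambda>u. if u = 0 then 1 else 0"]) auto
next
  case (Suc r)
  then obtain c :: "nat \<Rightarrow> real" where c: "\<And>u. c u \<ge> 0" "\<And>u. u > r * L \<Longrightarrow> c u = 0"
    "\<And>x. (\<Sum>j<L. ee (real j * x)) ^ r = (\<Sum>u\<le>r * L. of_real (c u) * ee (real u * x))" by blast
  \<comment> \<open>Convolution with the indicator of {0..<L}; the guard keeps natural subtraction
    from truncating.\<close>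
  define c' where "c' u = (\<Sum>j<L. if j \<le> u then c (u - j) else 0)" for u
  show ?case
  proof (rule exI[of _ c'], intro conjI allI impI)
    show "c' u \<ge> 0" for u using c(1) by (auto simp: c'_def intro!: sum_nonneg)
    show "c' u = 0" if "u > Suc r * L" for u
      unfolding c'_def using that by (intro sum.neutral) (auto intro!: c(2))
    fix x
    have "(\<Sum>u\<le>Suc r * L. of_real (c' u) * ee (real u * x)) =
      (\<Sum>u\<le>Suc r * L. \<Sum>j<L. if j \<le> u then of_real (c (u - j)) * ee (real u * x) else 0)"
      unfolding c'_def of_real_sum sum_distrib_right by (intro sum.cong refl) auto
    also have "\<dots> = (\<Sum>j<L. \<Sum>u\<le>Suc r * L. if j \<le> u then of_real (c (u - j)) * ee (real u * x) else 0)"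
      by (rule sum.swap)
    also have "\<dots> = (\<Sum>j<L. \<Sum>v\<le>r * L. of_real (c v) * ee (real (v + j) * x))"
    proof (rule sum.cong[OF refl])
      fix j assume j: "j \<in> {..<L}"
      have "(\<Sum>u\<le>Suc r * L. if j \<le> u then of_real (c (u - j)) * ee (real u * x) else 0) =
         (\<Sum>u\<in>{j..Suc r * L}. of_real (c (u - j)) * ee (real u * x))"
        by (rule sum.mono_neutral_cong_right) auto
      also have "\<dots> = (\<Sum>v\<in>{0..Suc r * L - j}. of_real (c v) * ee (real (v + j) * x))"
        by (rule sum.reindex_bij_witness[of _ "\<lambda>v. v + j" "\<lambda>u. u - j"]) (use j in auto)
      also have "\<dots> = (\<Sum>v\<le>r * L. of_real (c v) * ee (real (v + j) * x))"
        by (rule sum.mono_neutral_right) (use j in \<open>auto intro!: c(2)\<close>)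
      finally show "(\<Sum>u\<le>Suc r * L. if j \<le> u then of_real (c (u - j)) * ee (real u * x) else 0) =
         (\<Sum>v\<le>r * L. of_real (c v) * ee (real (v + j) * x))" .
    qed
    also have "\<dots> = (\<Sum>j<L. ee (real j * x)) * (\<Sum>v\<le>r * L. of_real (c v) * ee (real v * x))"
    proof -
      have "ee (real (v + j) * x) = ee (real j * x) * ee (real v * x)" for v j
        using ee_add[of "real j * x" "real v * x"] by (simp add: algebra_simps)
      then show ?thesis unfolding sum_product by (intro sum.cong refl) (simp only: mult_ac)
    qed
    finally show "(\<Sum>j<L. ee (real j * x)) ^ Suc r = (\<Sum>u\<le>Suc r * L. of_real (c' u) * ee (real u * x))"
      using c(3) by simp
  qed
qed

lemma norm_geometric_ee_le: "norm (\<Sum>j<L. ee (real j * x)) * dist_int x \<le> 1"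
proof -
  have "(\<Sum>j<L. ee (real j * x)) = (\<Sum>j\<in>{0..int L - 1}. ee (of_int j * x))"
    by (rule sum.reindex_bij_witness[of _ nat int]) auto
  then show ?thesis using geometric_ee_bound[of x 0 "int L - 1"] by simp
qed

text \<open>The terms are a geometric progression whose ratio is a J-th root of unity other than 1.
  The start of the window is left free so that a full period can later be centred at a given
  point.\<close>

lemma sum_ee_window_eq_0:
  fixes k :: int and J :: nat
  assumes "0 < \<bar>k\<bar>" "\<bar>k\<bar> < int J"
  shows "(\<Sum>j\<in>{a..<a + int J}. ee (of_int k * (x - of_int j / real J))) = 0"
proof -
  define w where "w = ee (- (of_int k / real J))"
  have J: "J > 0" using assms by linarith
  have w1: "w \<noteq> 1"
  proof
    assume "w = 1"
    then have "dist_int (- (of_int k / real J)) \<le> 0"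
      using norm_ee_minus_1_ge[of "- (of_int k / real J)"] by (simp add: w_def)
    then have "dist_int (of_int k / real J) = 0" using dist_int_nonneg[of "of_int k / real J"] by simp
    then have "of_int k / real J = of_int (round (of_int k / real J))" by (simp add: dist_int_def)
    then have "of_int k = of_int (round (of_int k / real J)) * real J" using J by (simp add: field_simps)
    then have "k = round (of_int k / real J) * int J" by (metis of_int_eq_iff of_int_mult of_int_of_nat_eq)
    then have "int J dvd k" by (metis dvd_triv_right)
    then show False using assms zdvd_imp_le[of "int J" "\<bar>k\<bar>"] by simp
  qed
  have wJ: "w ^ J = 1"
  proof -
    have "w ^ J = ee (of_int (- k))" using J by (simp add: w_def ee_power)
    then show ?thesis by (simp only: ee_of_int)
  qed
  have "(\<Sum>j\<in>{a..<a + int J}. ee (of_int k * (x - of_int j / real J))) =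
     (\<Sum>j<J. ee (of_int k * (x - of_int a / real J)) * w ^ j)"
  proof (rule sum.reindex_bij_witness[of _ "\<lambda>j. a + int j" "\<lambda>j. nat (j - a)"])
    fix j assume j: "j \<in> {a..<a + int J}"
    have wn: "w ^ n = ee (real n * (- (of_int k / real J)))" for n
      by (simp only: w_def ee_power)
    show "ee (of_int k * (x - of_int a / real J)) * w ^ nat (j - a) = ee (of_int k * (x - of_int j / real J))"
      unfolding wn ee_add[symmetric] using j by (simp add: diff_divide_distrib algebra_simps)
  qed auto
  also have "\<dots> = ee (of_int k * (x - of_int a / real J)) * (\<Sum>j<J. w ^ j)"
    by (rule sum_distrib_left[symmetric])
  also have "(\<Sum>j<J. w ^ j) = 0" using w1 wJ by (simp add: geometric_sum)
  finally show ?thesis by simp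
qed

text \<open>The mean is taken over a translate of \<open>(1/J)\<int>\<close> instead of the circle: this is exact for
  trigonometric polynomials of degree below \<open>J\<close>, so no integrals are needed.\<close>

lemma jackson_kernel:
  fixes L r J :: nat
  assumes L: "L \<ge> 1" and J: "J > r * L"
  obtains ker :: "real \<Rightarrow> real" and w :: "nat \<Rightarrow> nat \<Rightarrow> real" where
    "\<And>x. complex_of_real (ker x) = (\<Sum>u\<le>r * L. \<Sum>v\<le>r * L. of_real (w u v) * ee (of_int (int u - int v) * x))"
    "\<And>u v. w u v \<ge> 0" "(\<Sum>u\<le>r * L. w u u) = 1" "(\<Sum>u\<le>r * L. \<Sum>v\<le>r * L. w u v) \<le> real (r * L + 1)"
    "\<And>x. ker x \<ge> 0"
    "\<And>x a. (\<Sum>j\<in>{a..<a + int J}. ker (x - of_int j / real J)) = real J"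
    "\<And>x \<rho>. \<rho> > 0 \<Longrightarrow> dist_int x \<ge> \<rho> \<Longrightarrow> ker x \<le> real (r * L + 1) / (real L * \<rho>) ^ (2 * r)"
    "\<And>x k. ker (x + of_int k) = ker x"
proof -
  define R where "R = r * L"
  obtain c :: "nat \<Rightarrow> real" where c: "\<And>u. c u \<ge> 0" "\<And>x. (\<Sum>j<L. ee (real j * x)) ^ r = (\<Sum>u\<le>R. of_real (c u) * ee (real u * x))"
    using geometric_ee_power[of r L] unfolding R_def by blast
  define Dr where "Dr x = (\<Sum>j<L. ee (real j * x))" for x
  define Z where "Z = (\<Sum>u\<le>R. (c u)\<^sup>2)"
  have "complex_of_real (\<Sum>u\<le>R. c u) = of_real (real L ^ r)"
    using c(2)[of 0] by simp
  then have csum: "(\<Sum>u\<le>R. c u) = real L ^ r" by (simp only: of_real_eq_iff)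
  \<comment> \<open>This lower bound for the normalizing constant Z is used twice: for the total
    weight of the coefficients and for the decay of the kernel.\<close>
  have CS: "(real L ^ r)\<^sup>2 \<le> real (R + 1) * Z"
    using Cauchy_Schwarz_ineq_sum[of "\<lambda>_. 1" c "{..R}"] by (simp add: csum Z_def)
  have Z0: "Z > 0"
  proof -
    have "0 < (real L ^ r)\<^sup>2" using L by simp
    then have "0 < real (R + 1) * Z" using CS by linarith
    then show ?thesis by (simp add: zero_less_mult_iff)
  qed
  define ker where "ker x = (norm (Dr x ^ r))\<^sup>2 / Z" for x
  define w where "w u v = c u * c v / Z" for u v
  have 1: "complex_of_real (ker x) = (\<Sum>u\<le>R. \<Sum>v\<le>R. of_real (w u v) * ee (of_int (int u - int v) * x))" for x
  proof -
    have "complex_of_real ((norm (Dr x ^ r))\<^sup>2) = Dr x ^ r * cnj (Dr x ^ r)" by (rule complex_norm_square)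
    also have "\<dots> = (\<Sum>u\<le>R. \<Sum>v\<le>R. of_real (c u * c v) * ee (of_int (int u - int v) * x))"
      unfolding Dr_def c(2) cnj_sum sum_product
      by (intro sum.cong refl) (simp add: cnj_ee left_diff_distrib ee_add[of _ "- _", simplified])
    finally show ?thesis by (simp add: ker_def w_def sum_divide_distrib)
  qed
  have 2: "w u v \<ge> 0" for u v using c(1) Z0 by (simp add: w_def)
  have 3: "(\<Sum>u\<le>R. w u u) = 1"
    using Z0 by (simp add: w_def Z_def power2_eq_square flip: sum_divide_distrib)
  have 4: "(\<Sum>u\<le>R. \<Sum>v\<le>R. w u v) \<le> real (R + 1)"
  proof -
    have "(\<Sum>u\<le>R. \<Sum>v\<le>R. w u v) = (real L ^ r)\<^sup>2 / Z"
      unfolding w_def csum[symmetric] power2_eq_square sum_product by (simp flip: sum_divide_distrib)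
    also have "\<dots> \<le> real (R + 1)" using CS Z0 by (simp add: pos_divide_le_eq)
    finally show ?thesis .
  qed
  have 5: "ker x \<ge> 0" for x using Z0 by (simp add: ker_def)
  \<comment> \<open>Frequencies u - v are at most r L < J in absolute value, so no nonzero one is a
    multiple of J and only the diagonal survives.\<close>
  have 6: "(\<Sum>j\<in>{a..<a + int J}. ker (x - of_int j / real J)) = real J" for x a
  proof -
    have "complex_of_real (\<Sum>j\<in>{a..<a + int J}. ker (x - of_int j / real J)) =
      (\<Sum>u\<le>R. \<Sum>v\<le>R. of_real (w u v) * (\<Sum>j\<in>{a..<a + int J}. ee (of_int (int u - int v) * (x - of_int j / real J))))"
      unfolding of_real_sum 1 sum_distrib_left
      by (subst sum.swap, rule sum.cong[OF refl], rule sum.swap)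
    also have "\<dots> = (\<Sum>u\<le>R. \<Sum>v\<le>R. if v = u then of_real (w u u) * of_nat J else 0)"
    proof (intro sum.cong refl)
      fix u v assume uv: "u \<in> {..R}" "v \<in> {..R}"
      show "of_real (w u v) * (\<Sum>j\<in>{a..<a + int J}. ee (of_int (int u - int v) * (x - of_int j / real J)))
        = (if v = u then of_real (w u u) * of_nat J else 0)"
      proof (cases "v = u")
        case False
        then have "(\<Sum>j\<in>{a..<a + int J}. ee (of_int (int u - int v) * (x - of_int j / real J))) = 0"
          using uv J by (intro sum_ee_window_eq_0) (auto simp: R_def)
        then show ?thesis using False by simp
      qed simp
    qed
    also have "\<dots> = of_real ((\<Sum>u\<le>R. w u u) * real J)"
      by (simp add: sum_distrib_right)
    finally show ?thesis unfolding 3 by (simp only: of_real_eq_iff mult_1_left)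
  qed
  have 7: "ker x \<le> real (R + 1) / (real L * \<rho>) ^ (2 * r)" if "\<rho> > 0" "dist_int x \<ge> \<rho>" for x \<rho>
  proof -
    have "norm (Dr x) * \<rho> \<le> norm (Dr x) * dist_int x" using that by (intro mult_left_mono) auto
    also have "\<dots> \<le> 1" unfolding Dr_def by (rule norm_geometric_ee_le)
    finally have "norm (Dr x) \<le> 1 / \<rho>" using that by (simp add: field_simps)
    then have "norm (Dr x) ^ (2 * r) \<le> (1 / \<rho>) ^ (2 * r)" by (intro power_mono) auto
    moreover have "(norm (Dr x ^ r))\<^sup>2 = norm (Dr x) ^ (2 * r)"
      by (simp add: norm_power power_mult[symmetric] mult.commute)
    ultimately have "ker x \<le> (1 / \<rho>) ^ (2 * r) / Z" using Z0 by (simp add: ker_def divide_right_mono)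
    also have "\<dots> \<le> (1 / \<rho>) ^ (2 * r) * (real (R + 1) / (real L ^ r)\<^sup>2)"
    proof -
      have "1 / Z \<le> real (R + 1) / (real L ^ r)\<^sup>2"
        using CS Z0 L by (simp add: field_simps)
      from mult_left_mono[OF this, of "(1 / \<rho>) ^ (2 * r)"] that show ?thesis by simp
    qed
    also have "\<dots> = real (R + 1) / (real L * \<rho>) ^ (2 * r)"
      by (simp add: power_mult_distrib power_divide power_mult[symmetric] mult.commute)
    finally show ?thesis .
  qed
  have 8: "ker (x + of_int k) = ker x" for x k
  proof -
    have "ee (real j * (x + of_int k)) = ee (real j * x)" for j
    proof -
      have "ee (real j * (x + of_int k)) = ee (real j * x + of_int (int j * k))"
        by (simp add: distrib_left)
      then show ?thesis by (simp only: ee_add ee_of_int mult_1_right)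
    qed
    then show ?thesis by (simp add: ker_def Dr_def)
  qed
  show thesis
    by (rule that[of ker w]) (use 1 2 3 4 5 6 7 8 in \<open>simp_all only: R_def\<close>)
qed

lemma dist_int_eq_abs: "\<bar>x\<bar> \<le> 1 / 2 \<Longrightarrow> dist_int x = \<bar>x\<bar>"
proof -
  assume x: "\<bar>x\<bar> \<le> 1 / 2"
  show ?thesis
  proof (rule antisym[OF dist_int_le_abs])
    have "\<bar>x\<bar> \<le> \<bar>x - of_int k\<bar>" for k :: int
    proof (cases "k = 0")
      case False
      then have "\<bar>of_int k :: real\<bar> \<ge> 1" 
      proof -
        have "1 \<le> \<bar>k\<bar>" using False by linarith
        then have "(1 :: real) \<le> of_int \<bar>k\<bar>" by linarith
        then show ?thesis by simp
      qed
      then show ?thesis using x by linarith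
    qed simp
    then show "\<bar>x\<bar> \<le> dist_int x" by (simp add: dist_int_def)
  qed
qed

text \<open>Averaging the kernel over |j| \<le> m smooths the indicator of the arc of radius m/J,
  with a transition zone of width \<rho> and an error \<tau> from the kernel's tail. An arc smaller
  than \<delta> by \<rho> is nearly 0 outside \<delta>, and one larger by \<rho> is nearly 1
  inside.\<close>

lemma kernel_average_bounds:
  fixes ker :: "real \<Rightarrow> real" and J m :: nat
  defines "g \<equiv> (\<lambda>x. (\<Sum>j\<in>{- int m..int m}. ker (x - of_int j / real J)) / real J)"
  assumes J: "J > 0" and nonneg: "\<And>x. ker x \<ge> 0"
    and mean: "\<And>x a. (\<Sum>j\<in>{a..<a + int J}. ker (x - of_int j / real J)) = real J"
    and tail: "\<And>x. dist_int x \<ge> \<rho> \<Longrightarrow> ker x \<le> \<tau>"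
    and per: "\<And>x k. ker (x + of_int k) = ker x" and \<tau>: "\<tau> \<ge> 0"
  shows "g x \<ge> 0"
    and "2 * m + 1 \<le> J \<Longrightarrow> g x \<le> 1"
    and "2 * m + 1 \<le> J \<Longrightarrow> real m / real J \<le> \<delta> - \<rho> \<Longrightarrow> dist_int x \<ge> \<delta> \<Longrightarrow> g x \<le> \<tau>"
    and "real (m + 1) / real J \<ge> \<delta> + \<rho> \<Longrightarrow> dist_int x \<le> \<delta> \<Longrightarrow> g x \<ge> 1 - \<tau>"
proof -
  show "g x \<ge> 0" unfolding g_def by (intro divide_nonneg_nonneg sum_nonneg nonneg) auto
  show "g x \<le> 1" if "2 * m + 1 \<le> J"
  proof -
    have "(\<Sum>j\<in>{- int m..int m}. ker (x - of_int j / real J)) \<le> (\<Sum>j\<in>{- int m..<- int m + int J}. ker (x - of_int j / real J))"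
      using that by (intro sum_mono2 nonneg) auto
    then show ?thesis unfolding mean g_def using J by simp
  qed
  show "g x \<le> \<tau>" if *: "2 * m + 1 \<le> J" "real m / real J \<le> \<delta> - \<rho>" "dist_int x \<ge> \<delta>"
  proof -
    have "ker (x - of_int j / real J) \<le> \<tau>" if j: "j \<in> {- int m..int m}" for j
    proof (rule tail)
      have "\<bar>of_int j / real J\<bar> \<le> real m / real J"
        using j J by (auto simp: abs_le_iff divide_right_mono minus_divide_left)
      moreover have "dist_int x \<le> dist_int (x - of_int j / real J) + dist_int (of_int j / real J)"
        using dist_int_add_le[of "x - of_int j / real J" "of_int j / real J"] by simp
      moreover have "dist_int (of_int j / real J) \<le> \<bar>of_int j / real J\<bar>" by (rule dist_int_le_abs)
      ultimately show "dist_int (x - of_int j / real J) \<ge> \<rho>" using * by linarith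
    qed
    then have "(\<Sum>j\<in>{- int m..int m}. ker (x - of_int j / real J)) \<le> real (card {- int m..int m}) * \<tau>"
      by (rule sum_bounded_above)
    also have "\<dots> \<le> real J * \<tau>" using *(1) \<tau> by (intro mult_right_mono) auto
    finally show ?thesis using J by (simp add: g_def field_simps)
  qed
  show "g x \<ge> 1 - \<tau>" if *: "real (m + 1) / real J \<ge> \<delta> + \<rho>" "dist_int x \<le> \<delta>"
  proof -
    define t where "t = x - of_int (round x)"
    have t: "\<bar>t\<bar> \<le> \<delta>" using * by (simp add: t_def dist_int_def)
    \<comment> \<open>Centres a full period at J t. Every t - j/J in it is then at most 1/2 in
      absolute value, so that \<open>dist_int\<close> is the absolute value itself.\<close>
    define a where "a = \<lceil>real J * t - real J / 2\<rceil>"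
    have k: "ker (x - y) = ker (t - y)" for y
      using per[of "t - y" "round x"] by (simp add: t_def)
    have "real J = (\<Sum>j\<in>{a..<a + int J}. ker (t - of_int j / real J))" by (rule mean[symmetric])
    also have "\<dots> \<le> (\<Sum>j\<in>{a..<a + int J}. (if j \<in> {- int m..int m} then ker (t - of_int j / real J) else 0) + \<tau>)"
    proof (rule sum_mono)
      fix j assume j: "j \<in> {a..<a + int J}"
      show "ker (t - of_int j / real J) \<le> (if j \<in> {- int m..int m} then ker (t - of_int j / real J) else 0) + \<tau>"
      proof (cases "j \<in> {- int m..int m}")
        case False
        have "real_of_int j \<ge> real J * t - real J / 2" "real_of_int j \<le> real J * t + real J / 2"
        proof -
          have "real_of_int a < real J * t - real J / 2 + 1" "real_of_int a \<ge> real J * t - real J / 2"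
            unfolding a_def by linarith+
          moreover have "real_of_int j \<le> real_of_int (a + int J - 1)" "real_of_int j \<ge> real_of_int a"
            using j by (simp_all only: of_int_le_iff atLeastLessThan_iff) linarith
          moreover have "real_of_int (a + int J - 1) = real_of_int a + real J - 1" by simp
          ultimately show "real_of_int j \<ge> real J * t - real J / 2" "real_of_int j \<le> real J * t + real J / 2"
            by linarith+
        qed
        then have "\<bar>real J * t - of_int j\<bar> \<le> real J / 2" by linarith
        moreover have eq: "\<bar>t - of_int j / real J\<bar> = \<bar>real J * t - of_int j\<bar> / real J"
        proof -
          have "t - of_int j / real J = (real J * t - of_int j) / real J" using J by (simp add: field_simps)
          then show ?thesis by (simp only: abs_divide abs_of_nat)
        qed
        ultimately have "\<bar>t - of_int j / real J\<bar> \<le> 1 / 2" using J by (simp add: field_simps)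
        then have d: "dist_int (t - of_int j / real J) = \<bar>t - of_int j / real J\<bar>" by (rule dist_int_eq_abs)
        \<comment> \<open>The first omitted index is m + 1 and not m, hence the form of the
          hypothesis on \<delta> + \<rho>.\<close>
        have "\<bar>real_of_int j\<bar> \<ge> real (m + 1)" using False by auto
        then have "\<bar>of_int j / real J\<bar> \<ge> real (m + 1) / real J" using J by (simp add: divide_right_mono del: of_nat_Suc of_nat_add)
        then have "\<bar>t - of_int j / real J\<bar> \<ge> \<rho>" using * t by linarith
        then show ?thesis using False d \<tau> tail[of "t - of_int j / real J"] by simp
      qed (use \<tau> in simp)
    qed
    also have "\<dots> = (\<Sum>j\<in>{a..<a + int J} \<inter> {- int m..int m}. ker (t - of_int j / real J)) + real J * \<tau>"
      by (simp only: sum.distrib sum.inter_restrict[symmetric] finite_atLeastLessThan_int) simp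
    also have "(\<Sum>j\<in>{a..<a + int J} \<inter> {- int m..int m}. ker (t - of_int j / real J)) \<le> (\<Sum>j\<in>{- int m..int m}. ker (t - of_int j / real J))"
      by (intro sum_mono2 nonneg) auto
    finally show ?thesis using J unfolding g_def k by (simp add: field_simps)
  qed
qed

text \<open>Expanding both factors gives one character sum for each pair of frequencies. The pair
  (0, 0) yields the main term because the diagonal weights add up to 1; every other pair is bounded
  by T, and each factor has total weight at most s (R + 1).\<close>

lemma kernel_average_product_sum:
  fixes z :: "'a \<Rightarrow> complex" and w :: "nat \<Rightarrow> nat \<Rightarrow> real" and R m J :: nat
  assumes fin: "finite P" and J: "J > 0"
    and ker: "\<And>x. complex_of_real (ker x) = (\<Sum>u\<le>R. \<Sum>v\<le>R. of_real (w u v) * ee (of_int (int u - int v) * x))"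
    and w: "\<And>u v. w u v \<ge> 0" "(\<Sum>u\<le>R. w u u) = 1" "(\<Sum>u\<le>R. \<Sum>v\<le>R. w u v) \<le> real (R + 1)"
    and T: "\<And>a b :: int. (a, b) \<noteq> (0, 0) \<Longrightarrow> \<bar>a\<bar> \<le> int R \<Longrightarrow> \<bar>b\<bar> \<le> int R \<Longrightarrow>
       norm (\<Sum>p\<in>P. ee (of_int a * Re (z p) + of_int b * Im (z p))) \<le> T" and T0: "T \<ge> 0"
  defines "g \<equiv> (\<lambda>x. (\<Sum>j\<in>{- int m..int m}. ker (x - of_int j / real J)) / real J)"
    and "s \<equiv> real (2 * m + 1) / real J"
  shows "\<bar>(\<Sum>p\<in>P. g (Re (z p)) * g (Im (z p))) - s\<^sup>2 * real (card P)\<bar> \<le> s\<^sup>2 * (real (R + 1))\<^sup>2 * T"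
proof -
  define Q where "Q = {..R} \<times> {..R}"
  define K where "K q = int (fst q) - int (snd q)" for q :: "nat \<times> nat"
  \<comment> \<open>The Fourier coefficient of the window: it equals s at frequency 0 and is at most
    s everywhere. Keeping this factor s makes the error proportional to s^2 as well.\<close>
  define sg where "sg k = (\<Sum>j\<in>{- int m..int m}. ee (of_int k * (- of_int j / real J))) / of_nat J" for k :: int
  define W where "W q = of_real (w (fst q) (snd q)) * sg (K q)" for q
  have finQ: "finite Q" by (simp add: Q_def)
  have s0: "s \<ge> 0" by (simp add: s_def)
  have sg_le: "norm (sg k) \<le> s" for k
  proof -
    have "norm (\<Sum>j\<in>{- int m..int m}. ee (of_int k * (- of_int j / real J))) \<le> (\<Sum>j\<in>{- int m..int m}. 1)"
      by (rule order_trans[OF norm_sum]) simp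
    also have "\<dots> = real (2 * m + 1)" by simp
    finally show ?thesis unfolding sg_def s_def by (simp add: norm_divide divide_right_mono del: of_nat_add of_nat_mult)
  qed
  have sg0: "sg 0 = of_real s" by (simp add: sg_def s_def)
  have W_le: "norm (W q) \<le> w (fst q) (snd q) * s" for q
    unfolding W_def norm_mult using w(1) sg_le by (simp add: mult_left_mono)
  have wQ: "(\<Sum>q\<in>Q. w (fst q) (snd q)) \<le> real (R + 1)"
    using w(3) by (simp add: Q_def sum.cartesian_product case_prod_unfold)
  have g: "complex_of_real (g x) = (\<Sum>q\<in>Q. W q * ee (of_int (K q) * x))" for x
  proof -
    have "complex_of_real (g x) = (\<Sum>j\<in>{- int m..int m}. \<Sum>q\<in>Q. of_real (w (fst q) (snd q)) * ee (of_int (K q) * (x - of_int j / real J))) / of_nat J"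
      by (simp add: g_def ker Q_def K_def sum.cartesian_product case_prod_unfold)
    also have "\<dots> = (\<Sum>q\<in>Q. \<Sum>j\<in>{- int m..int m}. of_real (w (fst q) (snd q)) * ee (of_int (K q) * (x - of_int j / real J))) / of_nat J"
      by (subst sum.swap) (rule refl)
    also have "\<dots> = (\<Sum>q\<in>Q. (\<Sum>j\<in>{- int m..int m}. of_real (w (fst q) (snd q)) * ee (of_int (K q) * (x - of_int j / real J))) / of_nat J)"
      by (rule sum_divide_distrib)
    also have "\<dots> = (\<Sum>q\<in>Q. W q * ee (of_int (K q) * x))"
    proof (rule sum.cong[OF refl])
      fix q
      have e: "ee (of_int (K q) * (x - of_int j / real J)) = ee (of_int (K q) * (- of_int j / real J)) * ee (of_int (K q) * x)" for j :: int
        using ee_add[of "of_int (K q) * (- of_int j / real J)" "of_int (K q) * x"] by (simp add: algebra_simps)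
      have "(\<Sum>j\<in>{- int m..int m}. of_real (w (fst q) (snd q)) * ee (of_int (K q) * (x - of_int j / real J)))
         = of_real (w (fst q) (snd q)) * (\<Sum>j\<in>{- int m..int m}. ee (of_int (K q) * (- of_int j / real J))) * ee (of_int (K q) * x)"
        unfolding e sum_distrib_left sum_distrib_right by (simp only: mult.assoc)
      then show "(\<Sum>j\<in>{- int m..int m}. of_real (w (fst q) (snd q)) * ee (of_int (K q) * (x - of_int j / real J))) / of_nat J
        = W q * ee (of_int (K q) * x)"
        by (simp add: W_def sg_def)
    qed
    finally show ?thesis .
  qed
  define E where "E a b = (\<Sum>p\<in>P. ee (of_int a * Re (z p) + of_int b * Im (z p)))" for a b :: int
  \<comment> \<open>Subtracting the main term at (0, 0) makes the bound T uniform over all pairs of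
    frequencies.\<close>
  define D where "D a b = E a b - (if a = 0 \<and> b = 0 then of_nat (card P) else 0)" for a b
  have D_le: "norm (D (K q) (K q')) \<le> T" if "q \<in> Q" "q' \<in> Q" for q q'
  proof (cases "K q = 0 \<and> K q' = 0")
    case True
    then have "D (K q) (K q') = 0" by (simp add: D_def E_def)
    then show ?thesis using T0 by simp
  next
    case False
    have "\<bar>K q\<bar> \<le> int R" "\<bar>K q'\<bar> \<le> int R" using that by (auto simp: K_def Q_def)
    then show ?thesis using T[of "K q" "K q'"] False by (auto simp: D_def E_def)
  qed
  have diag: "(\<Sum>q\<in>Q. if K q = 0 then W q else 0) = of_real s"
  proof -
    have "(\<Sum>q\<in>Q. if K q = 0 then W q else 0) = (\<Sum>u\<le>R. \<Sum>v\<le>R. if v = u then of_real (w u u * s) else 0)"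
      unfolding Q_def sum.cartesian_product by (intro sum.cong refl) (auto simp: K_def W_def sg0)
    also have "\<dots> = of_real ((\<Sum>u\<le>R. w u u) * s)" by (simp add: sum_distrib_right)
    finally show ?thesis by (simp add: w(2))
  qed
  have "complex_of_real (\<Sum>p\<in>P. g (Re (z p)) * g (Im (z p))) =
     (\<Sum>p\<in>P. \<Sum>q\<in>Q. \<Sum>q'\<in>Q. W q * W q' * ee (of_int (K q) * Re (z p) + of_int (K q') * Im (z p)))"
    unfolding of_real_sum of_real_mult g sum_product ee_add
    by (intro sum.cong refl) (simp only: mult_ac)
  also have "\<dots> = (\<Sum>q\<in>Q. \<Sum>q'\<in>Q. W q * W q' * E (K q) (K q'))"
    unfolding E_def sum_distrib_left
    by (subst sum.swap, rule sum.cong[OF refl], rule sum.swap)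
  also have "\<dots> = (\<Sum>q\<in>Q. \<Sum>q'\<in>Q. W q * W q' * D (K q) (K q')) +
      (\<Sum>q\<in>Q. \<Sum>q'\<in>Q. (if K q = 0 then W q else 0) * (if K q' = 0 then W q' else 0)) * of_nat (card P)"
    unfolding sum_distrib_right sum.distrib[symmetric] by (intro sum.cong refl) (simp add: D_def algebra_simps)
  also have "(\<Sum>q\<in>Q. \<Sum>q'\<in>Q. (if K q = 0 then W q else 0) * (if K q' = 0 then W q' else 0)) = of_real (s\<^sup>2)"
    unfolding sum_product[symmetric] diag by (simp add: power2_eq_square)
  finally have "complex_of_real ((\<Sum>p\<in>P. g (Re (z p)) * g (Im (z p))) - s\<^sup>2 * real (card P)) =
     (\<Sum>q\<in>Q. \<Sum>q'\<in>Q. W q * W q' * D (K q) (K q'))"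
    by simp
  from arg_cong[OF this, of norm] have "\<bar>(\<Sum>p\<in>P. g (Re (z p)) * g (Im (z p))) - s\<^sup>2 * real (card P)\<bar> =
     norm (\<Sum>q\<in>Q. \<Sum>q'\<in>Q. W q * W q' * D (K q) (K q'))"
    by (simp only: norm_of_real)
  also have "\<dots> \<le> (\<Sum>q\<in>Q. \<Sum>q'\<in>Q. (w (fst q) (snd q) * s) * (w (fst q') (snd q') * s) * T)"
    using w(1) s0 by (intro sum_norm_le order_trans[OF norm_sum] sum_mono) (auto simp only: norm_mult intro!: mult_mono W_le D_le mult_nonneg_nonneg norm_ge_zero)
  also have "\<dots> = (s * (\<Sum>q\<in>Q. w (fst q) (snd q))) * (s * (\<Sum>q\<in>Q. w (fst q) (snd q))) * T"
    unfolding sum_distrib_left sum_product sum_distrib_right by (intro sum.cong refl) (simp only: mult_ac)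
  also have "\<dots> \<le> (s * real (R + 1)) * (s * real (R + 1)) * T"
    using w(1) s0 T0 by (intro mult_right_mono mult_mono mult_left_mono wQ) (auto intro!: sum_nonneg mult_nonneg_nonneg)
  finally show ?thesis by (simp add: power2_eq_square mult_ac)
qed

text \<open>Two windows, of radius \<delta> + \<rho> and \<delta> - \<rho> with \<rho> = \<kappa>
  \<delta>, bound the count from above and below. Their areas differ from 4 \<delta>^2 by a relative
  error of order \<kappa>. A point inside has product at least (1 - \<tau>)^2 \<ge> 1 - 2 \<tau> for
  the large window; a point outside has product at most \<tau> for the small one.\<close>

lemma count_by_characters:
  fixes z :: "'a \<Rightarrow> complex" and L r :: nat
  assumes fin: "finite P" and \<delta>: "0 < \<delta>" "\<delta> \<le> 1 / 2" and \<kappa>: "0 < \<kappa>" "\<kappa> \<le> 1 / 3" and L: "L \<ge> 1"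
    and T: "\<And>a b :: int. (a, b) \<noteq> (0, 0) \<Longrightarrow> \<bar>a\<bar> \<le> int (r * L) \<Longrightarrow> \<bar>b\<bar> \<le> int (r * L) \<Longrightarrow>
       norm (\<Sum>p\<in>P. ee (of_int a * Re (z p) + of_int b * Im (z p))) \<le> T" and T0: "T \<ge> 0"
    and \<tau>: "\<tau> = real (r * L + 1) / (real L * (\<kappa> * \<delta>)) ^ (2 * r)" "\<tau> \<le> 1"
  shows "\<bar>real (card {p \<in> P. dist_gauss (z p) \<le> \<delta>}) - 4 * \<delta>\<^sup>2 * real (card P)\<bar>
    \<le> 24 * \<kappa> * \<delta>\<^sup>2 * real (card P) + 2 * \<tau> * real (card P) + 16 * \<delta>\<^sup>2 * (real (r * L + 1))\<^sup>2 * T"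
proof -
  define \<rho> where "\<rho> = \<kappa> * \<delta>"
  have \<rho>: "\<rho> > 0" "3 * \<rho> \<le> \<delta>" using \<delta> \<kappa> mult_right_mono[OF \<kappa>(2), of \<delta>] by (auto simp: \<rho>_def)
  have \<tau>0: "\<tau> \<ge> 0" unfolding \<tau>(1) using \<delta> \<kappa> by auto
  \<comment> \<open>J exceeds the degree, which makes the discrete means exact, and J \<rho> \<ge>
    3, so that rounding the window to the grid costs at most \<rho>.\<close>
  define J where "J = nat \<lceil>3 / \<rho>\<rceil> + r * L + 1"
  have J: "J > r * L" "J > 0" by (simp_all add: J_def)
  have J\<rho>: "3 \<le> real J * \<rho>"
  proof -
    have "3 / \<rho> \<le> real (nat \<lceil>3 / \<rho>\<rceil>)" by (rule real_nat_ceiling_ge)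
    also have "\<dots> \<le> real J" unfolding J_def by simp
    finally show ?thesis using \<rho> by (simp add: field_simps)
  qed
  obtain ker :: "real \<Rightarrow> real" and w :: "nat \<Rightarrow> nat \<Rightarrow> real" where
    ker: "\<And>x. complex_of_real (ker x) = (\<Sum>u\<le>r * L. \<Sum>v\<le>r * L. of_real (w u v) * ee (of_int (int u - int v) * x))"
    and w: "\<And>u v. w u v \<ge> 0" "(\<Sum>u\<le>r * L. w u u) = 1" "(\<Sum>u\<le>r * L. \<Sum>v\<le>r * L. w u v) \<le> real (r * L + 1)"
    and nonneg: "\<And>x. ker x \<ge> 0"
    and mean: "\<And>x a. (\<Sum>j\<in>{a..<a + int J}. ker (x - of_int j / real J)) = real J"
    and tail0: "\<And>x \<rho>. \<rho> > 0 \<Longrightarrow> dist_int x \<ge> \<rho> \<Longrightarrow> ker x \<le> real (r * L + 1) / (real L * \<rho>) ^ (2 * r)"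
    and per: "\<And>x k. ker (x + of_int k) = ker x"
    using jackson_kernel[OF L J(1)] by blast
  have tail: "ker x \<le> \<tau>" if "dist_int x \<ge> \<rho>" for x
    using tail0[OF \<rho>(1) that] unfolding \<tau>(1) \<rho>_def .
  define g where "g m x = (\<Sum>j\<in>{- int m..int m}. ker (x - of_int j / real J)) / real J" for m :: nat and x
  have b1: "g m x \<ge> 0" for m x
    unfolding g_def by (rule kernel_average_bounds(1)[where \<rho> = \<rho>, OF J(2) nonneg mean _ per \<tau>0]) (rule tail)
  have b2: "g m x \<le> 1" if "2 * m + 1 \<le> J" for m x
    unfolding g_def by (rule kernel_average_bounds(2)[where \<rho> = \<rho>, OF J(2) nonneg mean _ per \<tau>0 that]) (rule tail)
  have b3: "g m x \<le> \<tau>" if "2 * m + 1 \<le> J" "real m / real J \<le> \<delta> - \<rho>" "dist_int x \<ge> \<delta>" for m x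
    unfolding g_def by (rule kernel_average_bounds(3)[where \<rho> = \<rho>, OF J(2) nonneg mean _ per \<tau>0 that]) (rule tail)
  have b4: "g m x \<ge> 1 - \<tau>" if "real (m + 1) / real J \<ge> \<delta> + \<rho>" "dist_int x \<le> \<delta>" for m x
    unfolding g_def by (rule kernel_average_bounds(4)[where \<rho> = \<rho>, OF J(2) nonneg mean _ per \<tau>0 that]) (rule tail)
  have main: "\<bar>(\<Sum>p\<in>P. g m (Re (z p)) * g m (Im (z p))) - (real (2 * m + 1) / real J)\<^sup>2 * real (card P)\<bar>
     \<le> (real (2 * m + 1) / real J)\<^sup>2 * (real (r * L + 1))\<^sup>2 * T" for m
    unfolding g_def by (rule kernel_average_product_sum[OF fin J(2) ker w _ T0]) (rule T)
  define n where "n = real (card P)"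
  define C where "C = real (card {p \<in> P. dist_gauss (z p) \<le> \<delta>})"
  define B where "B = (real (r * L + 1))\<^sup>2 * T"
  have B0: "B \<ge> 0" using T0 by (simp add: B_def)
  have n0: "n \<ge> 0" by (simp add: n_def)
  have C_eq: "C = (\<Sum>p\<in>P. if dist_gauss (z p) \<le> \<delta> then 1 else 0)"
    unfolding C_def using fin by (simp add: sum.If_cases Int_def)
  have Cn: "0 \<le> C" by (simp add: C_def)
  have upper: "C \<le> (4 + 24 * \<kappa>) * \<delta>\<^sup>2 * n + 2 * \<tau> * n + 16 * \<delta>\<^sup>2 * B"
  proof -
    \<comment> \<open>For \<delta> near 1/2 this window can be longer than a period, and then g may
      exceed 1. The upper bound for the count needs g only from below.\<close>
    define m where "m = nat \<lceil>real J * (\<delta> + \<rho>)\<rceil>"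
    define s where "s = real (2 * m + 1) / real J"
    have "real J * (\<delta> + \<rho>) \<ge> 0" using \<delta> \<rho> by simp
    then have m: "real J * (\<delta> + \<rho>) \<le> real m" "real m \<le> real J * (\<delta> + \<rho>) + 1"
      unfolding m_def by linarith+
    have mJ: "real (m + 1) / real J \<ge> \<delta> + \<rho>" using m J by (simp add: field_simps)
    have "s \<le> (2 * (real J * (\<delta> + \<rho>) + 1) + 1) / real J"
      unfolding s_def using m by (intro divide_right_mono) auto
    also have "\<dots> = 2 * (\<delta> + \<rho>) + 3 / real J" using J by (simp add: field_simps)
    also have "3 / real J \<le> \<rho>" using J\<rho> J by (simp add: field_simps)
    finally have s: "s \<le> 2 * \<delta> + 3 * \<rho>" by simp
    have s0: "s \<ge> 0" by (simp add: s_def)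
    have "s\<^sup>2 \<le> (2 * \<delta> + 3 * \<rho>)\<^sup>2" using s s0 by (intro power_mono) auto
    also have "\<dots> = \<delta>\<^sup>2 * (4 + 12 * \<kappa> + 9 * \<kappa> * \<kappa>)" by (simp add: \<rho>_def power2_eq_square algebra_simps)
    also have "\<dots> \<le> \<delta>\<^sup>2 * (4 + 24 * \<kappa>)"
      using \<kappa> mult_right_mono[OF \<kappa>(2), of \<kappa>] by (intro mult_left_mono) auto
    finally have s2: "s\<^sup>2 \<le> (4 + 24 * \<kappa>) * \<delta>\<^sup>2" by (simp add: mult.commute)
    have "(4 + 24 * \<kappa>) * \<delta>\<^sup>2 \<le> 16 * \<delta>\<^sup>2" using \<kappa> by (intro mult_right_mono) auto
    with s2 have s16: "s\<^sup>2 \<le> 16 * \<delta>\<^sup>2" by linarith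
    have "C \<le> (\<Sum>p\<in>P. g m (Re (z p)) * g m (Im (z p)) + 2 * \<tau>)"
      unfolding C_eq
    proof (rule sum_mono)
      fix p
      show "(if dist_gauss (z p) \<le> \<delta> then 1 else 0) \<le> g m (Re (z p)) * g m (Im (z p)) + 2 * \<tau>"
      proof (cases "dist_gauss (z p) \<le> \<delta>")
        case True
        then have "dist_int (Re (z p)) \<le> \<delta>" "dist_int (Im (z p)) \<le> \<delta>" by (simp_all add: dist_gauss_def)
        then have "g m (Re (z p)) \<ge> 1 - \<tau>" "g m (Im (z p)) \<ge> 1 - \<tau>"
          using b4[OF mJ] by blast+
        then have "(1 - \<tau>) * (1 - \<tau>) \<le> g m (Re (z p)) * g m (Im (z p))"
          using \<tau>(2) by (intro mult_mono) auto
        moreover have "1 - 2 * \<tau> \<le> (1 - \<tau>) * (1 - \<tau>)" by (simp add: algebra_simps)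
        ultimately show ?thesis using True by simp
      next
        case False
        have "g m (Re (z p)) * g m (Im (z p)) \<ge> 0" by (intro mult_nonneg_nonneg b1)
        then show ?thesis using False \<tau>0 by simp
      qed
    qed
    also have "\<dots> = (\<Sum>p\<in>P. g m (Re (z p)) * g m (Im (z p))) + 2 * \<tau> * n"
      by (simp add: sum.distrib n_def)
    also have "(\<Sum>p\<in>P. g m (Re (z p)) * g m (Im (z p))) \<le> s\<^sup>2 * n + s\<^sup>2 * B"
      using main[of m] unfolding s_def n_def B_def by (simp only: abs_le_iff mult.assoc) linarith
    also have "s\<^sup>2 * n + s\<^sup>2 * B \<le> (4 + 24 * \<kappa>) * \<delta>\<^sup>2 * n + 16 * \<delta>\<^sup>2 * B"
      using s2 s16 n0 B0 by (intro add_mono mult_right_mono)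
    finally show ?thesis by simp
  qed
  have lower: "(4 - 12 * \<kappa>) * \<delta>\<^sup>2 * n - \<tau> * n - 16 * \<delta>\<^sup>2 * B \<le> C"
  proof -
    \<comment> \<open>Here g must be at most 1, so the window has to fit into one period; \<delta>
      \<le> 1/2 and J \<rho> \<ge> 3 ensure this.\<close>
    define m where "m = nat \<lfloor>real J * (\<delta> - \<rho>)\<rfloor>"
    define s where "s = real (2 * m + 1) / real J"
    have "real J * (\<delta> - \<rho>) \<ge> 0" using \<delta> \<rho> by simp
    then have m: "real J * (\<delta> - \<rho>) - 1 \<le> real m" "real m \<le> real J * (\<delta> - \<rho>)"
      unfolding m_def by linarith+
    have mJ: "real m / real J \<le> \<delta> - \<rho>" using m J by (simp add: field_simps)
    have J2: "2 * m + 1 \<le> J"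
    proof -
      have "real J * (\<delta> - \<rho>) = real J * \<delta> - real J * \<rho>" by (simp add: right_diff_distrib)
      moreover have "real J * \<delta> \<le> real J * (1 / 2)" using \<delta> by (intro mult_left_mono) auto
      ultimately have "real (2 * m + 1) \<le> real J" using m J\<rho> by simp
      then show ?thesis by (simp only: of_nat_le_iff)
    qed
    have "s \<ge> (2 * (real J * (\<delta> - \<rho>) - 1) + 1) / real J"
      unfolding s_def using m by (intro divide_right_mono) auto
    moreover have "(2 * (real J * (\<delta> - \<rho>) - 1) + 1) / real J = 2 * \<delta> - 2 * \<rho> - 1 / real J" using J by (simp add: field_simps)
    moreover have iJ: "1 / real J \<le> \<rho>" using J\<rho> J by (simp add: field_simps)
    ultimately have s: "s \<ge> 2 * \<delta> - 3 * \<rho>" by linarith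
    have "s \<le> (2 * (real J * (\<delta> - \<rho>)) + 1) / real J"
      unfolding s_def using m by (intro divide_right_mono) auto
    also have "\<dots> = 2 * \<delta> - 2 * \<rho> + 1 / real J" using J by (simp add: field_simps)
    finally have s': "s \<le> 2 * \<delta>" using iJ \<rho> by linarith
    have s0: "s \<ge> 0" by (simp add: s_def)
    have "\<delta>\<^sup>2 * (4 - 12 * \<kappa>) \<le> \<delta>\<^sup>2 * (4 - 12 * \<kappa> + 9 * \<kappa> * \<kappa>)" using \<kappa> by (intro mult_left_mono) auto
    also have "\<dots> = (2 * \<delta> - 3 * \<rho>)\<^sup>2" by (simp add: \<rho>_def power2_eq_square algebra_simps)
    also have "\<dots> \<le> s\<^sup>2" using s \<rho> \<delta> by (intro power_mono) auto
    finally have s2: "(4 - 12 * \<kappa>) * \<delta>\<^sup>2 \<le> s\<^sup>2" by (simp add: mult.commute)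
    have "s\<^sup>2 \<le> (2 * \<delta>)\<^sup>2" using s' s0 by (intro power_mono)
    then have s16: "s\<^sup>2 \<le> 16 * \<delta>\<^sup>2" by (simp add: power_mult_distrib) (use zero_le_power2[of \<delta>] in linarith)
    have "(\<Sum>p\<in>P. g m (Re (z p)) * g m (Im (z p)) - \<tau>) \<le> C"
      unfolding C_eq
    proof (rule sum_mono)
      fix p
      have g01: "0 \<le> g m x" "g m x \<le> 1" for x using b1 b2 J2 by blast+
      show "g m (Re (z p)) * g m (Im (z p)) - \<tau> \<le> (if dist_gauss (z p) \<le> \<delta> then 1 else 0)"
      proof (cases "dist_gauss (z p) \<le> \<delta>")
        case True
        have "g m (Re (z p)) * g m (Im (z p)) \<le> 1 * 1" using g01 by (intro mult_mono) auto
        then show ?thesis using True \<tau>0 by simp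
      next
        case False
        then consider "dist_int (Re (z p)) \<ge> \<delta>" | "dist_int (Im (z p)) \<ge> \<delta>"
          by (auto simp: dist_gauss_def max_def split: if_splits)
        then have "g m (Re (z p)) * g m (Im (z p)) \<le> \<tau>"
        proof cases
          case 1
          then have "g m (Re (z p)) \<le> \<tau>" using b3[OF J2 mJ] by blast
          then have "g m (Re (z p)) * g m (Im (z p)) \<le> \<tau> * 1" using g01 \<tau>0 by (intro mult_mono) auto
          then show ?thesis by simp
        next
          case 2
          then have "g m (Im (z p)) \<le> \<tau>" using b3[OF J2 mJ] by blast
          then have "g m (Re (z p)) * g m (Im (z p)) \<le> 1 * \<tau>" using g01 \<tau>0 by (intro mult_mono) auto
          then show ?thesis by simp
        qed
        then show ?thesis using False by simp
      qed
    qed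
    moreover have "(\<Sum>p\<in>P. g m (Re (z p)) * g m (Im (z p)) - \<tau>) = (\<Sum>p\<in>P. g m (Re (z p)) * g m (Im (z p))) - \<tau> * n"
      by (simp add: sum_subtractf n_def)
    moreover have "(\<Sum>p\<in>P. g m (Re (z p)) * g m (Im (z p))) \<ge> s\<^sup>2 * n - s\<^sup>2 * B"
      using main[of m] unfolding s_def n_def B_def by (simp only: abs_le_iff mult.assoc) linarith
    moreover have "s\<^sup>2 * n \<ge> (4 - 12 * \<kappa>) * \<delta>\<^sup>2 * n" "s\<^sup>2 * B \<le> 16 * \<delta>\<^sup>2 * B"
      using mult_right_mono[OF s2 n0] mult_right_mono[OF s16 B0] by simp_all
    ultimately show ?thesis by linarith
  qed
  have "0 \<le> \<kappa> * \<delta>\<^sup>2 * n" "0 \<le> \<tau> * n" using \<kappa> n0 \<tau>0 by auto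
  then have "\<bar>C - 4 * \<delta>\<^sup>2 * n\<bar> \<le> 24 * \<kappa> * \<delta>\<^sup>2 * n + 2 * \<tau> * n + 16 * \<delta>\<^sup>2 * B"
    using upper lower unfolding abs_le_iff by (simp add: algebra_simps)
  then show ?thesis unfolding C_def n_def B_def by (simp only: mult.assoc)
qed

subsection \<open>Diophantine approximation\<close>

lemma nearest_gauss:
  obtains b where "cmod (z - complex_of_gauss b) \<le> sqrt 2 * dist_gauss z"
proof
  define b where "b = Gauss_Int (round (Re z)) (round (Im z))"
  have "(cmod (z - complex_of_gauss b))\<^sup>2 = (dist_int (Re z))\<^sup>2 + (dist_int (Im z))\<^sup>2"
    by (simp add: cmod_power2 b_def dist_int_def)
  also have "\<dots> \<le> (dist_gauss z)\<^sup>2 + (dist_gauss z)\<^sup>2"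
    by (intro add_mono power_mono) (auto simp: dist_gauss_def)
  also have "\<dots> = (sqrt 2 * dist_gauss z)\<^sup>2" by (simp add: power_mult_distrib)
  finally show "cmod (z - complex_of_gauss b) \<le> sqrt 2 * dist_gauss z"
    by (rule power2_le_imp_le) simp
qed

lemma dist_gauss_le_cmod: "dist_gauss z \<le> cmod (z - complex_of_gauss b)"
proof -
  have "dist_int (Re z) \<le> \<bar>Re (z - complex_of_gauss b)\<bar>" "dist_int (Im z) \<le> \<bar>Im (z - complex_of_gauss b)\<bar>"
    using dist_int_le[of "Re z" "gre b"] dist_int_le[of "Im z" "gim b"] by simp_all
  then show ?thesis using abs_Re_le_cmod[of "z - complex_of_gauss b"] abs_Im_le_cmod[of "z - complex_of_gauss b"]
    unfolding dist_gauss_def by linarith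
qed

text \<open>Pigeonhole: the (Q + 1)^2 Gaussian integers with coordinates from 0 to Q are mapped to
  Q^2 cells of the torus, and a difference of two of them has coordinates at most Q in absolute
  value.\<close>

lemma dirichlet_gauss:
  fixes Q :: nat
  assumes "Q \<ge> 1"
  obtains q where "q \<noteq> 0" "gauss_norm q \<le> 2 * real Q ^ 2" "dist_gauss (complex_of_gauss q * \<theta>) \<le> 1 / real Q"
proof -
  define S where "S = (\<lambda>(x, y). Gauss_Int x y) ` ({0..int Q} \<times> {0..int Q})"
  define cell where "cell n = (\<lfloor>real Q * frac (Re (complex_of_gauss n * \<theta>))\<rfloor>, \<lfloor>real Q * frac (Im (complex_of_gauss n * \<theta>))\<rfloor>)" for n
  have "inj_on (\<lambda>(x, y). Gauss_Int x y) ({0..int Q} \<times> {0..int Q})" by (auto simp: inj_on_def)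
  then have cS: "card S = (Q + 1) * (Q + 1)" unfolding S_def by (simp add: card_image card_cartesian_product nat_add_distrib)
  have fl: "\<lfloor>real Q * frac x\<rfloor> \<in> {0..<int Q}" for x
  proof -
    have "real Q * frac x < real Q * 1" using assms frac_lt_1[of x] by (intro mult_strict_left_mono) auto
    then show ?thesis using frac_ge_0[of x] by (simp add: floor_less_iff)
  qed
  have "cell ` S \<subseteq> {0..<int Q} \<times> {0..<int Q}" using fl by (auto simp: cell_def simp del: atLeastLessThan_iff)
  then have "card (cell ` S) \<le> card ({0..<int Q} \<times> {0..<int Q})" by (intro card_mono) auto
  also have "\<dots> < card S" unfolding cS by (simp add: card_cartesian_product)
  finally have "\<not> inj_on cell S" by (rule pigeonhole)
  then obtain n n' where n: "n \<in> S" "n' \<in> S" "n \<noteq> n'" "cell n = cell n'" by (auto simp: inj_on_def)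
  define q where "q = n - n'"
  have d: "dist_int (x - y) \<le> 1 / real Q" if "\<lfloor>real Q * frac x\<rfloor> = \<lfloor>real Q * frac y\<rfloor>" for x y
  proof -
    have "\<bar>real Q * frac x - real Q * frac y\<bar> < 1" using that by linarith
    then have "real Q * \<bar>frac x - frac y\<bar> < 1" by (simp add: abs_mult right_diff_distrib[symmetric])
    then have "\<bar>frac x - frac y\<bar> \<le> 1 / real Q" using assms by (simp add: field_simps)
    moreover have "dist_int (x - y) \<le> \<bar>frac x - frac y\<bar>"
      using dist_int_le[of "x - y" "\<lfloor>x\<rfloor> - \<lfloor>y\<rfloor>"] by (simp add: frac_def algebra_simps)
    ultimately show ?thesis by linarith
  qed
  have "q \<noteq> 0" using n by (simp add: q_def)
  moreover have "gauss_norm q \<le> 2 * real Q ^ 2"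
  proof -
    have sq: "(of_int x - of_int y :: real)\<^sup>2 \<le> (real Q)\<^sup>2" if "x \<in> {0..int Q}" "y \<in> {0..int Q}" for x y :: int
    proof -
      have "\<bar>x - y\<bar> \<le> int Q" using that by auto
      then have "real_of_int \<bar>x - y\<bar> \<le> real_of_int (int Q)" by (simp only: of_int_le_iff)
      then have "\<bar>of_int x - of_int y :: real\<bar> \<le> real Q" by simp
      then have "\<bar>of_int x - of_int y :: real\<bar>\<^sup>2 \<le> (real Q)\<^sup>2" by (intro power_mono) auto
      then show ?thesis by simp
    qed
    have "gre n \<in> {0..int Q}" "gim n \<in> {0..int Q}" "gre n' \<in> {0..int Q}" "gim n' \<in> {0..int Q}"
      using n by (auto simp: S_def)
    then show ?thesis using sq[of "gre n" "gre n'"] sq[of "gim n" "gim n'"]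
      by (simp add: q_def gauss_norm_altdef minus_gauss_int_def)
  qed
  moreover have "dist_gauss (complex_of_gauss q * \<theta>) \<le> 1 / real Q"
    unfolding q_def gauss_diff_mult dist_gauss_def minus_complex.sel using n(4) d unfolding cell_def by simp
  ultimately show thesis by (rule that)
qed

lemma gauss_rats_quotient:
  assumes "q \<noteq> 0" "complex_of_gauss q * \<theta> = complex_of_gauss a"
  shows "\<theta> \<in> gauss_rats"
proof -
  define n where "n = (gre q)\<^sup>2 + (gim q)\<^sup>2"
  have n: "gauss_norm q = of_int n" by (simp add: n_def gauss_norm_int)
  have n0: "(of_int n :: real) \<noteq> 0" using assms(1) by (simp flip: n)
  have "complex_of_real (of_int n) * \<theta> = cnj (complex_of_gauss q) * complex_of_gauss q * \<theta>"
    by (simp add: n_def complex_eq_iff power2_eq_square algebra_simps)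
  also have "\<dots> = cnj (complex_of_gauss q) * complex_of_gauss a" using assms(2) by (simp add: mult.assoc)
  finally have eq: "complex_of_real (of_int n) * \<theta> = cnj (complex_of_gauss q) * complex_of_gauss a" .
  define u where "u = gre q * gre a + gim q * gim a"
  define v where "v = gre q * gim a - gim q * gre a"
  have "of_int n * Re \<theta> = of_int u" "of_int n * Im \<theta> = of_int v"
    using arg_cong[OF eq, of Re] arg_cong[OF eq, of Im] by (simp_all add: u_def v_def)
  then have "Re \<theta> = of_int u / of_int n" "Im \<theta> = of_int v / of_int n"
    using n0 by (simp_all add: field_simps)
  then have "\<theta> = of_rat (of_int u / of_int n) + of_rat (of_int v / of_int n) * \<i>"
    by (simp add: complex_eq_iff of_rat_divide)
  then show ?thesis unfolding gauss_rats_def by blast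
qed

text \<open>If k \<theta> were close to b, then k a - q b = -k (q \<theta> - a) + q (k \<theta> - b)
  would have modulus at most 1/2 + 3/8 < 1 and hence vanish. Coprimality then gives that q divides
  k, which is impossible since k has the smaller norm.\<close>

lemma spaced_freq_of_approximation:
  assumes q: "q \<noteq> 0" and cop: "coprime a q" and approx: "cmod (complex_of_gauss q * \<theta> - complex_of_gauss a) \<le> 2 / sqrt (gauss_norm q)"
  shows "spaced_freq \<theta> (gauss_norm q / 16) (1 / (4 * sqrt (gauss_norm q)))"
  unfolding spaced_freq_def
proof (intro allI impI, elim conjE, rule ccontr)
  fix k assume k: "k \<noteq> 0" "gauss_norm k < gauss_norm q / 16"
    and lt: "\<not> dist_gauss (complex_of_gauss k * \<theta>) \<ge> 1 / (4 * sqrt (gauss_norm q))"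
  define s where "s = sqrt (gauss_norm q)"
  have s: "s > 0" using gauss_norm_pos[OF q] by (simp add: s_def)
  have cq: "cmod (complex_of_gauss q) = s" and ck: "cmod (complex_of_gauss k) \<le> s / 4"
  proof -
    show "cmod (complex_of_gauss q) = s" by (simp add: s_def gauss_norm_def)
    have "(cmod (complex_of_gauss k))\<^sup>2 \<le> (s / 4)\<^sup>2"
      using k(2) by (simp add: s_def power_divide) (simp add: gauss_norm_def)
    then show "cmod (complex_of_gauss k) \<le> s / 4" by (rule power2_le_imp_le) (use s in auto)
  qed
  obtain b where b: "cmod (complex_of_gauss k * \<theta> - complex_of_gauss b) \<le> sqrt 2 * dist_gauss (complex_of_gauss k * \<theta>)"
    by (rule nearest_gauss)
  also have "\<dots> \<le> (3 / 2) * (1 / (4 * s))"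
  proof (intro mult_mono)
    show "sqrt 2 \<le> 3 / 2" by (rule real_le_lsqrt) (auto simp: power2_eq_square)
  qed (use lt s in \<open>auto simp: s_def\<close>)
  finally have b': "cmod (complex_of_gauss k * \<theta> - complex_of_gauss b) \<le> (3 / 2) * (1 / (4 * s))" .
  have "complex_of_gauss (k * a - q * b) =
     - (complex_of_gauss k * (complex_of_gauss q * \<theta> - complex_of_gauss a)) + complex_of_gauss q * (complex_of_gauss k * \<theta> - complex_of_gauss b)"
    by (simp add: complex_of_gauss_hom algebra_simps)
  then have "cmod (complex_of_gauss (k * a - q * b)) \<le>
     cmod (complex_of_gauss k) * cmod (complex_of_gauss q * \<theta> - complex_of_gauss a) + cmod (complex_of_gauss q) * cmod (complex_of_gauss k * \<theta> - complex_of_gauss b)"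
    by (metis norm_minus_cancel norm_mult norm_triangle_ineq)
  also have "\<dots> \<le> (s / 4) * (2 / s) + s * ((3 / 2) * (1 / (4 * s)))"
    unfolding cq using ck b' approx s by (intro add_mono mult_mono mult_left_mono) (auto simp: s_def)
  also have "\<dots> < 1" using s by simp
  finally have "(cmod (complex_of_gauss (k * a - q * b)))\<^sup>2 < 1" by (simp add: power_less_one_iff)
  then have "gauss_norm (k * a - q * b) < 1" by (simp add: gauss_norm_def)
  then have "k * a - q * b = 0" using gauss_norm_ge_1[of "k * a - q * b"] by linarith
  then have "q dvd k * a" by (simp add: dvd_def)
  then have "q dvd k" using cop by (simp add: coprime_dvd_mult_left_iff coprime_commute)
  then have "gauss_norm q \<le> gauss_norm k" using k(1) by (rule gauss_norm_dvd_le)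
  then show False using k(2) gauss_norm_nonneg[of k] by linarith
qed

lemma spaced_freq_mult:
  assumes "spaced_freq \<theta> q \<Delta>" "h \<noteq> 0"
  shows "spaced_freq (complex_of_gauss h * \<theta>) (q / gauss_norm h) \<Delta>"
  unfolding spaced_freq_def
proof (intro allI impI, elim conjE)
  fix k assume k: "k \<noteq> 0" "gauss_norm k < q / gauss_norm h"
  have "gauss_norm (k * h) < q" using k gauss_norm_pos[OF assms(2)] by (simp add: gauss_norm_mult field_simps)
  moreover have "k * h \<noteq> 0" using k assms by simp
  ultimately have "dist_gauss (complex_of_gauss (k * h) * \<theta>) \<ge> \<Delta>" using assms(1) by (simp add: spaced_freq_def)
  then show "dist_gauss (complex_of_gauss k * (complex_of_gauss h * \<theta>)) \<ge> \<Delta>"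
    by (simp add: complex_of_gauss_hom mult.assoc)
qed

text \<open>The place where \<theta> being irrational is used: finitely many candidates q of norm at
  most M have q \<theta> at a positive minimal distance from the Gaussian integers. A sufficiently
  good approximation therefore has a larger denominator.\<close>

lemma spaced_freq_arbitrarily_large:
  assumes "\<theta> \<notin> gauss_rats"
  obtains n where "n \<ge> M" "n \<ge> 1" "spaced_freq \<theta> (n / 16) (1 / (4 * sqrt n))"
proof -
  define S where "S = gball M - {0}"
  define f where "f q = dist_gauss (complex_of_gauss q * \<theta>)" for q
  have fpos: "f q > 0" if "q \<in> S" for q
  proof (rule ccontr)
    assume "\<not> f q > 0"
    then have "f q = 0" using dist_gauss_nonneg[of "complex_of_gauss q * \<theta>"] unfolding f_def by linarith
    moreover obtain b where "cmod (complex_of_gauss q * \<theta> - complex_of_gauss b) \<le> sqrt 2 * f q"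
      unfolding f_def by (rule nearest_gauss)
    ultimately have "complex_of_gauss q * \<theta> = complex_of_gauss b" by simp
    then show False using gauss_rats_quotient[of q \<theta> b] that assms by (auto simp: S_def)
  qed
  \<comment> \<open>Inserting 1 keeps the minimum meaningful if S is empty.\<close>
  define m where "m = Min (insert 1 (f ` S))"
  have finS: "finite (insert 1 (f ` S))" by (simp add: S_def)
  have m0: "m > 0" unfolding m_def using finS fpos by (subst Min_gr_iff) auto
  have mle: "m \<le> f q" if "q \<in> S" for q unfolding m_def using finS that by (intro Min_le) auto
  define Q where "Q = nat \<lceil>2 / m\<rceil> + 1"
  have Q: "Q \<ge> 1" "real Q > 2 / m" unfolding Q_def by linarith+
  obtain q0 where q0: "q0 \<noteq> 0" "gauss_norm q0 \<le> 2 * real Q ^ 2" "dist_gauss (complex_of_gauss q0 * \<theta>) \<le> 1 / real Q"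
    using dirichlet_gauss[OF Q(1)] by blast
  obtain a0 where a0: "cmod (complex_of_gauss q0 * \<theta> - complex_of_gauss a0) \<le> sqrt 2 * dist_gauss (complex_of_gauss q0 * \<theta>)"
    by (rule nearest_gauss)
  \<comment> \<open>Cancelling the gcd divides the error by a modulus of at least 1 and does not
    increase the denominator, so both bounds survive in lowest terms.\<close>
  define g where "g = gcd a0 q0"
  have g0: "g \<noteq> 0" using q0 by (simp add: g_def)
  obtain a q where aq: "a0 = a * g" "q0 = q * g" "coprime a q"
    using gcd_coprime_exists[of a0 q0] g0 unfolding g_def by blast
  have q: "q \<noteq> 0" using q0 aq by auto
  have cg: "1 \<le> cmod (complex_of_gauss g)"
  proof -
    have "1\<^sup>2 \<le> (cmod (complex_of_gauss g))\<^sup>2" using gauss_norm_ge_1[OF g0] by (simp add: gauss_norm_def)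
    then show ?thesis by (rule power2_le_imp_le) simp
  qed
  have "cmod (complex_of_gauss q * \<theta> - complex_of_gauss a) * 1 \<le> cmod (complex_of_gauss q * \<theta> - complex_of_gauss a) * cmod (complex_of_gauss g)"
    using cg by (intro mult_left_mono) auto
  also have "\<dots> = cmod (complex_of_gauss q0 * \<theta> - complex_of_gauss a0)"
    unfolding norm_mult[symmetric] by (rule arg_cong[of _ _ cmod]) (simp add: aq complex_of_gauss_hom algebra_simps)
  also have "\<dots> \<le> sqrt 2 * (1 / real Q)" using q0(3) by (intro order_trans[OF a0] mult_left_mono) auto
  finally have ap: "cmod (complex_of_gauss q * \<theta> - complex_of_gauss a) \<le> sqrt 2 / real Q" by simp
  have Nq: "gauss_norm q \<le> 2 * real Q ^ 2"
    using gauss_norm_dvd_le[of q q0] aq q0 by force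
  have "sqrt (gauss_norm q) \<le> sqrt 2 * real Q"
    using real_sqrt_le_mono[OF Nq] by (simp add: real_sqrt_mult)
  then have "sqrt 2 / real Q \<le> 2 / sqrt (gauss_norm q)"
    using Q gauss_norm_pos[OF q] mult_left_mono[of "sqrt (gauss_norm q)" "sqrt 2 * real Q" "sqrt 2"]
    by (simp add: field_simps)
  with ap have ap2: "cmod (complex_of_gauss q * \<theta> - complex_of_gauss a) \<le> 2 / sqrt (gauss_norm q)" by linarith
  have "gauss_norm q \<ge> M"
  proof (rule ccontr)
    assume "\<not> gauss_norm q \<ge> M"
    then have "q \<in> S" using q by (auto simp: S_def gball_def)
    then have "m \<le> f q" by (rule mle)
    also have "f q \<le> sqrt 2 / real Q" unfolding f_def using dist_gauss_le_cmod ap by (rule order_trans)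
    also have "\<dots> \<le> 2 / real Q" using Q by (intro divide_right_mono real_le_lsqrt) auto
    also have "\<dots> < m" using Q m0 by (simp add: field_simps)
    finally show False by simp
  qed
  then show thesis using that gauss_norm_ge_1[OF q] spaced_freq_of_approximation[OF q aq(3) ap2] by blast
qed

subsection \<open>Lattice points and a Mertens estimate\<close>

text \<open>Unit squares around lattice points. The open ones are disjoint, for the upper bound of
  the lattice count; the closed ones cover the plane, for the lower bound. In both cases the
  boundary effect is at most 1 in the radius.\<close>

definition gsquare :: "gauss_int \<Rightarrow> complex set" where
  "gsquare z = box (complex_of_gauss z - Complex (1/2) (1/2)) (complex_of_gauss z + Complex (1/2) (1/2))"

definition gcsquare :: "gauss_int \<Rightarrow> complex set" where
  "gcsquare z = cbox (complex_of_gauss z - Complex (1/2) (1/2)) (complex_of_gauss z + Complex (1/2) (1/2))"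

lemma measure_gcsquare: "measure lborel (gcsquare z) = 1"
  unfolding gcsquare_def by (subst content_cbox) (auto simp: Basis_complex_def)

lemma emeasure_gsquare: "emeasure lborel (gsquare z) = 1"
  unfolding gsquare_def by (subst emeasure_lborel_box) (auto simp: Basis_complex_def)

lemma measure_ball_complex: "r \<ge> 0 \<Longrightarrow> measure lborel (ball (0 :: complex) r) = pi * r\<^sup>2"
  using content_ball[of r "0 :: complex"] by (simp add: unit_ball_vol_2)

lemma emeasure_ball_complex_finite: "emeasure lborel (ball (0 :: complex) r) < \<infinity>"
  by (rule emeasure_bounded_finite) simp

lemma card_gball_lower:
  assumes "X \<ge> 1"
  shows "pi * (sqrt X - 1)\<^sup>2 \<le> real (card (gball X))"
proof -
  have "ball 0 (sqrt X - 1) \<subseteq> (\<Union>z\<in>gball X. gcsquare z)"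
  proof
    fix w :: complex assume w: "w \<in> ball 0 (sqrt X - 1)"
    define z where "z = Gauss_Int (round (Re w)) (round (Im w))"
    have r: "\<bar>Re w - of_int (round (Re w))\<bar> \<le> 1 / 2" "\<bar>Im w - of_int (round (Im w))\<bar> \<le> 1 / 2"
      using of_int_round_abs_le[of "Re w"] of_int_round_abs_le[of "Im w"] by (simp_all add: abs_minus_commute)
    have "cmod (complex_of_gauss z - w) \<le> \<bar>Re (complex_of_gauss z - w)\<bar> + \<bar>Im (complex_of_gauss z - w)\<bar>"
      by (rule cmod_le)
    also have "\<dots> \<le> 1" using r by (simp add: z_def abs_minus_commute)
    finally have "cmod (complex_of_gauss z) \<le> cmod w + 1"
      using norm_triangle_ineq[of "complex_of_gauss z - w" w] by simp
    then have "cmod (complex_of_gauss z) \<le> sqrt X" using w by simp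
    then have "(cmod (complex_of_gauss z))\<^sup>2 \<le> (sqrt X)\<^sup>2" by (rule power_mono) simp
    then have "z \<in> gball X" using assms by (simp add: gball_def gauss_norm_def)
    moreover have "w \<in> gcsquare z"
    proof -
      have "of_int (round (Re w)) - 1 / 2 \<le> Re w" "Re w \<le> of_int (round (Re w)) + 1 / 2"
        "of_int (round (Im w)) - 1 / 2 \<le> Im w" "Im w \<le> of_int (round (Im w)) + 1 / 2"
        using r by linarith+
      then show ?thesis unfolding gcsquare_def in_cbox_complex_iff by (simp add: z_def)
    qed
    ultimately show "w \<in> (\<Union>z\<in>gball X. gcsquare z)" by blast
  qed
  moreover have "(\<Union>z\<in>gball X. gcsquare z) \<in> fmeasurable lborel"
  proof (rule fmeasurable.finite_UN)
    show "gcsquare z \<in> fmeasurable lborel" for z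
    proof (rule fmeasurableI)
      show "emeasure lborel (gcsquare z) < \<infinity>"
        unfolding gcsquare_def by (rule emeasure_bounded_finite) (rule bounded_cbox)
    qed (simp add: gcsquare_def)
  qed simp
  ultimately have "measure lborel (ball (0 :: complex) (sqrt X - 1)) \<le> measure lborel (\<Union>z\<in>gball X. gcsquare z)"
    by (intro measure_mono_fmeasurable) auto
  also have "\<dots> \<le> (\<Sum>z\<in>gball X. measure lborel (gcsquare z))"
    by (rule measure_UNION_le) (auto simp: gcsquare_def)
  also have "\<dots> = real (card (gball X))" by (simp add: measure_gcsquare)
  finally show ?thesis using assms by (simp add: measure_ball_complex)
qed

lemma card_gball_upper:
  assumes "X \<ge> 0"
  shows "real (card (gball X)) \<le> pi * (sqrt X + 1)\<^sup>2"
proof -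
  have disj: "disjoint_family_on gsquare (gball X)"
    unfolding disjoint_family_on_def
  proof (intro ballI impI, rule ccontr)
    fix z z' assume zz: "z \<noteq> z'" "gsquare z \<inter> gsquare z' \<noteq> {}"
    then obtain w where w: "w \<in> gsquare z" "w \<in> gsquare z'" by blast
    have i: "a = b" if "real_of_int a - 1 / 2 < t" "t < real_of_int a + 1 / 2" "real_of_int b - 1 / 2 < t" "t < real_of_int b + 1 / 2" for a b t
    proof -
      have "real_of_int a < real_of_int b + 1" "real_of_int b < real_of_int a + 1" using that by linarith+
      then show ?thesis by linarith
    qed
    have "gre z = gre z'" "gim z = gim z'"
      using w unfolding gsquare_def in_box_complex_iff by (auto intro!: i[of _ "Re w"] i[of _ "Im w"])
    then show False using zz(1) by (simp add: gauss_int.expand)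
  qed
  have "real (card (gball X)) = (\<Sum>z\<in>gball X. measure lborel (gsquare z))"
    by (simp add: measure_def emeasure_gsquare)
  also have "\<dots> = measure lborel (\<Union>z\<in>gball X. gsquare z)"
  proof (rule measure_finite_Union[symmetric])
    show "gsquare ` gball X \<subseteq> sets lborel" by (auto simp: gsquare_def)
  qed (use disj in \<open>auto simp: emeasure_gsquare\<close>)
  also have "\<dots> \<le> measure lborel (ball (0 :: complex) (sqrt X + 1))"
  proof (rule measure_mono_fmeasurable)
    show "(\<Union>z\<in>gball X. gsquare z) \<subseteq> ball 0 (sqrt X + 1)"
    proof
      fix w assume "w \<in> (\<Union>z\<in>gball X. gsquare z)"
      then obtain z where z: "z \<in> gball X" "w \<in> gsquare z" by blast
      have "of_int (gre z) - 1 / 2 < Re w" "Re w < of_int (gre z) + 1 / 2"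
        "of_int (gim z) - 1 / 2 < Im w" "Im w < of_int (gim z) + 1 / 2"
        using z(2) unfolding gsquare_def in_box_complex_iff by simp_all
      then have "\<bar>Re (w - complex_of_gauss z)\<bar> < 1 / 2" "\<bar>Im (w - complex_of_gauss z)\<bar> < 1 / 2"
        unfolding minus_complex.sel Re_complex_of_gauss Im_complex_of_gauss by linarith+
      then have "cmod (w - complex_of_gauss z) < 1" using cmod_le[of "w - complex_of_gauss z"] by linarith
      moreover have "cmod (complex_of_gauss z) \<le> sqrt X"
        using z(1) by (intro real_le_rsqrt) (simp add: gball_def gauss_norm_def)
      ultimately have "cmod w < sqrt X + 1"
        using norm_triangle_ineq[of "w - complex_of_gauss z" "complex_of_gauss z"] by simp
      then show "w \<in> ball 0 (sqrt X + 1)" by simp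
    qed
    show "(\<Union>z\<in>gball X. gsquare z) \<in> sets lborel" by (rule sets.finite_UN) (auto simp: gsquare_def)
    show "ball (0 :: complex) (sqrt X + 1) \<in> fmeasurable lborel"
      by (rule fmeasurableI) (use emeasure_ball_complex_finite in auto)
  qed
  also have "\<dots> = pi * (sqrt X + 1)\<^sup>2" using assms by (intro measure_ball_complex) simp
  finally show ?thesis .
qed

lemma card_gann_0: "X \<ge> 0 \<Longrightarrow> real (card (gann 0 X)) = real (card (gball X)) - 1"
proof -
  assume "X \<ge> 0"
  have "z \<in> gball X \<longleftrightarrow> z \<in> insert 0 (gann 0 X)" for z
    using \<open>X \<ge> 0\<close> gauss_norm_pos[of z] by (cases "z = 0") (auto simp: gball_def gann_def)
  then have "gball X = insert 0 (gann 0 X)" by blast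
  moreover have "0 \<notin> gann 0 X" by (simp add: gann_def)
  ultimately show ?thesis by simp
qed

text \<open>One percent is accurate enough: the combined loss in \<open>mertens_gap\<close> only has
  to stay below the factor 6/5.\<close>

lemma eventually_card_gann:
  "eventually (\<lambda>X. 99 / 100 * pi * X \<le> real (card (gann 0 X)) \<and> real (card (gann 0 X)) \<le> 101 / 100 * pi * X) at_top"
proof -
  have "eventually (\<lambda>X :: real. 99 / 100 * pi * X \<le> pi * (sqrt X - 1)\<^sup>2 - 1) at_top" by real_asymp
  moreover have "eventually (\<lambda>X :: real. pi * (sqrt X + 1)\<^sup>2 - 1 \<le> 101 / 100 * pi * X) at_top" by real_asymp
  moreover have "eventually (\<lambda>X :: real. X \<ge> 1) at_top" by (rule eventually_ge_at_top)
  ultimately show ?thesis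
  proof eventually_elim
    case (elim X)
    then show ?case using card_gball_lower[of X] card_gball_upper[of X] card_gann_0[of X] by linarith
  qed
qed

section \<open>Chebyshev and Mertens estimates\<close>

lemma sum_ln_gann:
  "(\<Sum>n\<in>gann 0 X. ln (gauss_norm n)) = (\<Sum>d\<in>gcanon \<inter> gball X. gmangoldt d * real (card (gann 0 (X / gauss_norm d))))"
proof -
  have "(\<Sum>n\<in>gann 0 X. ln (gauss_norm n)) = (\<Sum>n\<in>gann 0 X. \<Sum>d\<in>gdiv n. (\<lambda>d m. gmangoldt d) d (n div d))"
  proof (intro sum.cong refl)
    fix n assume "n \<in> gann 0 X"
    then have "n \<noteq> 0" by (auto simp: gann_def)
    then show "ln (gauss_norm n) = (\<Sum>d\<in>gdiv n. (\<lambda>d m. gmangoldt d) d (n div d))"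
      by (simp add: sum_gmangoldt_gdiv)
  qed
  also have "\<dots> = (\<Sum>d\<in>gcanon \<inter> gball X. \<Sum>m\<in>gann (0 / gauss_norm d) (X / gauss_norm d). (\<lambda>d m. gmangoldt d) d m)"
    by (rule sum_gann_gdiv) simp
  finally show ?thesis by (simp add: mult.commute)
qed

definition mertens_sum :: "real \<Rightarrow> real" where
  "mertens_sum X = (\<Sum>d\<in>gcanon \<inter> gball X. gmangoldt d / gauss_norm d)"

lemma gcanon_pos: "d \<in> gcanon \<Longrightarrow> gauss_norm d > 0"
  by (simp add: gcanon_def gauss_norm_pos)

text \<open>Only d of norm at most X/Y are kept, for which X divided by the norm of d is in the
  range of the precise lattice count; the other terms are nonnegative. The comparison is with the
  trivial bound ln X for each logarithm.\<close>

lemma mertens_upper: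
  obtains Y where "Y \<ge> 1" "\<And>X. X \<ge> Y \<Longrightarrow> 99 * mertens_sum (X / Y) \<le> 101 * ln X"
    "\<And>X. X \<ge> Y \<Longrightarrow> 99 / 100 * pi * X \<le> real (card (gann 0 X)) \<and> real (card (gann 0 X)) \<le> 101 / 100 * pi * X"
proof -
  obtain Y0 where Y0: "\<And>X. X \<ge> Y0 \<Longrightarrow> 99 / 100 * pi * X \<le> real (card (gann 0 X)) \<and> real (card (gann 0 X)) \<le> 101 / 100 * pi * X"
    using eventually_card_gann unfolding eventually_at_top_linorder by blast
  define Y where "Y = max Y0 1"
  have Y: "Y \<ge> 1" "Y \<ge> Y0" by (simp_all add: Y_def)
  have "99 * mertens_sum (X / Y) \<le> 101 * ln X" if X: "X \<ge> Y" for X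
  proof -
    have X0: "X > 0" using X Y by linarith
    have "(\<Sum>d\<in>gcanon \<inter> gball (X / Y). gmangoldt d * (99 / 100 * pi * (X / gauss_norm d)))
       \<le> (\<Sum>d\<in>gcanon \<inter> gball (X / Y). gmangoldt d * real (card (gann 0 (X / gauss_norm d))))"
    proof (intro sum_mono mult_left_mono gmangoldt_nonneg)
      fix d assume d: "d \<in> gcanon \<inter> gball (X / Y)"
      then have dp: "gauss_norm d > 0" and dX: "gauss_norm d \<le> X / Y" using gcanon_pos by (auto simp: gball_def)
      have "Y0 * gauss_norm d \<le> Y * gauss_norm d" using dp Y by (intro mult_right_mono) auto
      also have "\<dots> \<le> X" using dX Y by (simp add: field_simps)
      finally have "X / gauss_norm d \<ge> Y0" using dp by (simp add: field_simps)
      then show "99 / 100 * pi * (X / gauss_norm d) \<le> real (card (gann 0 (X / gauss_norm d)))" using Y0 by blast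
    qed
    also have "\<dots> \<le> (\<Sum>d\<in>gcanon \<inter> gball X. gmangoldt d * real (card (gann 0 (X / gauss_norm d))))"
    proof (rule sum_mono2)
      have "X / Y \<le> X / 1" using Y X0 by (intro divide_left_mono) auto
      then show "gcanon \<inter> gball (X / Y) \<subseteq> gcanon \<inter> gball X" by (auto simp: gball_def)
    qed (auto simp: gmangoldt_nonneg)
    also have "\<dots> = (\<Sum>n\<in>gann 0 X. ln (gauss_norm n))" by (rule sum_ln_gann[symmetric])
    also have "\<dots> \<le> real (card (gann 0 X)) * ln X"
      by (rule sum_bounded_above) (auto simp: gann_def)
    also have "\<dots> \<le> 101 / 100 * pi * X * ln X"
      using Y0[of X] X Y by (intro mult_right_mono) auto
    also have "\<dots> = (pi * X / 100) * (101 * ln X)" by simp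
    also have "(\<Sum>d\<in>gcanon \<inter> gball (X / Y). gmangoldt d * (99 / 100 * pi * (X / gauss_norm d))) =
        (pi * X / 100) * (99 * mertens_sum (X / Y))"
      unfolding mertens_sum_def sum_distrib_left by (intro sum.cong refl) simp
    finally have "(pi * X / 100) * (99 * mertens_sum (X / Y)) \<le> (pi * X / 100) * (101 * ln X)" .
    then show ?thesis using X0 by (subst (asm) mult_le_cancel_left_pos) auto
  qed
  then show thesis using that[OF Y(1)] Y0 Y(2) by (meson order_trans)
qed

text \<open>The crude asymptotic for the Mertens sum with relative error a few percent already forces
  von Mangoldt mass between \<open>X\<close> and \<open>X\<^bsup>6/5\<^esup>\<close>.\<close>

lemma mertens_gap:
  obtains c where "c > 0" "eventually (\<lambda>X. mertens_sum (X powr (6 / 5)) - mertens_sum X \<ge> c * ln X) at_top"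
proof -
  obtain Y where Y: "Y \<ge> 1" and up: "\<And>X. X \<ge> Y \<Longrightarrow> 99 * mertens_sum (X / Y) \<le> 101 * ln X"
    and L: "\<And>X. X \<ge> Y \<Longrightarrow> 99 / 100 * pi * X \<le> real (card (gann 0 X)) \<and> real (card (gann 0 X)) \<le> 101 / 100 * pi * X"
    by (rule mertens_upper) blast
  define c where "c = pi / 180"
  \<comment> \<open>The numerical heart is the third estimate: 97/100 * 6/5 = 1.164 exceeds 101/100
    * 101/99, about 1.03, with more than 5/100 to spare. Division by the crude lattice constant 9
    then gives \<open>c\<close>.\<close>
  have e1: "eventually (\<lambda>X :: real. Y * X \<le> X powr (6 / 5)) at_top"
    and e2: "eventually (\<lambda>X :: real. 100 * Y \<le> X powr (6 / 5)) at_top"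
    and e3: "eventually (\<lambda>X :: real. 97 / 100 * (ln (X powr (6 / 5)) - ln 100) - 101 / 100 * (101 / 99 * ln (X * Y)) \<ge> 5 / 100 * ln X) at_top"
    using Y by real_asymp+
  have e4: "eventually (\<lambda>X :: real. X \<ge> Y \<and> X > 1) at_top"
    by (intro eventually_conj eventually_ge_at_top eventually_gt_at_top)
  have "eventually (\<lambda>X. mertens_sum (X powr (6 / 5)) - mertens_sum X \<ge> c * ln X) at_top"
    using e1 e2 e3 e4
  proof eventually_elim
    case (elim X)
    define Z where "Z = X powr (6 / 5)"
    have Z: "Y * X \<le> Z" "100 * Y \<le> Z" using elim by (simp_all add: Z_def)
    have X0: "X > 0" "X \<ge> 1" using elim by auto
    have Z0: "Z > 0" using X0 by (simp add: Z_def)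
    have ZY: "Z \<ge> Y" using Z Y by linarith
    have XZ: "X \<le> Z" using Z(1) mult_right_mono[OF Y, of X] X0 by linarith
    have mX: "mertens_sum X \<le> 101 / 99 * ln (X * Y)"
      using up[of "X * Y"] Y elim(4) mult_right_mono[of 1 X Y] by simp
    \<comment> \<open>Norms up to Z/100 make up at most two percent of the points and are dropped.
      For the rest the logarithm is at least ln Z - ln 100.\<close>
    have low: "97 / 100 * pi * Z * (ln Z - ln 100) \<le> (\<Sum>n\<in>gann 0 Z. ln (gauss_norm n))"
    proof -
      have sub: "gann (Z / 100) Z \<subseteq> gann 0 Z" using Z0 by (auto simp: gann_def intro: less_trans[rotated])
      have "card (gann 0 Z) = card (gann 0 (Z / 100)) + card (gann (Z / 100) Z)"
      proof -
        have "gann 0 Z = gann 0 (Z / 100) \<union> gann (Z / 100) Z" using Z0 by (auto simp: gann_def intro: less_trans[rotated])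
        moreover have "gann 0 (Z / 100) \<inter> gann (Z / 100) Z = {}" by (auto simp: gann_def)
        ultimately show ?thesis by (simp add: card_Un_disjoint)
      qed
      moreover have "real (card (gann 0 (Z / 100))) \<le> 101 / 100 * pi * (Z / 100)"
        using L[of "Z / 100"] Z(2) by simp
      moreover have "99 / 100 * pi * Z \<le> real (card (gann 0 Z))" using L[OF ZY] by simp
      moreover have "101 / 100 * pi * (Z / 100) \<le> 2 / 100 * pi * Z" using Z0 by simp
      ultimately have "97 / 100 * pi * Z \<le> real (card (gann (Z / 100) Z))" by simp
      then have "97 / 100 * pi * Z * (ln Z - ln 100) \<le> real (card (gann (Z / 100) Z)) * (ln Z - ln 100)"
      proof (rule mult_right_mono)
        have "100 \<le> Z" using Z(2) Y by linarith
        then show "0 \<le> ln Z - ln 100" by simp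
      qed
      also have "\<dots> \<le> (\<Sum>n\<in>gann (Z / 100) Z. ln (gauss_norm n))"
      proof (rule sum_bounded_below)
        fix n assume "n \<in> gann (Z / 100) Z"
        then have "Z / 100 \<le> gauss_norm n" by (simp add: gann_def)
        then have "ln (Z / 100) \<le> ln (gauss_norm n)" using Z0 by (subst ln_le_cancel_iff) auto
        then show "ln Z - ln 100 \<le> ln (gauss_norm n)" using Z0 by (simp add: ln_div)
      qed
      also have "\<dots> \<le> (\<Sum>n\<in>gann 0 Z. ln (gauss_norm n))"
      proof (rule sum_mono2[OF finite_gann sub])
        fix n assume "n \<in> gann 0 Z - gann (Z / 100) Z"
        then have "n \<noteq> 0" by (auto simp: gann_def)
        then show "0 \<le> ln (gauss_norm n)" using gauss_norm_ge_1 by (intro ln_ge_zero) blast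
      qed
      finally show ?thesis .
    qed
    also have "(\<Sum>n\<in>gann 0 Z. ln (gauss_norm n)) = (\<Sum>d\<in>gcanon \<inter> gball Z. gmangoldt d * real (card (gann 0 (Z / gauss_norm d))))"
      by (rule sum_ln_gann)
    \<comment> \<open>Up to X the lattice count is sharp, as Z divided by the norm of d is at least
      Y. Beyond X the crude constant 9 is enough, since it only affects the size of
      \<open>c\<close>.\<close>
    also have "\<dots> \<le> (\<Sum>d\<in>gcanon \<inter> gball Z. (if d \<in> gball X then 101 / 100 * pi * Z * (gmangoldt d / gauss_norm d) else 0)
        + (if d \<in> gball X then 0 else 9 * Z * (gmangoldt d / gauss_norm d)))"
    proof (rule sum_mono)
      fix d assume d: "d \<in> gcanon \<inter> gball Z"
      then have dp: "gauss_norm d > 0" "gauss_norm d \<le> Z" using gcanon_pos by (auto simp: gball_def)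
      show "gmangoldt d * real (card (gann 0 (Z / gauss_norm d))) \<le>
        (if d \<in> gball X then 101 / 100 * pi * Z * (gmangoldt d / gauss_norm d) else 0) + (if d \<in> gball X then 0 else 9 * Z * (gmangoldt d / gauss_norm d))"
      proof (cases "d \<in> gball X")
        case True
        then have "Y * gauss_norm d \<le> Y * X" using Y by (intro mult_left_mono) (auto simp: gball_def)
        then have "Y * gauss_norm d \<le> Z" using Z(1) by linarith
        then have "Z / gauss_norm d \<ge> Y" using dp by (simp add: field_simps)
        then have "gmangoldt d * real (card (gann 0 (Z / gauss_norm d))) \<le> gmangoldt d * (101 / 100 * pi * (Z / gauss_norm d))"
          using L by (intro mult_left_mono gmangoldt_nonneg) blast
        then show ?thesis using True by (simp add: mult_ac)
      next
        case False
        have "Z / gauss_norm d \<ge> 1" using dp by simp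
        then have "gmangoldt d * real (card (gann 0 (Z / gauss_norm d))) \<le> gmangoldt d * (9 * (Z / gauss_norm d))"
          by (intro mult_left_mono gmangoldt_nonneg card_gann_le) auto
        then show ?thesis using False by (simp add: mult_ac)
      qed
    qed
    also have "\<dots> = 101 / 100 * pi * Z * mertens_sum X + 9 * Z * (mertens_sum Z - mertens_sum X)"
    proof -
      have s1: "(\<Sum>d\<in>gcanon \<inter> gball Z. if d \<in> gball X then 101 / 100 * pi * Z * (gmangoldt d / gauss_norm d) else 0) = 101 / 100 * pi * Z * mertens_sum X"
        unfolding mertens_sum_def sum_distrib_left
        by (rule sum.mono_neutral_cong_right) (use XZ in \<open>auto simp: gball_def finite_gball[unfolded gball_def]\<close>)
      have "gcanon \<inter> gball X \<subseteq> gcanon \<inter> gball Z" using XZ by (auto simp: gball_def)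
      then have "mertens_sum Z - mertens_sum X = (\<Sum>d\<in>gcanon \<inter> gball Z - gcanon \<inter> gball X. gmangoldt d / gauss_norm d)"
        unfolding mertens_sum_def by (intro sum_diff[symmetric]) auto
      then have s2: "(\<Sum>d\<in>gcanon \<inter> gball Z. if d \<in> gball X then 0 else 9 * Z * (gmangoldt d / gauss_norm d)) = 9 * Z * (mertens_sum Z - mertens_sum X)"
        unfolding sum_distrib_left
        by (simp only: sum_distrib_left, intro sum.mono_neutral_cong_right) (auto simp: finite_gball)
      show ?thesis unfolding sum.distrib s1 s2 ..
    qed
    finally have "Z * (97 / 100 * pi * (ln Z - ln 100)) \<le> Z * (101 / 100 * pi * mertens_sum X + 9 * (mertens_sum Z - mertens_sum X))"
      by (simp add: algebra_simps)
    then have "97 / 100 * pi * (ln Z - ln 100) \<le> 101 / 100 * pi * mertens_sum X + 9 * (mertens_sum Z - mertens_sum X)"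
      using Z0 by (rule mult_left_le_imp_le)
    also have "\<dots> \<le> 101 / 100 * pi * (101 / 99 * ln (X * Y)) + 9 * (mertens_sum Z - mertens_sum X)"
      by (intro add_mono mult_left_mono mX) auto
    finally have "pi * (97 / 100 * (ln Z - ln 100) - 101 / 100 * (101 / 99 * ln (X * Y))) \<le> 9 * (mertens_sum Z - mertens_sum X)"
      by (simp add: algebra_simps)
    moreover have "pi * (5 / 100 * ln X) \<le> pi * (97 / 100 * (ln Z - ln 100) - 101 / 100 * (101 / 99 * ln (X * Y)))"
      using elim(3) unfolding Z_def by (intro mult_left_mono) auto
    ultimately have "pi * (5 / 100 * ln X) \<le> 9 * (mertens_sum Z - mertens_sum X)" by linarith
    then show ?case unfolding c_def Z_def by simp
  qed
  then show thesis by (rule that[rotated]) (simp add: c_def)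
qed

subsection \<open>Assembling the asymptotic\<close>

lemma sum_UNION_le:
  fixes f :: "'a \<Rightarrow> real"
  assumes "finite K" "\<And>j. finite (A j)" "\<And>x. f x \<ge> 0"
  shows "sum f (\<Union>j\<in>K. A j) \<le> (\<Sum>j\<in>K. sum f (A j))"
  using assms(1)
proof (induction K rule: finite_induct)
  case (insert j K)
  have "sum f (\<Union>j\<in>insert j K. A j) = sum f (A j \<union> (\<Union>j\<in>K. A j))" by simp
  also have "\<dots> \<le> sum f (A j) + sum f (\<Union>j\<in>K. A j)"
    using sum_Un[of "A j" "\<Union>j\<in>K. A j" f] insert.hyps assms(2) sum_nonneg[of "A j \<inter> (\<Union>j\<in>K. A j)" f] assms(3) by simp
  finally show ?case using insert by simp
qed simp

text \<open>The Mertens mass between X and X^(6/5) is at least a constant times ln X and is shared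
  by at most 4 ln X dyadic blocks, so some block carries von Mangoldt mass proportional to its
  length.\<close>

lemma many_primes_in_some_dyadic_block:
  obtains c where "c > 0" "eventually (\<lambda>X :: real. \<exists>j :: nat. X < 2 ^ j \<and> 2 ^ j \<le> 2 * X powr (6 / 5) \<and>
     c * 2 ^ j / ln (2 ^ j) \<le> real (card (gauss_primes_dyadic (2 ^ j)))) at_top"
proof -
  obtain c0 where c0: "c0 > 0" and gap: "eventually (\<lambda>X. mertens_sum (X powr (6 / 5)) - mertens_sum X \<ge> c0 * ln X) at_top"
    by (rule mertens_gap)
  \<comment> \<open>If every block had mass below 2 c 2^j, the total would be at most 4 c * 4 ln X =
    c0 ln X / 2, a contradiction. Of the mass 2 c 2^j that is found, half is reserved for prime
    powers.\<close>
  define c where "c = c0 / 32"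
  have c: "c > 0" using c0 by (simp add: c_def)
  have "eventually (\<lambda>x :: real. 72 * (1 + ln x)\<^sup>2 * sqrt x \<le> c * x) at_top" using c by real_asymp
  then obtain X0 where X0: "\<And>x. x \<ge> X0 \<Longrightarrow> 72 * (1 + ln x)\<^sup>2 * sqrt x \<le> c * x"
    unfolding eventually_at_top_linorder by blast
  have e1: "eventually (\<lambda>X :: real. log 2 (2 * X powr (6 / 5)) + 1 \<le> 4 * ln X) at_top"
  proof -
    have "eventually (\<lambda>X :: real. 2 + 9 / 5 * ln X \<le> 4 * ln X \<and> X > 1) at_top"
      by (intro eventually_conj eventually_gt_at_top) real_asymp
    then show ?thesis
    proof eventually_elim
      case (elim X)
      have "log 2 (2 * X powr (6 / 5)) = 1 + 6 / 5 * (ln X / ln 2)"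
        using elim by (simp add: log_def ln_mult ln_powr add_divide_distrib)
      moreover have "ln X / ln 2 \<le> ln X / (2 / 3)"
        using elim ln2_ge_two_thirds by (intro divide_left_mono) auto
      ultimately show ?case using elim by simp
    qed
  qed
  have e2: "eventually (\<lambda>X :: real. X \<ge> max X0 6 \<and> X \<le> X powr (6 / 5)) at_top"
    by (intro eventually_conj eventually_ge_at_top) real_asymp
  have "eventually (\<lambda>X :: real. \<exists>j :: nat. X < 2 ^ j \<and> 2 ^ j \<le> 2 * X powr (6 / 5) \<and>
     c * 2 ^ j / ln (2 ^ j) \<le> real (card (gauss_primes_dyadic (2 ^ j)))) at_top"
    using gap e1 e2
  proof eventually_elim
    case (elim X)
    define X' where "X' = X powr (6 / 5)"
    have X: "X \<ge> X0" "X \<ge> 6" "X \<le> X'" using elim by (simp_all add: X'_def)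
    define K where "K = {j :: nat. X < 2 ^ j \<and> 2 ^ j \<le> 2 * X'}"
    have K_sub: "K \<subseteq> {..nat \<lfloor>log 2 (2 * X')\<rfloor>}"
    proof
      fix j assume "j \<in> K"
      then have "2 ^ j \<le> 2 * X'" by (simp add: K_def)
      then have "real j \<le> log 2 (2 * X')" using X by (simp add: le_log_iff powr_realpow)
      then have "j \<le> nat \<lfloor>log 2 (2 * X')\<rfloor>" by linarith
      then show "j \<in> {..nat \<lfloor>log 2 (2 * X')\<rfloor>}" by simp
    qed
    have finK: "finite K" using K_sub by (rule finite_subset) simp
    have cardK: "real (card K) \<le> 4 * ln X"
    proof -
      have "card K \<le> card {..nat \<lfloor>log 2 (2 * X')\<rfloor>}" using K_sub by (intro card_mono) auto
      then have "card K \<le> nat \<lfloor>log 2 (2 * X')\<rfloor> + 1" by simp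
      moreover have "log 2 (2 * X') \<ge> 0" using X by simp
      ultimately have "real (card K) \<le> log 2 (2 * X') + 1" by linarith
      then show ?thesis using elim(2) by (simp add: X'_def)
    qed
    define \<psi> where "\<psi> j = (\<Sum>d\<in>gann (2 ^ j / 2) (2 ^ j). gmangoldt d)" for j :: nat
    define D where "D = gcanon \<inter> gball X' - gcanon \<inter> gball X"
    have "c0 * ln X \<le> mertens_sum X' - mertens_sum X" using elim(1) by (simp add: X'_def)
    also have "\<dots> = (\<Sum>d\<in>D. gmangoldt d / gauss_norm d)"
    proof -
      have "gcanon \<inter> gball X \<subseteq> gcanon \<inter> gball X'" using X by (auto simp: gball_def)
      then show ?thesis unfolding mertens_sum_def D_def by (intro sum_diff[symmetric]) auto
    qed
    also have "\<dots> \<le> (\<Sum>d\<in>(\<Union>j\<in>K. gann (2 ^ j / 2) (2 ^ j)). gmangoldt d / gauss_norm d)"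
    proof (rule sum_mono2)
      show "finite (\<Union>j\<in>K. gann (2 ^ j / 2) (2 ^ j))" using finK by blast
      show "D \<subseteq> (\<Union>j\<in>K. gann (2 ^ j / 2) (2 ^ j))"
      proof
        fix d assume "d \<in> D"
        then have d: "X < gauss_norm d" "gauss_norm d \<le> X'" by (auto simp: D_def gball_def)
        have d1: "gauss_norm d > 1" using d X by linarith
        define j where "j = nat \<lceil>log 2 (gauss_norm d)\<rceil>"
        have l0: "log 2 (gauss_norm d) > 0" using d1 by simp
        then have j: "log 2 (gauss_norm d) \<le> real j" "real j < log 2 (gauss_norm d) + 1" unfolding j_def by linarith+
        have "gauss_norm d \<le> 2 ^ j" using j(1) d1 by (simp add: log_le_iff powr_realpow)
        moreover have "2 ^ j < 2 * gauss_norm d"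
        proof -
          have "2 powr real j < 2 powr (log 2 (gauss_norm d) + 1)" using j(2) by simp
          then show ?thesis using d1 by (simp add: powr_add powr_realpow mult.commute)
        qed
        ultimately have "j \<in> K" "d \<in> gann (2 ^ j / 2) (2 ^ j)" using d by (auto simp: K_def gann_def)
        then show "d \<in> (\<Union>j\<in>K. gann (2 ^ j / 2) (2 ^ j))" by blast
      qed
    qed (simp add: gmangoldt_nonneg)
    also have "\<dots> \<le> (\<Sum>j\<in>K. \<Sum>d\<in>gann (2 ^ j / 2) (2 ^ j). gmangoldt d / gauss_norm d)"
      using sum_UNION_le[OF finK, of "\<lambda>j. gann (2 ^ j / 2) (2 ^ j)" "\<lambda>d. gmangoldt d / gauss_norm d"]
      by (simp add: gmangoldt_nonneg)
    also have "\<dots> \<le> (\<Sum>j\<in>K. 2 / 2 ^ j * \<psi> j)"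
      unfolding \<psi>_def sum_distrib_left
    proof (intro sum_mono)
      fix j d assume d: "d \<in> gann (2 ^ j / 2) (2 ^ j)"
      have "gmangoldt d / gauss_norm d \<le> gmangoldt d / (2 ^ j / 2)"
        using d gmangoldt_nonneg[of d] by (intro divide_left_mono) (auto simp: gann_def intro!: mult_pos_pos intro: less_trans[rotated])
      then show "gmangoldt d / gauss_norm d \<le> 2 / 2 ^ j * gmangoldt d" by (simp add: field_simps)
    qed
    finally have total: "c0 * ln X \<le> (\<Sum>j\<in>K. 2 / 2 ^ j * \<psi> j)" .
    have "\<exists>j\<in>K. \<psi> j \<ge> 2 * c * 2 ^ j"
    proof (rule ccontr)
      assume *: "\<not> (\<exists>j\<in>K. \<psi> j \<ge> 2 * c * 2 ^ j)"
      have "(\<Sum>j\<in>K. 2 / 2 ^ j * \<psi> j) \<le> real (card K) * (c0 / 8)"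
      proof (rule sum_bounded_above)
        fix j assume "j \<in> K"
        then have "\<psi> j \<le> 2 * c * 2 ^ j" using * by force
        then have "2 / 2 ^ j * \<psi> j \<le> 2 / 2 ^ j * (2 * c * 2 ^ j)" by (intro mult_left_mono) auto
        then show "2 / 2 ^ j * \<psi> j \<le> c0 / 8" by (simp add: c_def)
      qed
      also have "\<dots> \<le> 4 * ln X * (c0 / 8)" using cardK c0 by (intro mult_right_mono) auto
      finally have "c0 * ln X \<le> c0 * ln X / 2" using total by simp
      moreover have "c0 * ln X > 0" using c0 X by simp
      ultimately show False by linarith
    qed
    then obtain j where j: "j \<in> K" "\<psi> j \<ge> 2 * c * 2 ^ j" by blast
    define N :: real where "N = 2 ^ j"
    have N: "N > X" "N \<ge> X0" "N > 6" using j X by (auto simp: K_def N_def)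
    define S where "S = (\<Sum>p\<in>gprimes (N / 2) N. ln (gauss_norm p))"
    have "norm ((\<Sum>n\<in>gann (N / 2) N. of_real (gmangoldt n) * 1) - (\<Sum>p\<in>gprimes (N / 2) N. of_real (ln (gauss_norm p)) * (1 :: complex)))
       \<le> 72 * (1 + ln N)\<^sup>2 * sqrt N"
      by (rule norm_prime_sum_diff_le) (use N in auto)
    then have "norm (complex_of_real (\<psi> j - S)) \<le> 72 * (1 + ln N)\<^sup>2 * sqrt N"
      by (simp add: \<psi>_def S_def N_def)
    then have "\<bar>\<psi> j - S\<bar> \<le> 72 * (1 + ln N)\<^sup>2 * sqrt N" by (simp only: norm_of_real)
    then have "2 * c * N - c * N \<le> S" using X0[OF N(2)] j(2) unfolding N_def[symmetric] by linarith
    also have "2 * c * N - c * N = c * N" by (simp add: algebra_simps)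
    finally have "c * N \<le> S" .
    also have "S \<le> real (card (gprimes (N / 2) N)) * ln N"
      unfolding S_def
    proof (rule sum_bounded_above)
      fix p assume "p \<in> gprimes (N / 2) N"
      then have "0 < gauss_norm p" "gauss_norm p \<le> N" using N by (auto simp: gprimes_def gann_def)
      then show "ln (gauss_norm p) \<le> ln N" by simp
    qed
    finally have "c * N / ln N \<le> real (card (gprimes (N / 2) N))"
      using N by (simp add: pos_divide_le_eq)
    then show ?case using j(1) unfolding K_def X'_def gprimes_dyadic N_def by auto
  qed
  then show thesis using that c by blast
qed

text \<open>The condition \<open>r \<epsilon> \<ge> 4\<close> makes the tail of the kernel of exponent \<open>2 r\<close> at most
  \<open>3 r x\<^bsup>1/24 - 2\<^esup>\<close>, while its degree stays below \<open>3 r x\<^bsup>1/24 - \<epsilon>/2\<^esup>\<close>. The hypotheses on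
  \<open>n\<close> say that \<open>\<theta>\<close> has an approximation with denominator of norm \<open>n\<close> between about
  \<open>x\<^bsup>1/3\<^esup>\<close> and \<open>x\<^bsup>2/5\<^esup>\<close>.\<close>

lemma discrepancy_bound:
  fixes \<theta> :: complex and \<epsilon> \<delta> n c :: real and N r :: nat
  defines "x \<equiv> real N"
  assumes \<epsilon>: "0 < \<epsilon>" "\<epsilon> < 1 / 24" and r: "r \<ge> 1" "real r * \<epsilon> \<ge> 4" and x: "x \<ge> 64" and c: "c > 0"
    and x1: "1152 * (real r)\<^sup>2 \<le> x powr \<epsilon>" and x2: "3 * real r * x powr (1 / 24 - 2) \<le> 1" and x3: "x powr (- \<epsilon> / 4) \<le> 1 / 3"
    and sp: "spaced_freq \<theta> (n / 16) (1 / (4 * sqrt n))" and n: "n \<ge> 1" "n powr (5 / 2) \<le> x" "x \<le> 2 * n ^ 3"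
    and primes: "c * x / ln x \<le> real (card (gauss_primes_dyadic N))"
    and \<delta>: "x powr (- 1 / 24 + \<epsilon>) \<le> \<delta>" "\<delta> \<le> 1 / 2"
  defines "P \<equiv> gauss_primes_dyadic N"
  shows "\<bar>real (card {p \<in> P. dist_gauss (complex_of_gauss p * \<theta>) \<le> \<delta>}) / (4 * \<delta>\<^sup>2 * real (card P)) - 1\<bar>
    \<le> 6 * x powr (- \<epsilon> / 4) + 3 / 2 * real r * x powr (- 15 / 8) + 288 * 10 ^ 8 * (real r)\<^sup>2 / c * (1 + ln x) ^ 6 * x powr (- \<epsilon>)"
proof -
  have x0: "x > 0" "x \<ge> 1" using x by auto
  have xp: "x powr s > 0" for s using x0 by simp
  have xmono: "x powr s \<le> x powr t" if "s \<le> t" for s t using that x0 by (intro powr_mono) auto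
  have x1p: "x powr s \<ge> 1" if "s \<ge> 0" for s using that x0 by (intro ge_one_powr_ge_zero) auto
  define l where "l = 1 + ln x"
  have l: "l \<ge> 1" "ln x \<le> l" "ln x > 0" using x by (auto simp: l_def)
  have \<delta>0: "\<delta> > 0" using \<delta>(1) xp[of "-1/24+\<epsilon>"] by linarith
  define y where "y = x powr (1 / 24 - \<epsilon> / 2)"
  have y: "y \<ge> 1" unfolding y_def using \<epsilon> by (intro x1p) simp
  define \<kappa> where "\<kappa> = x powr (- \<epsilon> / 4)"
  \<comment> \<open>The excess x^(\<epsilon>/2) over 1/\<delta> outweighs the factor
    x^(-\<epsilon>/4) in \<kappa>, so the kernel is concentrated on the scale \<kappa>
    \<delta>.\<close>
  define L where "L = nat \<lceil>x powr (\<epsilon> / 2) / \<delta>\<rceil>"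
  have Ld: "x powr (\<epsilon> / 2) / \<delta> > 0" using xp \<delta>0 by simp
  have L: "x powr (\<epsilon> / 2) / \<delta> \<le> real L" "real L \<le> x powr (\<epsilon> / 2) / \<delta> + 1" "L \<ge> 1"
    using Ld unfolding L_def by linarith+
  have Ly: "real L \<le> 2 * y"
  proof -
    have "x powr (\<epsilon> / 2) / \<delta> \<le> x powr (\<epsilon> / 2) / x powr (- 1 / 24 + \<epsilon>)"
      using \<delta> \<delta>0 xp by (intro divide_left_mono) auto
    also have "\<dots> = y" by (simp add: y_def powr_diff[symmetric])
    finally show ?thesis using L(2) y by linarith
  qed
  have R: "real (r * L + 1) \<le> 3 * real r * y"
  proof -
    have "real r * real L \<le> real r * (2 * y)" using Ly by (intro mult_left_mono) auto
    moreover have "1 * 1 \<le> real r * y" using r y by (intro mult_mono) auto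
    ultimately show ?thesis by simp
  qed
  have y2: "y\<^sup>2 = x powr (1 / 12 - \<epsilon>)" unfolding y_def using x0 by (simp add: powr_power)
  have R2: "(real (r * L + 1))\<^sup>2 \<le> 9 * (real r)\<^sup>2 * x powr (1 / 12 - \<epsilon>)"
  proof -
    have "(real (r * L + 1))\<^sup>2 \<le> (3 * real r * y)\<^sup>2" using R by (intro power_mono) auto
    then show ?thesis by (simp add: power_mult_distrib y2)
  qed
  define \<tau> where "\<tau> = real (r * L + 1) / (real L * (\<kappa> * \<delta>)) ^ (2 * r)"
  \<comment> \<open>L \<kappa> \<delta> is at least x^(\<epsilon>/4), and the power 2 r turns this
    into at least x^2.\<close>
  have \<tau>: "\<tau> \<le> 3 * real r * x powr (1 / 24 - 2)"
  proof -
    have "x powr (\<epsilon> / 4) = x powr (\<epsilon> / 2) / \<delta> * (\<kappa> * \<delta>)"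
      using \<delta>0 by (simp add: \<kappa>_def powr_add[symmetric])
    also have "\<dots> \<le> real L * (\<kappa> * \<delta>)" using L(1) \<delta>0 by (intro mult_right_mono) (auto simp: \<kappa>_def)
    finally have "(x powr (\<epsilon> / 4)) ^ (2 * r) \<le> (real L * (\<kappa> * \<delta>)) ^ (2 * r)" by (intro power_mono) auto
    moreover have "(x powr (\<epsilon> / 4)) ^ (2 * r) = x powr (real r * \<epsilon> / 2)"
      using x0 by (simp add: powr_power mult_ac)
    moreover have "x powr 2 \<le> x powr (real r * \<epsilon> / 2)" using r by (intro xmono) simp
    ultimately have "x powr 2 \<le> (real L * (\<kappa> * \<delta>)) ^ (2 * r)" by linarith
    then have "\<tau> \<le> real (r * L + 1) / x powr 2"
      unfolding \<tau>_def using xp[of 2] less_le_trans[OF xp[of 2]] by (intro divide_left_mono mult_pos_pos) auto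
    also have "\<dots> \<le> 3 * real r * x powr (1 / 24) / x powr 2"
    proof (rule divide_right_mono)
      have "y \<le> x powr (1 / 24)" unfolding y_def using \<epsilon> by (intro xmono) simp
      then have "3 * real r * y \<le> 3 * real r * x powr (1 / 24)" by (intro mult_left_mono) auto
      then show "real (r * L + 1) \<le> 3 * real r * x powr (1 / 24)" using R by linarith
    qed simp
    also have "\<dots> = 3 * real r * x powr (1 / 24 - 2)" by (simp only: powr_diff times_divide_eq_right)
    finally show ?thesis .
  qed
  \<comment> \<open>The constant c of \<open>prime_gchar_bound\<close> is 1/4 here, matching the
    spacing 1/(4 sqrt n).\<close>
  define T where "T = 2 * 10 ^ 8 / (1 / 4) * l ^ 5 * x powr (11 / 12)"
  have T0: "T \<ge> 0" using l by (simp add: T_def)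
  have T: "norm (\<Sum>p\<in>P. ee (of_int a * Re (complex_of_gauss p * \<theta>) + of_int b * Im (complex_of_gauss p * \<theta>))) \<le> T"
    if ab: "(a, b) \<noteq> (0, 0)" "\<bar>a\<bar> \<le> int (r * L)" "\<bar>b\<bar> \<le> int (r * L)" for a b :: int
  proof -
    \<comment> \<open>The conjugate of a + b i, because Re (h z) = a Re z + b Im z.\<close>
    define h where "h = Gauss_Int a (- b)"
    have h0: "h \<noteq> 0" using ab(1) by (auto simp: h_def zero_gauss_int_def)
    have hpos: "gauss_norm h > 0" by (rule gauss_norm_pos[OF h0])
    have sq: "(of_int t :: real)\<^sup>2 \<le> (real (r * L + 1))\<^sup>2" if "\<bar>t\<bar> \<le> int (r * L)" for t :: int
    proof -
      have "real_of_int \<bar>t\<bar> \<le> real_of_int (int (r * L))" using that by (simp only: of_int_le_iff)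
      then have "\<bar>real_of_int t\<bar> \<le> real (r * L + 1)" by simp
      then have "\<bar>real_of_int t\<bar>\<^sup>2 \<le> (real (r * L + 1))\<^sup>2" by (intro power_mono) auto
      then show ?thesis by simp
    qed
    have hle: "gauss_norm h \<le> 18 * (real r)\<^sup>2 * x powr (1 / 12 - \<epsilon>)"
    proof -
      have "gauss_norm h = (of_int a)\<^sup>2 + (of_int b)\<^sup>2" by (simp add: gauss_norm_altdef h_def)
      then show ?thesis using sq[OF ab(2)] sq[OF ab(3)] R2 by linarith
    qed
    have ch: "gchar (complex_of_gauss h * \<theta>) p = ee (of_int a * Re (complex_of_gauss p * \<theta>) + of_int b * Im (complex_of_gauss p * \<theta>))" for p
      unfolding gchar_def by (rule arg_cong[of _ _ ee]) (simp add: h_def algebra_simps)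
    have "norm (\<Sum>p\<in>gauss_primes_dyadic N. gchar (complex_of_gauss h * \<theta>) p) \<le> 2 * 10 ^ 8 / (1 / 4) * (1 + ln (real N)) ^ 5 * real N powr (11 / 12)"
    proof (rule prime_gchar_bound[OF spaced_freq_mult[OF sp h0]])
      have xe: "x powr (1 / 12 - \<epsilon>) * x powr \<epsilon> = x powr (1 / 12)" by (simp add: powr_add[symmetric])
      \<comment> \<open>The hypothesis x \<le> 2 n^3 gives n \<ge> x^(1/3) / 2, and the norm of h is
        at most a constant times x^(1/12 - \<epsilon>). The spare factor x^\<epsilon> absorbs the
        constants.\<close>
      show "real N powr (1 / 4) \<le> n / 16 / gauss_norm h"
      proof -
        have n3: "x powr (1 / 3) \<le> 2 * n"
        proof -
          have "0 \<le> n ^ 3" using n by simp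
          then have "x \<le> 8 * n ^ 3" using n(3) by linarith
          then have "x \<le> (2 * n) ^ 3" by (simp add: power_mult_distrib)
          then have "x powr (1 / 3) \<le> ((2 * n) ^ 3) powr (1 / 3)" using x0 by (intro powr_mono2) auto
          also have "(2 * n) ^ 3 = (2 * n) powr 3" using n by simp
          also have "((2 * n) powr 3) powr (1 / 3) = (2 * n) powr (3 * (1 / 3))" by (simp only: powr_powr)
          also have "\<dots> = 2 * n" using n by simp
          finally show ?thesis .
        qed
        have "x powr (1 / 4) * (16 * gauss_norm h) \<le> x powr (1 / 4) * (16 * (18 * (real r)\<^sup>2 * x powr (1 / 12 - \<epsilon>)))"
          using hle by (intro mult_left_mono) auto
        also have "\<dots> = 288 * (real r)\<^sup>2 * (x powr (1 / 4) * x powr (1 / 12 - \<epsilon>))" by simp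
        also have "\<dots> \<le> (x powr \<epsilon> / 2) * (x powr (1 / 4) * x powr (1 / 12 - \<epsilon>))"
        proof (rule mult_right_mono)
          have "0 \<le> (real r)\<^sup>2" by simp
          then show "288 * (real r)\<^sup>2 \<le> x powr \<epsilon> / 2" using x1 by linarith
        qed simp
        also have "\<dots> = x powr (1 / 3) / 2" by (simp add: powr_add[symmetric])
        also have "\<dots> \<le> n" using n3 by simp
        finally show ?thesis using hpos unfolding x_def by (simp add: field_simps)
      qed
      show "1 / 4 * real N powr (- 1 / 5) \<le> 1 / (4 * sqrt n)"
      proof -
        have "n = (n powr (5 / 2)) powr (2 / 5)" using n by (simp add: powr_powr)
        also have "\<dots> \<le> x powr (2 / 5)" using n by (intro powr_mono2) auto
        finally have "sqrt n \<le> sqrt (x powr (2 / 5))" by simp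
        also have "\<dots> = x powr (1 / 5)" by (simp add: powr_half_sqrt[symmetric] powr_powr)
        finally have "1 / x powr (1 / 5) \<le> 1 / sqrt n" using n xp by (intro divide_left_mono) auto
        then show ?thesis unfolding x_def[symmetric] by (simp add: powr_minus_divide)
      qed
      \<comment> \<open>Here n cancels, and the condition only limits the norm of h. It is met
        because of the exponent 1/24 in the hypothesis on \<delta>.\<close>
      show "1 / 4 * real N powr (- 1 / 12) \<le> n / 16 / gauss_norm h * (1 / (4 * sqrt n))\<^sup>2"
      proof -
        have "gauss_norm h * 64 \<le> 18 * (real r)\<^sup>2 * x powr (1 / 12 - \<epsilon>) * 64"
          using hle by (intro mult_right_mono) auto
        also have "\<dots> = 1152 * (real r)\<^sup>2 * x powr (1 / 12 - \<epsilon>)" by simp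
        also have "\<dots> \<le> x powr \<epsilon> * x powr (1 / 12 - \<epsilon>)" using x1 by (intro mult_right_mono) auto
        also have "\<dots> = x powr (1 / 12)" using xe by (simp add: mult.commute)
        finally have "1 / x powr (1 / 12) \<le> 1 / (gauss_norm h * 64)"
          using hpos xp by (intro divide_left_mono) auto
        then have "1 / 4 * x powr (- 1 / 12) \<le> 1 / (256 * gauss_norm h)" by (simp add: powr_minus_divide)
        also have "\<dots> = n / 16 / gauss_norm h * (1 / (4 * sqrt n))\<^sup>2"
          using n hpos by (simp add: power_divide power_mult_distrib)
        finally show ?thesis unfolding x_def .
      qed
      show "1 / (4 * sqrt n) \<le> 1 / 2"
      proof -
        have "sqrt n \<ge> 1" using n by simp
        then have "2 \<le> 4 * sqrt n" by linarith
        then show ?thesis by (rule frac_le[rotated 3]) simp_all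
      qed
    qed (use x in \<open>auto simp: x_def\<close>)
    then show ?thesis unfolding ch P_def T_def l_def x_def .
  qed
  define m where "m = real (card P)"
  have fin: "finite P" unfolding P_def by (rule finite_gauss_primes_dyadic)
  have pos: "c * x / ln x > 0" using c x0 l by simp
  then have m0: "m > 0" using primes by (simp add: m_def P_def)
  \<comment> \<open>Trading x for the number of primes costs one logarithm and raises l^5 to
    l^6.\<close>
  have xm: "x \<le> m * l / c"
  proof -
    have "c * x \<le> m * ln x" using primes l by (simp add: m_def P_def field_simps)
    also have "\<dots> \<le> m * l" using l m0 by (intro mult_left_mono) auto
    finally show ?thesis using c by (simp add: field_simps)
  qed
  define C where "C = real (card {p \<in> P. dist_gauss (complex_of_gauss p * \<theta>) \<le> \<delta>})"
  have \<kappa>: "0 < \<kappa>" "\<kappa> \<le> 1 / 3" using x3 xp by (simp_all add: \<kappa>_def)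
  have \<tau>1: "\<tau> \<le> 1" using \<tau> x2 by linarith
  have main: "\<bar>C - 4 * \<delta>\<^sup>2 * m\<bar> \<le> 24 * \<kappa> * \<delta>\<^sup>2 * m + 2 * \<tau> * m + 16 * \<delta>\<^sup>2 * (real (r * L + 1))\<^sup>2 * T"
    unfolding C_def m_def
    by (rule count_by_characters[OF fin \<delta>0 \<delta>(2) \<kappa> L(3) _ T0 \<tau>_def \<tau>1]) (rule T)
  define W where "W = 4 * \<delta>\<^sup>2 * m"
  have W0: "W > 0" using \<delta>0 m0 by (simp add: W_def)
  have t1: "24 * \<kappa> * \<delta>\<^sup>2 * m = 6 * \<kappa> * W" by (simp add: W_def)
  have t2: "2 * \<tau> * m \<le> 3 / 2 * real r * x powr (- 15 / 8) * W"
  proof -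
    have "x powr (- 1 / 24) \<le> x powr (- 1 / 24 + \<epsilon>)" using \<epsilon> by (intro xmono) simp
    then have "x powr (- 1 / 24) \<le> \<delta>" using \<delta>(1) by linarith
    then have "(x powr (- 1 / 24))\<^sup>2 \<le> \<delta>\<^sup>2" by (intro power_mono) auto
    moreover have "(x powr (- 1 / 24))\<^sup>2 = x powr (- 1 / 12)" using x0 by (simp add: powr_power)
    ultimately have d2: "x powr (- 1 / 12) \<le> \<delta>\<^sup>2" by simp
    have "2 * \<tau> * m \<le> 2 * (3 * real r * x powr (1 / 24 - 2)) * m"
      using \<tau> m0 by (intro mult_right_mono mult_left_mono) auto
    also have "x powr (1 / 24 - 2) = x powr (- 15 / 8) * x powr (- 1 / 12)" by (simp add: powr_add[symmetric])
    also have "2 * (3 * real r * (x powr (- 15 / 8) * x powr (- 1 / 12))) * m \<le> 2 * (3 * real r * (x powr (- 15 / 8) * \<delta>\<^sup>2)) * m"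
      using d2 m0 by (intro mult_right_mono mult_left_mono) auto
    also have "\<dots> = 3 / 2 * real r * x powr (- 15 / 8) * W" by (simp add: W_def)
    finally show ?thesis .
  qed
  have t3: "16 * \<delta>\<^sup>2 * (real (r * L + 1))\<^sup>2 * T \<le> 288 * 10 ^ 8 * (real r)\<^sup>2 / c * l ^ 6 * x powr (- \<epsilon>) * W"
  proof -
    have "16 * \<delta>\<^sup>2 * (real (r * L + 1))\<^sup>2 * T \<le> 16 * \<delta>\<^sup>2 * (9 * (real r)\<^sup>2 * x powr (1 / 12 - \<epsilon>)) * T"
      using R2 T0 by (intro mult_right_mono mult_left_mono) auto
    also have "\<dots> = 1152 * 10 ^ 8 * \<delta>\<^sup>2 * (real r)\<^sup>2 * l ^ 5 * (x powr (1 / 12 - \<epsilon>) * x powr (11 / 12))"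
      by (simp add: T_def)
    also have "x powr (1 / 12 - \<epsilon>) * x powr (11 / 12) = x * x powr (- \<epsilon>)"
      using x0 powr_add[of x 1 "- \<epsilon>"] by (simp add: powr_add[symmetric])
    also have "1152 * 10 ^ 8 * \<delta>\<^sup>2 * (real r)\<^sup>2 * l ^ 5 * (x * x powr (- \<epsilon>)) \<le> 1152 * 10 ^ 8 * \<delta>\<^sup>2 * (real r)\<^sup>2 * l ^ 5 * (m * l / c * x powr (- \<epsilon>))"
      using xm l by (intro mult_left_mono mult_right_mono) auto
    also have "\<dots> = 288 * 10 ^ 8 * (real r)\<^sup>2 / c * l ^ 6 * x powr (- \<epsilon>) * W"
      by (simp add: W_def eval_nat_numeral)
    finally show ?thesis .
  qed
  have "\<bar>C - W\<bar> \<le> (6 * \<kappa> + 3 / 2 * real r * x powr (- 15 / 8) + 288 * 10 ^ 8 * (real r)\<^sup>2 / c * l ^ 6 * x powr (- \<epsilon>)) * W"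
    using main t1 t2 t3 unfolding W_def[symmetric] distrib_right by linarith
  then have "\<bar>C - W\<bar> / W \<le> 6 * \<kappa> + 3 / 2 * real r * x powr (- 15 / 8) + 288 * 10 ^ 8 * (real r)\<^sup>2 / c * l ^ 6 * x powr (- \<epsilon>)"
    using W0 by (subst pos_divide_le_eq)
  moreover have "\<bar>C / W - 1\<bar> = \<bar>C - W\<bar> / W"
    using W0 by (simp add: field_simps abs_divide)
  ultimately show ?thesis by (simp only: C_def W_def m_def \<kappa>_def l_def)
qed


text \<open>The clause for \<epsilon> < 1/24 makes the constant choice \<delta> = 1/2 admissible, so
  the claim about all \<delta> is not vacuous in that range. For larger \<epsilon> no \<delta> is
  admissible, since N k is positive.\<close>

theorem theorem10p1:
  fixes \<theta> :: complex and \<epsilon> :: real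
  assumes "\<theta> \<notin> gauss_rats"
    and "\<epsilon> > 0"
  shows "\<exists>N :: nat \<Rightarrow> nat. strict_mono N \<and> (\<forall>k. N k > 0) \<and>
    (\<epsilon> < 1 / 24 \<longrightarrow> (\<forall>k. real (N k) powr (- 1 / 24 + \<epsilon>) \<le> 1 / 2)) \<and>
    (\<forall>\<delta> :: nat \<Rightarrow> real.
      (\<forall>k. real (N k) powr (- 1 / 24 + \<epsilon>) \<le> \<delta> k \<and> \<delta> k \<le> 1 / 2) \<longrightarrow>
      (\<lambda>k. \<Sum>p | p \<in> gauss_primes_dyadic (N k) \<and> dist_gauss (complex_of_gauss p * \<theta>) \<le> \<delta> k. 1 :: real)
        \<sim>[sequentially]
      (\<lambda>k. 4 * (\<delta> k)\<^sup>2 * (\<Sum>p \<in> gauss_primes_dyadic (N k). 1)))"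
proof (cases "\<epsilon> < 1 / 24")
  case False
  \<comment> \<open>No \<open>\<delta>\<close> is admissible, since \<open>N k powr (- 1 / 24 + \<epsilon>) \<ge> 1\<close>.\<close>
  have "\<not> (\<forall>k. real (Suc k) powr (- 1 / 24 + \<epsilon>) \<le> \<delta> k \<and> \<delta> k \<le> 1 / 2)" for \<delta> :: "nat \<Rightarrow> real"
  proof
    assume "\<forall>k. real (Suc k) powr (- 1 / 24 + \<epsilon>) \<le> \<delta> k \<and> \<delta> k \<le> 1 / 2"
    then have "real (Suc 0) powr (- 1 / 24 + \<epsilon>) \<le> \<delta> 0" "\<delta> 0 \<le> 1 / 2" by blast+
    then show False by simp
  qed
  then show ?thesis using False by (intro exI[of _ Suc]) (auto simp: strict_mono_Suc_iff)
next
  case \<epsilon>: True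
  define r where "r = nat \<lceil>4 / \<epsilon>\<rceil>"
  have r: "real r * \<epsilon> \<ge> 4" "r \<ge> 1"
  proof -
    have *: "4 / \<epsilon> \<le> real r" unfolding r_def by (rule real_nat_ceiling_ge)
    then show "real r * \<epsilon> \<ge> 4" using assms(2) by (simp add: field_simps)
    have "4 / \<epsilon> > 0" using assms(2) by simp
    then show "r \<ge> 1" using * by (cases r) auto
  qed
  obtain c where c: "c > 0" and blocks: "eventually (\<lambda>X :: real. \<exists>j :: nat. X < 2 ^ j \<and> 2 ^ j \<le> 2 * X powr (6 / 5) \<and>
     c * 2 ^ j / ln (2 ^ j) \<le> real (card (gauss_primes_dyadic (2 ^ j)))) at_top"
    by (rule many_primes_in_some_dyadic_block)
  obtain X0 where X0: "\<And>X :: real. X \<ge> X0 \<Longrightarrow> \<exists>j :: nat. X < 2 ^ j \<and> 2 ^ j \<le> 2 * X powr (6 / 5) \<and>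
     c * 2 ^ j / ln (2 ^ j) \<le> real (card (gauss_primes_dyadic (2 ^ j)))"
    using blocks unfolding eventually_at_top_linorder by blast
  define err where "err x = 6 * x powr (- \<epsilon> / 4) + 3 / 2 * real r * x powr (- 15 / 8)
     + 288 * 10 ^ 8 * (real r)\<^sup>2 / c * (1 + ln x) ^ 6 * x powr (- \<epsilon>)" for x :: real
  have err0: "(err \<longlongrightarrow> 0) at_top"
  proof -
    have "((\<lambda>x :: real. x powr (- \<epsilon> / 4)) \<longlongrightarrow> 0) at_top" "((\<lambda>x :: real. x powr (- 15 / 8)) \<longlongrightarrow> 0) at_top"
      "((\<lambda>x :: real. (1 + ln x) ^ 6 * x powr (- \<epsilon>)) \<longlongrightarrow> 0) at_top"
      using assms(2) by real_asymp+
    then have "((\<lambda>x. 6 * x powr (- \<epsilon> / 4) + 3 / 2 * real r * x powr (- 15 / 8)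
       + 288 * 10 ^ 8 * (real r)\<^sup>2 / c * ((1 + ln x) ^ 6 * x powr (- \<epsilon>))) \<longlongrightarrow>
       6 * 0 + 3 / 2 * real r * 0 + 288 * 10 ^ 8 * (real r)\<^sup>2 / c * 0) at_top"
      by (intro tendsto_intros)
    then show ?thesis unfolding err_def by (simp only: mult.assoc mult_zero_right add_0_right)
  qed
  define large where "large x \<longleftrightarrow> x \<ge> 64 \<and> 1152 * (real r)\<^sup>2 \<le> x powr \<epsilon> \<and> 3 * real r * x powr (1 / 24 - 2) \<le> 1 \<and>
    x powr (- \<epsilon> / 4) \<le> 1 / 3 \<and> x powr (- 1 / 24 + \<epsilon>) \<le> 1 / 2" for x :: real
  have "eventually large at_top"
  proof -
    have "filterlim (\<lambda>x :: real. x powr \<epsilon>) at_top at_top" using assms(2) by real_asymp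
    then have 1: "eventually (\<lambda>x :: real. 1152 * (real r)\<^sup>2 \<le> x powr \<epsilon>) at_top" by (simp add: filterlim_at_top)
    have "((\<lambda>x :: real. 3 * real r * x powr (1 / 24 - 2)) \<longlongrightarrow> 3 * real r * 0) at_top"
      by (intro tendsto_mult_left) real_asymp
    then have 2: "eventually (\<lambda>x :: real. 3 * real r * x powr (1 / 24 - 2) < 1) at_top"
      by (rule order_tendstoD(2)) simp
    have "((\<lambda>x :: real. x powr (- \<epsilon> / 4)) \<longlongrightarrow> 0) at_top" using assms(2) by real_asymp
    then have 3: "eventually (\<lambda>x :: real. x powr (- \<epsilon> / 4) < 1 / 3) at_top" by (rule order_tendstoD(2)) simp
    have "- 1 / 24 + \<epsilon> < 0" using \<epsilon> by simp
    then have "((\<lambda>x :: real. x powr (- 1 / 24 + \<epsilon>)) \<longlongrightarrow> 0) at_top" by (rule tendsto_neg_powr) (rule filterlim_ident)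
    then have 4: "eventually (\<lambda>x :: real. x powr (- 1 / 24 + \<epsilon>) < 1 / 2) at_top" by (rule order_tendstoD(2)) simp
    show ?thesis using 1 2 3 4 eventually_ge_at_top[of 64]
      by eventually_elim (simp add: large_def)
  qed
  then obtain X1 where X1: "\<And>x. x \<ge> X1 \<Longrightarrow> large x" unfolding eventually_at_top_linorder by blast
  \<comment> \<open>All admissible moduli at once, whatever approximation n serves them. This set is
    independent of \<delta>; its increasing enumeration is the sequence sought, and each k selects
    its own n afterwards.\<close>
  define S where "S = {N :: nat. large (real N) \<and> (\<exists>n \<ge> 1. spaced_freq \<theta> (n / 16) (1 / (4 * sqrt n)) \<and>
     n powr (5 / 2) \<le> real N \<and> real N \<le> 2 * n ^ 3 \<and> c * real N / ln (real N) \<le> real (card (gauss_primes_dyadic N)))}"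
  have "\<exists>N \<in> S. N > M" for M
  proof -
    obtain n where n: "n \<ge> max (real M) (max X0 X1)" "n \<ge> 1" "spaced_freq \<theta> (n / 16) (1 / (4 * sqrt n))"
      by (rule spaced_freq_arbitrarily_large[OF assms(1)])
    have np: "n \<le> n powr (5 / 2)" using n(2) powr_mono[of 1 "5 / 2" n] by simp
    obtain j :: nat where j: "n powr (5 / 2) < 2 ^ j" "2 ^ j \<le> 2 * (n powr (5 / 2)) powr (6 / 5)"
      "c * 2 ^ j / ln (2 ^ j) \<le> real (card (gauss_primes_dyadic (2 ^ j)))"
      using X0[of "n powr (5 / 2)"] n(1) np by auto
    \<comment> \<open>The prime block found above n^(5/2) thus lies below 2 n^3, exactly the window
      in which n is usable.\<close>
    have "(n powr (5 / 2)) powr (6 / 5) = n ^ 3" using n(2) by (simp add: powr_powr)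
    then have "2 ^ j \<in> S" unfolding S_def using j n np X1[of "2 ^ j"] by (auto intro!: exI[of _ n])
    moreover have "M < 2 ^ j"
    proof -
      have "real M < 2 ^ j" using j(1) np n(1) by linarith
      then show ?thesis by (simp only: of_nat_less_iff[symmetric, where ?'a = real] of_nat_power of_nat_numeral)
    qed
    ultimately show ?thesis by blast
  qed
  then have "infinite S" unfolding infinite_nat_iff_unbounded by blast
  then obtain N :: "nat \<Rightarrow> nat" where N: "strict_mono N" "\<And>k. N k \<in> S"
    using infinite_enumerate by blast
  have large: "large (real (N k))" for k using N(2)[of k] by (simp add: S_def)
  have "(\<lambda>k. \<Sum>p | p \<in> gauss_primes_dyadic (N k) \<and> dist_gauss (complex_of_gauss p * \<theta>) \<le> \<delta> k. 1 :: real)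
      \<sim>[sequentially] (\<lambda>k. 4 * (\<delta> k)\<^sup>2 * (\<Sum>p \<in> gauss_primes_dyadic (N k). 1))"
    if \<delta>: "\<And>k. real (N k) powr (- 1 / 24 + \<epsilon>) \<le> \<delta> k \<and> \<delta> k \<le> 1 / 2" for \<delta> :: "nat \<Rightarrow> real"
  proof (rule asymp_equivI')
    define q where "q k = (\<Sum>p | p \<in> gauss_primes_dyadic (N k) \<and> dist_gauss (complex_of_gauss p * \<theta>) \<le> \<delta> k. 1 :: real)
      / (4 * (\<delta> k)\<^sup>2 * (\<Sum>p \<in> gauss_primes_dyadic (N k). 1))" for k
    have "\<bar>q k - 1\<bar> \<le> err (real (N k))" for k
    proof -
      obtain n where n: "n \<ge> 1" "spaced_freq \<theta> (n / 16) (1 / (4 * sqrt n))"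
         "n powr (5 / 2) \<le> real (N k)" "real (N k) \<le> 2 * n ^ 3" "c * real (N k) / ln (real (N k)) \<le> real (card (gauss_primes_dyadic (N k)))"
        using N(2)[of k] unfolding S_def by blast
      have lk: "real (N k) \<ge> 64" "1152 * (real r)\<^sup>2 \<le> real (N k) powr \<epsilon>" "3 * real r * real (N k) powr (1 / 24 - 2) \<le> 1"
        "real (N k) powr (- \<epsilon> / 4) \<le> 1 / 3" using large[of k] by (simp_all add: large_def)
      show ?thesis
        using discrepancy_bound[OF assms(2) \<epsilon> r(2,1) lk(1) c lk(2-4) n(2) n(1) n(3-5) conjunct1[OF \<delta>] conjunct2[OF \<delta>]]
        by (simp add: q_def err_def)
    qed
    moreover have "(\<lambda>k. err (real (N k))) \<longlonglongrightarrow> 0"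
    proof (rule filterlim_compose[OF err0])
      show "filterlim (\<lambda>k. real (N k)) at_top sequentially"
        using filterlim_compose[OF filterlim_real_sequentially filterlim_subseq[OF N(1)]] .
    qed
    ultimately have "(\<lambda>k. q k - 1) \<longlonglongrightarrow> 0"
      by (intro Lim_null_comparison[of "\<lambda>k. q k - 1" "\<lambda>k. err (real (N k))"] always_eventually) (auto simp: real_norm_def)
    from tendsto_add[OF this tendsto_const[of 1]] show "q \<longlonglongrightarrow> 1" by simp
  qed
  moreover have "N k > 0" "real (N k) powr (- 1 / 24 + \<epsilon>) \<le> 1 / 2" for k
  proof -
    have "real (N k) \<ge> 64" using large[of k] by (simp add: large_def)
    then show "N k > 0" by (cases "N k") auto
    show "real (N k) powr (- 1 / 24 + \<epsilon>) \<le> 1 / 2" using large[of k] by (simp add: large_def)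
  qed
  ultimately show ?thesis using N(1) by (intro exI[of _ N]) auto
qed

end
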